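(* Assume $4N\mu\geq 1/2$. Then the closure $\bar{\mathcal L}$ of the operator $\mathcal L$ generates a strongly continuous contraction semigroup on $L^2(\Omega_{\mathbf y})$.
   Context: Fix $N>0$, an integer $L\geq 1$, real numbers $\gamma_1,\dots,\gamma_L,\eta_1,\dots,\eta_L$ and $\mu>0$. Let $\xi(s)=s(1-s)$ and $\xi'(s)=1-2s$ for $s\in(0,1)$. Set $\Phi(\mathbf x) = -\sum_{i=1}^L \gamma_i \xi'(x_i) + 2\sum_{i=1}^L \eta_i\xi(x_i) + 2\mu\sum_{i=1}^L \ln\xi(x_i)$ for $\mathbf x\in(0,1)^L$. Let $Y_N = 2\pi\sqrt N$, $\Omega_{\mathbf y}=(0,Y_N)^L$, and for $\mathbf y\in\Omega_{\mathbf y}$ let $\mathbf x(\mathbf y)$ be given componentwise by $x_i = \sin^2\!\big(y_i/(4\sqrt N)\big)$. Let $J(\mathbf x) = (2\sqrt N)^{-L}\prod_{i=1}^L \xi(x_i)^{1/2}$, $W(\mathbf y) = \sum_{i=1}^L \ln \xi(x_i(\mathbf y)) - 2N\,\Phi(\mathbf x(\mathbf y)) - \ln J(\mathbf x(\mathbf y))$, and $\bar u(\mathbf y) = e^{-W(\mathbf y)}/\int_{\Omega_{\mathbf y}} e^{-W}\,\mathrm d\mathbf y$. Define $\mathcal{H}_{\mathbf y} = \{ z\in L^2(\Omega_{\mathbf y}) : \int_{\Omega_{\mathbf y}} |\nabla_{\mathbf y}(z/\sqrt{\bar u})|^2\,\bar u\,\mathrm d\mathbf y <\infty\}$. The operator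 $\mathcal L$ on $L^2(\Omega_{\mathbf y})$ has domain $D(\mathcal L)$ consisting of those $z\in\mathcal H_{\mathbf y}$ for which there is $g\in L^2(\Omega_{\mathbf y})$ with $-\int_{\Omega_{\mathbf y}} \nabla_{\mathbf y}(z/\sqrt{\bar u})\cdot\nabla_{\mathbf y}(\psi/\sqrt{\bar u})\,\bar u\,\mathrm d\mathbf y = \int_{\Omega_{\mathbf y}} g\psi\,\mathrm d\mathbf y$ for all $\psi\in\mathcal H_{\mathbf y}$, and then $\mathcal L z = g$. (This is the weak form, in transformed coordinates $z = J u/\sqrt{\bar u}$, of the Fokker–Planck equation $\partial_t u = \frac{1}{4N}\sum_i\partial_{x_i}\big(\xi(x_i) u_\alpha \partial_{x_i}(u/u_\alpha)\big)$ on $(0,1)^L$ with no-flux boundary condition, where $u_\alpha\propto e^{2N\Phi}/\prod_i\xi(x_i)$.) *)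

theory Defs
  imports "HOL-Analysis.Analysis"
begin

definition xi :: "real \<Rightarrow> real" where "xi s = s * (1 - s)"
definition xi' :: "real \<Rightarrow> real" where "xi' s = 1 - 2 * s"

definition Phi :: "real^'n \<Rightarrow> real^'n \<Rightarrow> real \<Rightarrow> real^'n \<Rightarrow> real" where
  "Phi \<gamma> \<eta> \<mu> x =
     - (\<Sum>i\<in>UNIV. \<gamma>$i * xi' (x$i)) + 2 * (\<Sum>i\<in>UNIV. \<eta>$i * xi (x$i))
     + 2 * \<mu> * (\<Sum>i\<in>UNIV. ln (xi (x$i)))"

definition YN :: "real \<Rightarrow> real" where "YN N = 2 * pi * sqrt N"

definition Omega_y :: "real \<Rightarrow> (real^'n) set" where
  "Omega_y N = box 0 (\<chi> i. YN N)"

definition xmap :: "real \<Rightarrow> real^'n \<Rightarrow> real^'n" where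
  "xmap N y = (\<chi> i. (sin (y$i / (4 * sqrt N)))\<^sup>2)"

definition Jac :: "real \<Rightarrow> real^'n \<Rightarrow> real" where
  "Jac N x = inverse ((2 * sqrt N) ^ CARD('n)) * (\<Prod>i\<in>UNIV. sqrt (xi (x$i)))"

definition W :: "real \<Rightarrow> real^'n \<Rightarrow> real^'n \<Rightarrow> real \<Rightarrow> real^'n \<Rightarrow> real" where
  "W N \<gamma> \<eta> \<mu> y =
     (\<Sum>i\<in>UNIV. ln (xi (xmap N y $ i))) - 2 * N * Phi \<gamma> \<eta> \<mu> (xmap N y)
     - ln (Jac N (xmap N y))"

definition ubar :: "real \<Rightarrow> real^'n \<Rightarrow> real^'n \<Rightarrow> real \<Rightarrow> real^'n \<Rightarrow> real" where
  "ubar N \<gamma> \<eta> \<mu> y =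
     exp (- W N \<gamma> \<eta> \<mu> y) / (LINT v:Omega_y N|lborel. exp (- W N \<gamma> \<eta> \<mu> v))"

definition L2 :: "('a::euclidean_space) set \<Rightarrow> ('a \<Rightarrow> real) set" where
  "L2 S = {f. f \<in> borel_measurable (lebesgue_on S) \<and> integrable (lebesgue_on S) (\<lambda>y. (f y)\<^sup>2)}"

definition L2norm :: "('a::euclidean_space) set \<Rightarrow> ('a \<Rightarrow> real) \<Rightarrow> real" where
  "L2norm S f = sqrt (integral\<^sup>L (lebesgue_on S) (\<lambda>y. (f y)\<^sup>2))"

definition ae_eq :: "('a::euclidean_space) set \<Rightarrow> ('a \<Rightarrow> real) \<Rightarrow> ('a \<Rightarrow> real) \<Rightarrow> bool" where
  "ae_eq S f g \<longleftrightarrow> (AE y in lebesgue_on S. f y = g y)"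

definition pderiv_i :: "'n \<Rightarrow> (real^'n \<Rightarrow> real) \<Rightarrow> real^'n \<Rightarrow> real" where
  "pderiv_i i f y = frechet_derivative f (at y) (axis i 1)"

fun Ck :: "nat \<Rightarrow> (real^'n \<Rightarrow> real) \<Rightarrow> bool" where
  "Ck 0 f = continuous_on UNIV f"
| "Ck (Suc k) f = ((\<forall>y. f differentiable (at y)) \<and> continuous_on UNIV f
                    \<and> (\<forall>i. Ck k (pderiv_i i f)))"

definition smooth :: "(real^'n \<Rightarrow> real) \<Rightarrow> bool" where
  "smooth f \<longleftrightarrow> (\<forall>k. Ck k f)"

definition tsupport :: "(real^'n \<Rightarrow> real) \<Rightarrow> (real^'n) set" where
  "tsupport f = closure {y. f y \<noteq> 0}"

definition test_fun :: "(real^'n) set \<Rightarrow> (real^'n \<Rightarrow> real) \<Rightarrow> bool" where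
  "test_fun S \<phi> \<longleftrightarrow> smooth \<phi> \<and> compact (tsupport \<phi>) \<and> tsupport \<phi> \<subseteq> S"

definition loc_integrable :: "(real^'n) set \<Rightarrow> (real^'n \<Rightarrow> real) \<Rightarrow> bool" where
  "loc_integrable S f \<longleftrightarrow> (\<forall>K. compact K \<and> K \<subseteq> S \<longrightarrow> integrable (lebesgue_on K) f)"

definition weak_grad :: "(real^'n) set \<Rightarrow> (real^'n \<Rightarrow> real) \<Rightarrow> (real^'n \<Rightarrow> real^'n) \<Rightarrow> bool" where
  "weak_grad S f g \<longleftrightarrow> loc_integrable S f \<and> (\<forall>i. loc_integrable S (\<lambda>y. g y $ i)) \<and>
     (\<forall>\<phi> i. test_fun S \<phi> \<longrightarrow>
        integral\<^sup>L (lebesgue_on S) (\<lambda>y. f y * pderiv_i i \<phi> y)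
        = - integral\<^sup>L (lebesgue_on S) (\<lambda>y. g y $ i * \<phi> y))"

definition Hy :: "real \<Rightarrow> real^'n \<Rightarrow> real^'n \<Rightarrow> real \<Rightarrow> (real^'n \<Rightarrow> real) set" where
  "Hy N \<gamma> \<eta> \<mu> = {z. z \<in> L2 (Omega_y N) \<and>
      (\<exists>G. weak_grad (Omega_y N) (\<lambda>y. z y / sqrt (ubar N \<gamma> \<eta> \<mu> y)) G \<and>
           integrable (lebesgue_on (Omega_y N)) (\<lambda>y. (norm (G y))\<^sup>2 * ubar N \<gamma> \<eta> \<mu> y))}"

text \<open>Graph of the operator L: Lop z g means z in D(L) and L z = g.
  The weak gradient is unique a.e., so quantifying over all weak gradients is harmless.\<close>
definition Lop :: "real \<Rightarrow> real^'n \<Rightarrow> real^'n \<Rightarrow> real \<Rightarrow>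
                   (real^'n \<Rightarrow> real) \<Rightarrow> (real^'n \<Rightarrow> real) \<Rightarrow> bool" where
  "Lop N \<gamma> \<eta> \<mu> z g \<longleftrightarrow> z \<in> Hy N \<gamma> \<eta> \<mu> \<and> g \<in> L2 (Omega_y N) \<and>
     (\<forall>\<psi> Gz G\<psi>. \<psi> \<in> Hy N \<gamma> \<eta> \<mu>
        \<and> weak_grad (Omega_y N) (\<lambda>y. z y / sqrt (ubar N \<gamma> \<eta> \<mu> y)) Gz
        \<and> weak_grad (Omega_y N) (\<lambda>y. \<psi> y / sqrt (ubar N \<gamma> \<eta> \<mu> y)) G\<psi> \<longrightarrow>
        - integral\<^sup>L (lebesgue_on (Omega_y N)) (\<lambda>y. (Gz y \<bullet> G\<psi> y) * ubar N \<gamma> \<eta> \<mu> y)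
        = integral\<^sup>L (lebesgue_on (Omega_y N)) (\<lambda>y. g y * \<psi> y))"

definition op_closure :: "('a::euclidean_space) set \<Rightarrow> (('a \<Rightarrow> real) \<Rightarrow> ('a \<Rightarrow> real) \<Rightarrow> bool)
     \<Rightarrow> ('a \<Rightarrow> real) \<Rightarrow> ('a \<Rightarrow> real) \<Rightarrow> bool" where
  "op_closure S A f g \<longleftrightarrow> f \<in> L2 S \<and> g \<in> L2 S \<and>
     (\<exists>fs gs. (\<forall>n. A (fs n) (gs n)) \<and>
        (\<lambda>n. L2norm S (\<lambda>y. fs n y - f y)) \<longlonglongrightarrow> 0 \<and>
        (\<lambda>n. L2norm S (\<lambda>y. gs n y - g y)) \<longlonglongrightarrow> 0)"

definition C0_contraction_semigroup :: "('a::euclidean_space) set \<Rightarrow>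
      (real \<Rightarrow> ('a \<Rightarrow> real) \<Rightarrow> ('a \<Rightarrow> real)) \<Rightarrow> bool" where
  "C0_contraction_semigroup S T \<longleftrightarrow>
     (\<forall>t\<ge>0. \<forall>f\<in>L2 S. T t f \<in> L2 S) \<and>
     (\<forall>t\<ge>0. \<forall>f\<in>L2 S. \<forall>g\<in>L2 S. ae_eq S f g \<longrightarrow> ae_eq S (T t f) (T t g)) \<and>
     (\<forall>t\<ge>0. \<forall>f\<in>L2 S. \<forall>g\<in>L2 S. \<forall>a b::real.
        ae_eq S (T t (\<lambda>y. a * f y + b * g y)) (\<lambda>y. a * T t f y + b * T t g y)) \<and>
     (\<forall>f\<in>L2 S. ae_eq S (T 0 f) f) \<and>
     (\<forall>s\<ge>0. \<forall>t\<ge>0. \<forall>f\<in>L2 S. ae_eq S (T (s + t) f) (T s (T t f))) \<and>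
     (\<forall>t\<ge>0. \<forall>f\<in>L2 S. L2norm S (T t f) \<le> L2norm S f) \<and>
     (\<forall>f\<in>L2 S. ((\<lambda>t. L2norm S (\<lambda>y. T t f y - f y)) \<longlongrightarrow> 0) (at_right 0))"

definition generator :: "('a::euclidean_space) set \<Rightarrow>
      (real \<Rightarrow> ('a \<Rightarrow> real) \<Rightarrow> ('a \<Rightarrow> real)) \<Rightarrow> ('a \<Rightarrow> real) \<Rightarrow> ('a \<Rightarrow> real) \<Rightarrow> bool" where
  "generator S T f g \<longleftrightarrow> f \<in> L2 S \<and> g \<in> L2 S \<and>
     ((\<lambda>h. L2norm S (\<lambda>y. (T h f y - f y) / h - g y)) \<longlongrightarrow> 0) (at_right 0)"

definition graph_eq :: "('a::euclidean_space) set \<Rightarrow>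
      (('a \<Rightarrow> real) \<Rightarrow> ('a \<Rightarrow> real) \<Rightarrow> bool) \<Rightarrow> (('a \<Rightarrow> real) \<Rightarrow> ('a \<Rightarrow> real) \<Rightarrow> bool) \<Rightarrow> bool" where
  "graph_eq S A B \<longleftrightarrow>
     (\<forall>f g. A f g \<longrightarrow> (\<exists>f' g'. B f' g' \<and> ae_eq S f f' \<and> ae_eq S g g')) \<and>
     (\<forall>f g. B f g \<longrightarrow> (\<exists>f' g'. A f' g' \<and> ae_eq S f f' \<and> ae_eq S g g'))"

definition generates_C0_contraction_semigroup :: "('a::euclidean_space) set \<Rightarrow>
      (('a \<Rightarrow> real) \<Rightarrow> ('a \<Rightarrow> real) \<Rightarrow> bool) \<Rightarrow> bool" where
  "generates_C0_contraction_semigroup S A \<longleftrightarrow>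
     (\<exists>T. C0_contraction_semigroup S T \<and> graph_eq S (generator S T) A)"

end

theory Submission
  imports Defs "HOL-Computational_Algebra.Polynomial"
begin

text \<open>
  Write \<open>\<rho>\<close> for the square root of the stationary density and \<open>D z = \<rho> \<nabla>(z / \<rho>)\<close>, with the weak
  gradient. Testing against \<open>\<phi> / \<rho>\<close>, which is square integrable because \<open>\<rho>\<close> is continuous and
  positive on the open box, shows that \<open>D\<close> is closed; it is densely defined because its domain
  contains all \<open>\<rho> \<phi>\<close>. The operator of the theorem is \<open>- D\<^sup>* D\<close>, hence by von Neumann's argument
  dissipative, densely defined and with \<open>1 - h A\<close> surjective for all \<open>h > 0\<close>. In particular it is
  already closed. The semigroup is obtained as the limit of \<open>(1 - (t / 2\<^sup>m) A)\<close> to the power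
  \<open>- 2\<^sup>m\<close>. The hypothesis \<open>4 N \<mu> \<ge> 1/2\<close> bounds \<open>e\<close> to the power \<open>- W\<close>, which makes the normalising
  integral finite and positive.
\<close>

section \<open>Semigroups generated by m-dissipative operators\<close>

text \<open>By the definitions, the density is a factor bounded from both sides times the product of
  all \<open>xi (x$i)\<close> to the power \<open>4 * N * \<mu> - 1/2\<close>. It may vanish at the
  boundary, where \<open>1 / \<rho>\<close> is then unbounded, so weak gradients are tested only
  with compactly supported functions; the no-flux condition sits in the adjoint, because the form is
  tested against the whole form domain. Dyadic step numbers make consecutive approximations
  comparable: halving a step replaces \<open>J (2 h)\<close> by \<open>J h\<close> applied twice,
  which costs order \<open>h\<^sup>2\<close> on the domain of \<open>A\<^sup>2\<close>, so all
  refinements together form a geometric series. Contractivity and density carry the limit to every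
  vector. The operator of the statement is defined through functions and all their weak gradients,
  the Hilbert space argument through equivalence classes; the bridge is that weak gradients are
  unique almost everywhere, by the fundamental lemma of the calculus of variations, which is derived
  from smooth bumps that tend to indicators of boxes.\<close>

lemma norm_triangle_add_diff:
  fixes a b c :: "'h::real_normed_vector"
  shows "norm (a + b - c) \<le> norm a + norm b + norm c"
  using norm_triangle_ineq4[of "a + b" c] norm_triangle_ineq[of a b] by linarith

section \<open>Powers of commuting contractions\<close>

lemma funpow_contraction:
  fixes P :: "'h::real_normed_vector \<Rightarrow> 'h"
  assumes "\<And>x. norm (P x) \<le> norm x"
  shows "norm ((P ^^ n) x) \<le> norm x"
  by (induction n) (auto intro: order_trans[OF assms])

lemma linear_funpow:
  fixes P :: "'h::real_vector \<Rightarrow> 'h"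
  assumes "linear P"
  shows "linear (P ^^ n)"
proof (induction n)
  case 0
  show ?case by (simp add: linear_id[unfolded id_def] id_def)
next
  case (Suc n)
  show ?case using linear_compose[OF Suc assms] by (simp add: o_def)
qed

lemma funpow_commute:
  assumes "\<And>x. P (Q x) = Q (P x)"
  shows "P ((Q ^^ n) x) = (Q ^^ n) (P x)"
  by (induction n) (auto simp: assms)

lemma funpow_mult_commute:
  assumes "\<And>x. P (Q x) = Q (P x)"
  shows "((\<lambda>x. P (Q x)) ^^ n) x = (P ^^ n) ((Q ^^ n) x)"
  by (induction n) (auto simp: funpow_commute[of Q P, OF assms[symmetric]])

text \<open>Telescoping: each of the \<open>n\<close> exchanges of one \<open>P\<close> for one
  \<open>Q\<close> leaves, after commuting, a product of contractions applied to
  \<open>P x - Q x\<close>. The bound is linear in \<open>n\<close>, so a single-step error of order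
  \<open>1 / n\<^sup>2\<close> gives a total error of order \<open>1 / n\<close>.\<close>

lemma funpow_diff_le:
  fixes P Q :: "'h::real_normed_vector \<Rightarrow> 'h"
  assumes P: "linear P" "\<And>x. norm (P x) \<le> norm x"
    and Q: "linear Q" "\<And>x. norm (Q x) \<le> norm x"
    and comm: "\<And>x. P (Q x) = Q (P x)"
  shows "norm ((P ^^ n) x - (Q ^^ n) x) \<le> real n * norm (P x - Q x)"
proof (induction n)
  case 0
  show ?case by simp
next
  case (Suc n)
  have "(P ^^ Suc n) x - (Q ^^ Suc n) x = P ((P ^^ n) x - (Q ^^ n) x) + (Q ^^ n) (P x - Q x)"
    using funpow_commute[of P Q n x, OF comm]
    by (simp add: linear_diff[OF P(1)] linear_diff[OF linear_funpow[OF Q(1)]] funpow_swap1)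
  then have "norm ((P ^^ Suc n) x - (Q ^^ Suc n) x)
      \<le> norm (P ((P ^^ n) x - (Q ^^ n) x)) + norm ((Q ^^ n) (P x - Q x))"
    by (metis norm_triangle_ineq)
  also have "\<dots> \<le> norm ((P ^^ n) x - (Q ^^ n) x) + norm (P x - Q x)"
    by (intro add_mono P(2) funpow_contraction Q(2))
  also have "\<dots> \<le> real (Suc n) * norm (P x - Q x)"
    using Suc by (simp add: algebra_simps)
  finally show ?case .
qed

text \<open>Transfers the Cauchy property of the approximations from the dense domain of
  \<open>A\<^sup>2\<close> to every vector.\<close>

lemma Cauchy_if_approximable:
  fixes f :: "nat \<Rightarrow> 'h::real_normed_vector"
  assumes "\<And>e. e > 0 \<Longrightarrow> \<exists>g. Cauchy g \<and> (\<forall>n. norm (f n - g n) < e)"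
  shows "Cauchy f"
proof (rule CauchyI)
  fix e :: real assume "e > 0"
  then obtain g where g: "Cauchy g" "\<And>n. norm (f n - g n) < e / 3"
    using assms[of "e / 3"] by auto
  obtain M where M: "\<And>m n. m \<ge> M \<Longrightarrow> n \<ge> M \<Longrightarrow> norm (g m - g n) < e / 3"
    using CauchyD[OF g(1), of "e / 3"] \<open>e > 0\<close> by auto
  have "norm (f m - f n) < e" if "m \<ge> M" "n \<ge> M" for m n
  proof -
    have "f m - f n = (f m - g m) + (g m - g n) - (f n - g n)" by simp
    then have "norm (f m - f n) \<le> norm (f m - g m) + norm (g m - g n) + norm (f n - g n)"
      by (metis norm_triangle_add_diff)
    then show ?thesis using g(2)[of m] g(2)[of n] M[OF that] by linarith
  qed
  then show "\<exists>M. \<forall>m\<ge>M. \<forall>n\<ge>M. norm (f m - f n) < e" by blast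
qed

text \<open>A partial operator is represented by its graph, which turns adjoints and closedness into
  statements about subspaces of a product.\<close>

locale m_dissipative =
  fixes A :: "('h::{real_inner,complete_space} \<times> 'h) set"
  assumes subspace: "subspace A"
    and dissipative: "(x, y) \<in> A \<Longrightarrow> x \<bullet> y \<le> 0"
    and range: "h > 0 \<Longrightarrow> \<exists>x y. (x, y) \<in> A \<and> x - h *\<^sub>R y = f"
    and dense: "closure (fst ` A) = UNIV"
begin

lemma add: "(x, y) \<in> A \<Longrightarrow> (x', y') \<in> A \<Longrightarrow> (x + x', y + y') \<in> A"
  using subspace_add[OF subspace] by fastforce

lemma diff: "(x, y) \<in> A \<Longrightarrow> (x', y') \<in> A \<Longrightarrow> (x - x', y - y') \<in> A"
  using subspace_diff[OF subspace] by fastforce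

lemma scale: "(x, y) \<in> A \<Longrightarrow> (c *\<^sub>R x, c *\<^sub>R y) \<in> A"
  using subspace_scale[OF subspace] by fastforce

text \<open>Dissipativity gives \<open>x \<bullet> x \<le> x \<bullet> (x - h y)\<close>, and
  Cauchy-Schwarz does the rest. This yields injectivity of \<open>1 - h A\<close>, contractivity of
  its inverse and closedness of the graph.\<close>

lemma norm_le_resolvent:
  assumes "(x, y) \<in> A" "h \<ge> 0"
  shows "norm x \<le> norm (x - h *\<^sub>R y)"
proof (cases "x = 0")
  case False
  have "norm x * norm x = x \<bullet> x" by (simp add: dot_square_norm power2_eq_square)
  also have "\<dots> \<le> x \<bullet> (x - h *\<^sub>R y)"
    using mult_nonneg_nonpos[OF assms(2) dissipative[OF assms(1)]] by (simp add: inner_diff_right)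
  also have "\<dots> \<le> norm x * norm (x - h *\<^sub>R y)" by (rule norm_cauchy_schwarz)
  finally show ?thesis using False by simp
qed simp

lemma resolvent_unique:
  assumes "(x, y) \<in> A" "(x', y') \<in> A" "h \<ge> 0" "x - h *\<^sub>R y = x' - h *\<^sub>R y'"
  shows "x = x'"
  using norm_le_resolvent[OF diff[OF assms(1,2)] assms(3)] assms(4) by (simp add: algebra_simps)

text \<open>The resolvent, that is the inverse of \<open>1 - h A\<close>: one backward Euler step.
  The value \<open>f\<close> for \<open>h \<le> 0\<close> makes \<open>J h\<close> the identity
  there, so that linearity and contractivity hold for every \<open>h\<close>.\<close>

definition J :: "real \<Rightarrow> 'h \<Rightarrow> 'h" where
  "J h f = (if h > 0 then THE x. \<exists>y. (x, y) \<in> A \<and> x - h *\<^sub>R y = f else f)"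

lemma J_eqI:
  assumes "(x, y) \<in> A" "x - h *\<^sub>R y = f" "h > 0"
  shows "J h f = x"
  unfolding J_def using assms resolvent_unique[of _ _ _ _ h]
  by (auto intro!: the_equality)

lemma J_nonpos [simp]: "h \<le> 0 \<Longrightarrow> J h f = f"
  by (simp add: J_def)

lemma J_obtain:
  assumes "h > 0"
  obtains y where "(J h f, y) \<in> A" "J h f - h *\<^sub>R y = f"
  using range[OF assms] J_eqI[OF _ _ assms] by metis

lemma norm_J: "norm (J h f) \<le> norm f"
proof (cases "h > 0")
  case True
  then obtain y where "(J h f, y) \<in> A" "J h f - h *\<^sub>R y = f" by (rule J_obtain)
  then show ?thesis using norm_le_resolvent True by (metis less_imp_le)
qed simp

lemma linear_J: "linear (J h)"
proof (cases "h > 0")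
  case True
  show ?thesis
  proof
    fix f g :: 'h and c :: real
    obtain y where y: "(J h f, y) \<in> A" "J h f - h *\<^sub>R y = f" using True by (rule J_obtain)
    obtain z where z: "(J h g, z) \<in> A" "J h g - h *\<^sub>R z = g" using True by (rule J_obtain)
    show "J h (f + g) = J h f + J h g"
      by (rule J_eqI[OF add[OF y(1) z(1)] _ True]) (use y(2) z(2) in \<open>simp add: algebra_simps\<close>)
    show "J h (c *\<^sub>R f) = c *\<^sub>R J h f"
    proof (rule J_eqI[OF scale[OF y(1)] _ True])
      have "c *\<^sub>R J h f - h *\<^sub>R c *\<^sub>R y = c *\<^sub>R (J h f - h *\<^sub>R y)" by (simp add: algebra_simps)
      then show "c *\<^sub>R J h f - h *\<^sub>R c *\<^sub>R y = c *\<^sub>R f" using y(2) by simp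
    qed
  qed
next
  case False
  then have "J h = (\<lambda>x. x)" by auto
  then show ?thesis by (simp add: linear_id[unfolded id_def])
qed

text \<open>With \<open>q = A (J h u) = (J h u - u) / h\<close>, both terms of the difference lie in
  the domain, so \<open>A q\<close> exists and \<open>q - h A q = v\<close>, that is
  \<open>q = J h v\<close>.\<close>

lemma J_graph:
  assumes uv: "(u, v) \<in> A"
  shows "(J h u, J h v) \<in> A" and "h \<ge> 0 \<Longrightarrow> J h u - u = h *\<^sub>R J h v"
proof -
  have *: "(J h u, J h v) \<in> A \<and> J h u - u = h *\<^sub>R J h v" if h: "h > 0"
  proof -
    obtain q where q: "(J h u, q) \<in> A" "J h u - h *\<^sub>R q = u" using h by (rule J_obtain)
    have eq: "(1/h) *\<^sub>R (J h u - u) = q"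
    proof -
      have "J h u - u = h *\<^sub>R q" using q(2) by (simp add: algebra_simps)
      then show ?thesis using h by simp
    qed
    have "(q, (1/h) *\<^sub>R (q - v)) \<in> A"
      using scale[OF diff[OF q(1) uv], of "1/h"] eq by simp
    then have "J h v = q" by (rule J_eqI) (use h in auto)
    then show ?thesis using q by (auto simp: algebra_simps)
  qed
  show "(J h u, J h v) \<in> A" using * uv by (cases "h > 0") auto
  show "h \<ge> 0 \<Longrightarrow> J h u - u = h *\<^sub>R J h v" using * uv by (cases "h > 0") auto
qed

lemma J_commute: "J s (J t f) = J t (J s f)"
proof (cases "t > 0")
  case True
  then obtain y where y: "(J t f, y) \<in> A" "J t f - t *\<^sub>R y = f" by (rule J_obtain)
  have "J s (J t f) - t *\<^sub>R J s y = J s f"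
    using arg_cong[OF y(2), of "J s"]
    by (simp add: linear_diff[OF linear_J] linear_scale[OF linear_J])
  from J_eqI[OF J_graph(1)[OF y(1)] this True] show ?thesis by simp
qed simp

lemma J_graph2: "h > 0 \<Longrightarrow> \<exists>y z. (J h (J h f), y) \<in> A \<and> (y, z) \<in> A"
proof -
  assume h: "h > 0"
  obtain y where y: "(J h f, y) \<in> A" using h by (rule J_obtain)
  obtain z where "(J h y, z) \<in> A" using h by (rule J_obtain)
  then show ?thesis using J_graph(1)[OF y] by blast
qed

lemma J_diff_le:
  assumes "(x, y) \<in> A" "h \<ge> 0"
  shows "norm (J h x - x) \<le> h * norm y"
  using J_graph(2)[OF assms] norm_J[of h y] assms(2) by (simp add: mult_left_mono)

text \<open>Density argument shared by \<open>J\<close> and \<open>sgr\<close>: convergence, known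
  with a linear rate on the domain, extends to all vectors because the family is uniformly
  contractive.\<close>

lemma tendsto_contractions_at_right:
  assumes lin: "\<And>h. linear (B h)" and contr: "\<And>h x. norm (B h x) \<le> norm x"
    and dom: "\<And>x y h. (x, y) \<in> A \<Longrightarrow> h \<ge> 0 \<Longrightarrow> norm (B h x - x) \<le> h * norm y"
  shows "((\<lambda>h. B h x) \<longlongrightarrow> (x::'h)) (at_right (0::real))"
proof (rule tendstoI)
  fix e :: real assume e: "e > 0"
  have "x \<in> closure (fst ` A)" using dense by simp
  then obtain u v where uv: "(u, v) \<in> A" "dist u x < e / 3"
    using e closure_approachable[of x "fst ` A"] by (auto dest!: spec[of _ "e/3"])
  have "((\<lambda>h. h * norm v) \<longlongrightarrow> 0 * norm v) (at_right (0::real))"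
    by (intro tendsto_intros)
  from order_tendstoD(2)[OF this, of "e / 3"]
  have "eventually (\<lambda>h. h * norm v < e / 3) (at_right (0::real))"
    using e by simp
  moreover have "eventually (\<lambda>h::real. h > 0) (at_right 0)" by (simp add: eventually_at_right_less)
  ultimately show "eventually (\<lambda>h. dist (B h x) x < e) (at_right 0)"
  proof eventually_elim
    case (elim h)
    have eq: "B h x - x = B h (x - u) + (B h u - u) - (x - u)"
      by (simp add: linear_diff[OF lin])
    have "norm (B h x - x) \<le> norm (B h (x - u)) + norm (B h u - u) + norm (x - u)"
      unfolding eq by (rule norm_triangle_add_diff)
    also have "\<dots> \<le> norm (x - u) + h * norm v + norm (x - u)"
      using elim by (intro add_mono contr dom[OF uv(1)]) auto
    finally show ?case using elim uv(2) norm_minus_commute[of u x] unfolding dist_norm by linarith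
  qed
qed

lemma J_tendsto: "((\<lambda>h. J h x) \<longlongrightarrow> x) (at_right 0)"
  by (intro tendsto_contractions_at_right linear_J norm_J J_diff_le)

text \<open>Two resolvents map any vector into the domain of \<open>A\<^sup>2\<close>, and the norm
  of \<open>J h (J h x) - x\<close> is at most twice that of \<open>J h x - x\<close>.\<close>

lemma dense2: "closure {x. \<exists>y z. (x, y) \<in> A \<and> (y, z) \<in> A} = UNIV"
proof -
  have "x \<in> closure {x. \<exists>y z. (x, y) \<in> A \<and> (y, z) \<in> A}" for x
  proof (rule closure_approachable[THEN iffD2], intro allI impI)
    fix e :: real assume e: "e > 0"
    have "eventually (\<lambda>h. dist (J h x) x < e / 2) (at_right 0)"
      by (rule tendstoD[OF J_tendsto]) (use e in simp)
    moreover have "eventually (\<lambda>h::real. h > 0) (at_right 0)" by (simp add: eventually_at_right_less)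
    ultimately have "eventually (\<lambda>h. h > 0 \<and> dist (J h x) x < e / 2) (at_right 0)"
      by eventually_elim auto
    then obtain h where h: "h > 0" "dist (J h x) x < e / 2"
      using eventually_happens'[OF trivial_limit_at_right_real] by blast
    have "J h (J h x) - x = J h (J h x - x) + (J h x - x)" by (simp add: linear_diff[OF linear_J])
    then have "norm (J h (J h x) - x) \<le> norm (J h x - x) + norm (J h x - x)"
      by (metis norm_J norm_triangle_mono order_refl)
    then have "dist (J h (J h x)) x < e" using h by (simp add: dist_norm)
    then show "\<exists>y\<in>{x. \<exists>y z. (x, y) \<in> A \<and> (y, z) \<in> A}. dist y x < e"
      using J_graph2[OF h(1)] by blast
  qed
  then show ?thesis by blast
qed

text \<open>From \<open>(1 - s A) (1 - t A) = 1 - (s + t) A + s t A\<^sup>2\<close>.\<close>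

lemma J_add_le:
  assumes xy: "(x, y) \<in> A" and yz: "(y, z) \<in> A" and st: "s \<ge> 0" "t \<ge> 0"
  shows "norm (J s (J t x) - J (s + t) x) \<le> s * t * norm z"
proof (cases "s + t > 0")
  case True
  define u v w where "u = J s (J t x)" "v = J s (J t y)" "w = J s (J t z)"
  note uvw = u_v_w_def
  have uv: "(u, v) \<in> A" unfolding uvw by (intro J_graph xy)
  have 1: "J t x - x = t *\<^sub>R J t y" by (rule J_graph(2)[OF xy st(2)])
  have 2: "u - J t x = s *\<^sub>R v" unfolding uvw by (rule J_graph(2)[OF J_graph(1)[OF xy] st(1)])
  have 3: "v - J t y = s *\<^sub>R w" unfolding uvw by (rule J_graph(2)[OF J_graph(1)[OF yz] st(1)])
  have "u - (s + t) *\<^sub>R v = x - t *\<^sub>R (v - J t y)"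
    using 1 2 by (simp add: algebra_simps)
  then have "u - (s + t) *\<^sub>R v = x - (s * t) *\<^sub>R w"
    unfolding 3 by (simp add: mult.commute)
  then have "u = J (s + t) (x - (s * t) *\<^sub>R w)"
    using J_eqI[OF uv _ True] by simp
  then have "u - J (s + t) x = - ((s * t) *\<^sub>R J (s + t) w)"
    by (simp add: linear_diff[OF linear_J] linear_scale[OF linear_J])
  then have "norm (u - J (s + t) x) = s * t * norm (J (s + t) w)"
    using st by (simp add: abs_mult)
  moreover have "norm (J (s + t) w) \<le> norm z"
    unfolding uvw by (meson norm_J order_trans)
  ultimately show ?thesis using st unfolding uvw by (simp add: mult_left_mono)
next
  case False
  then have "s = 0" "t = 0" using st by auto
  then show ?thesis by simp
qed

section \<open>Dyadic backward Euler approximations\<close>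

definition approx :: "nat \<Rightarrow> real \<Rightarrow> 'h \<Rightarrow> 'h" where
  "approx m t = J (t / 2 ^ m) ^^ (2 ^ m)"

lemma linear_approx: "linear (approx m t)"
  unfolding approx_def by (intro linear_funpow linear_J)

lemma norm_approx: "norm (approx m t x) \<le> norm x"
  unfolding approx_def by (intro funpow_contraction norm_J)

text \<open>Each of the \<open>2 ^ m\<close> steps of length \<open>2 h\<close> is split into two of
  length \<open>h\<close>. By \<open>J_add_le\<close> the cost per step is
  \<open>h * h * norm z\<close>, and \<open>2 ^ m * h\<^sup>2\<close> equals
  \<open>t\<^sup>2 * (1/2) ^ m / 4\<close>.\<close>

lemma approx_step:
  assumes xy: "(x, y) \<in> A" and yz: "(y, z) \<in> A" and t: "t \<ge> 0"
  shows "norm (approx (Suc m) t x - approx m t x) \<le> t\<^sup>2 * norm z * (1/2) ^ m / 4"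
proof -
  define h where "h = t / 2 ^ Suc m"
  have h: "h \<ge> 0" using t by (simp add: h_def)
  have hh: "t / 2 ^ m = h + h" by (simp add: h_def field_simps)
  have "approx (Suc m) t x = ((J h ^^ 2) ^^ (2 ^ m)) x"
    by (simp add: approx_def h_def funpow_mult mult.commute)
  also have "J h ^^ 2 = (\<lambda>x. J h (J h x))" by (simp add: numeral_2_eq_2 fun_eq_iff)
  finally have 1: "approx (Suc m) t x = ((\<lambda>x. J h (J h x)) ^^ (2 ^ m)) x" .
  have 2: "approx m t x = (J (h + h) ^^ (2 ^ m)) x" by (simp add: approx_def hh)
  have com: "J h (J h (J (h + h) u)) = J (h + h) (J h (J h u))" for u by (metis J_commute)
  have "norm (approx (Suc m) t x - approx m t x) \<le> real (2 ^ m) * norm (J h (J h x) - J (h + h) x)"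
    unfolding 1 2
    by (rule funpow_diff_le)
      (fact com linear_J norm_J linear_compose[OF linear_J linear_J, unfolded o_def] order_trans[OF norm_J norm_J])+
  also have "\<dots> \<le> real (2 ^ m) * (h * h * norm z)"
    by (intro mult_left_mono J_add_le[OF xy yz] h) simp
  also have "\<dots> = t\<^sup>2 * norm z * (1/2) ^ m / 4"
    by (simp add: h_def power2_eq_square field_simps)
  finally show ?thesis .
qed

text \<open>The factor \<open>1 - (1/2) ^ k\<close> is a partial geometric sum: it lets the
  induction close and never exceeds 1.\<close>

lemma approx_diff_le:
  assumes xy: "(x, y) \<in> A" and yz: "(y, z) \<in> A" and t: "t \<ge> 0"
  shows "norm (approx (m + k) t x - approx m t x) \<le> t\<^sup>2 * norm z * (1/2) ^ m * (1 - (1/2) ^ k)"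
proof (induction k)
  case (Suc k)
  have "norm (approx (m + Suc k) t x - approx m t x)
    \<le> norm (approx (Suc (m + k)) t x - approx (m + k) t x) + norm (approx (m + k) t x - approx m t x)"
    using norm_triangle_ineq[of "approx (Suc (m + k)) t x - approx (m + k) t x" "approx (m + k) t x - approx m t x"]
    by simp
  also have "\<dots> \<le> t\<^sup>2 * norm z * (1/2) ^ (m + k) / 4 + t\<^sup>2 * norm z * (1/2) ^ m * (1 - (1/2) ^ k)"
    by (intro add_mono approx_step[OF assms] Suc.IH)
  \<comment> \<open>Weakening the divisor 4 to 2 makes the new term match the growth of
    \<open>1 - (1/2) ^ k\<close> from \<open>k\<close> to \<open>Suc k\<close>.\<close>
  also have "\<dots> \<le> t\<^sup>2 * norm z * (1/2) ^ (m + k) / 2 + t\<^sup>2 * norm z * (1/2) ^ m * (1 - (1/2) ^ k)"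
    by (simp add: divide_left_mono)
  also have "\<dots> = t\<^sup>2 * norm z * (1/2) ^ m * (1 - (1/2) ^ Suc k)"
    by (simp add: power_add field_simps)
  finally show ?case .
qed simp

lemma approx_Cauchy2:
  assumes xy: "(x, y) \<in> A" and yz: "(y, z) \<in> A" and t: "t \<ge> 0"
  shows "Cauchy (\<lambda>m. approx m t x)"
proof (rule CauchyI')
  fix e :: real assume e: "e > 0"
  have "(\<lambda>m. t\<^sup>2 * norm z * (1/2) ^ m) \<longlonglongrightarrow> t\<^sup>2 * norm z * 0"
    by (intro tendsto_intros LIMSEQ_power_zero) simp
  from order_tendstoD(2)[OF this, of e]
  obtain M where M: "\<And>m. m \<ge> M \<Longrightarrow> t\<^sup>2 * norm z * (1/2) ^ m < e"
    using e unfolding eventually_sequentially by auto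
  have "norm (approx m t x - approx n t x) < e" if "m \<ge> M" "n > m" for m n
  proof -
    define k where "k = n - m"
    have n: "n = m + k" using that by (simp add: k_def)
    have "norm (approx n t x - approx m t x) \<le> t\<^sup>2 * norm z * (1/2) ^ m * (1 - (1/2) ^ k)"
      unfolding n by (rule approx_diff_le[OF assms])
    also have "\<dots> \<le> t\<^sup>2 * norm z * (1/2) ^ m * 1" by (intro mult_left_mono) auto
    finally show ?thesis using M[OF that(1)] norm_minus_commute[of "approx m t x"] by simp
  qed
  then show "\<exists>M. \<forall>m\<ge>M. \<forall>n>m. dist (approx m t x) (approx n t x) < e"
    by (auto simp: dist_norm)
qed

lemma approx_Cauchy:
  assumes t: "t \<ge> 0"
  shows "Cauchy (\<lambda>m. approx m t x)"
proof (rule Cauchy_if_approximable)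
  fix e :: real assume e: "e > 0"
  have "x \<in> closure {x. \<exists>y z. (x, y) \<in> A \<and> (y, z) \<in> A}" using dense2 by simp
  then obtain u v w where u: "(u, v) \<in> A" "(v, w) \<in> A" "dist u x < e"
    using e unfolding closure_approachable by auto
  have "norm (approx m t x - approx m t u) < e" for m
    using norm_approx[of m t "x - u"] u(3) norm_minus_commute[of u x]
    unfolding linear_diff[OF linear_approx] dist_norm by linarith
  then show "\<exists>g. Cauchy g \<and> (\<forall>m. norm (approx m t x - g m) < e)"
    using approx_Cauchy2[OF u(1,2) t] by blast
qed

text \<open>\<open>max t 0\<close> freezes negative times at 0, where every approximation is the
  identity. Hence linearity and contractivity hold for all \<open>t\<close>.\<close>

definition sgr :: "real \<Rightarrow> 'h \<Rightarrow> 'h" where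
  "sgr t x = lim (\<lambda>m. approx m (max t 0) x)"

lemma approx_tendsto_max: "(\<lambda>m. approx m (max t 0) x) \<longlonglongrightarrow> sgr t x"
  unfolding sgr_def using approx_Cauchy[of "max t 0" x]
  by (simp add: Cauchy_convergent_iff convergent_LIMSEQ_iff)

lemma approx_tendsto: "t \<ge> 0 \<Longrightarrow> (\<lambda>m. approx m t x) \<longlonglongrightarrow> sgr t x"
  using approx_tendsto_max[of t x] by (simp add: max_absorb1)

lemma norm_sgr: "norm (sgr t x) \<le> norm x"
  using approx_tendsto_max[THEN tendsto_norm]
  by (rule tendsto_upperbound) (simp_all add: norm_approx)

lemma linear_sgr: "linear (sgr t)"
proof
  fix x y :: 'h and c :: real
  show "sgr t (x + y) = sgr t x + sgr t y"
    using tendsto_add[OF approx_tendsto_max[of t x] approx_tendsto_max[of t y]]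
    by (intro LIMSEQ_unique[OF approx_tendsto_max]) (simp add: linear_add[OF linear_approx])
  show "sgr t (c *\<^sub>R x) = c *\<^sub>R sgr t x"
    using tendsto_scaleR[OF tendsto_const[of c] approx_tendsto_max[of t x]]
    by (intro LIMSEQ_unique[OF approx_tendsto_max]) (simp add: linear_scale[OF linear_approx])
qed

lemma sgr_0: "sgr 0 x = x"
proof -
  have "J 0 ^^ n = id" for n by (induction n) auto
  then have "approx m 0 x = x" for m by (simp add: approx_def)
  then show ?thesis using approx_tendsto[of 0 x] by (simp add: LIMSEQ_const_iff)
qed

text \<open>The comparison of \<open>approx_step\<close> with two different step lengths:
  \<open>2 ^ m\<close> commuting pairs, each with error
  \<open>(s / 2 ^ m) * (t / 2 ^ m) * norm z\<close>.\<close>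

lemma approx_add_le:
  assumes xy: "(x, y) \<in> A" and yz: "(y, z) \<in> A" and st: "s \<ge> 0" "t \<ge> 0"
  shows "norm (approx m s (approx m t x) - approx m (s + t) x) \<le> s * t * norm z * (1/2) ^ m"
proof -
  let ?P = "J (s / 2 ^ m)" and ?Q = "J (t / 2 ^ m)" and ?R = "J (s / 2 ^ m + t / 2 ^ m)"
  have 1: "approx m s (approx m t x) = ((\<lambda>x. ?P (?Q x)) ^^ (2 ^ m)) x"
    unfolding approx_def by (rule funpow_mult_commute[symmetric]) (rule J_commute)
  have 2: "approx m (s + t) x = (?R ^^ (2 ^ m)) x"
    by (simp add: approx_def add_divide_distrib)
  have com: "?P (?Q (?R u)) = ?R (?P (?Q u))" for u by (metis J_commute)
  have "norm (approx m s (approx m t x) - approx m (s + t) x) \<le> real (2 ^ m) * norm (?P (?Q x) - ?R x)"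
    unfolding 1 2
    by (rule funpow_diff_le)
      (fact com linear_J norm_J linear_compose[OF linear_J linear_J, unfolded o_def] order_trans[OF norm_J norm_J])+
  also have "\<dots> \<le> real (2 ^ m) * (s / 2 ^ m * (t / 2 ^ m) * norm z)"
    using st by (intro mult_left_mono J_add_le[OF xy yz]) auto
  also have "\<dots> = s * t * norm z * (1/2) ^ m"
    by (simp add: field_simps)
  finally show ?thesis .
qed

text \<open>Both sides are continuous in \<open>x\<close>, so it suffices to check the dense domain
  of \<open>A\<^sup>2\<close>, where \<open>approx_add_le\<close> applies.\<close>

lemma sgr_add:
  assumes st: "s \<ge> 0" "t \<ge> 0"
  shows "sgr (s + t) x = sgr s (sgr t x)"
proof -
  let ?C = "{x. sgr (s + t) x = sgr s (sgr t x)}"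
  have cont: "continuous_on UNIV (sgr r)" for r
    by (intro linear_continuous_on bounded_linear.intro linear_sgr bounded_linear_axioms.intro exI[of _ 1])
      (simp add: norm_sgr)
  have "closed ?C"
    by (intro closed_Collect_eq cont continuous_on_compose2[OF cont cont]) auto
  moreover have "{x. \<exists>y z. (x, y) \<in> A \<and> (y, z) \<in> A} \<subseteq> ?C"
  proof clarify
    fix x y z assume xy: "(x, y) \<in> A" and yz: "(y, z) \<in> A"
    \<comment> \<open>The operator and its argument both depend on \<open>m\<close>; contractivity
      of \<open>approx m s\<close> bounds this error by that of the argument.\<close>
    have "(\<lambda>m. approx m s (approx m t x) - approx m s (sgr t x)) \<longlonglongrightarrow> 0"
    proof (rule Lim_null_comparison)
      show "(\<lambda>m. norm (approx m t x - sgr t x)) \<longlonglongrightarrow> 0"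
        using approx_tendsto[OF st(2)] by (simp add: tendsto_norm_zero_iff LIM_zero_iff)
      show "eventually (\<lambda>m. norm (approx m s (approx m t x) - approx m s (sgr t x)) \<le> norm (approx m t x - sgr t x))
        sequentially"
        by (simp add: linear_diff[OF linear_approx, symmetric] norm_approx)
    qed
    from tendsto_add[OF this approx_tendsto[OF st(1), of "sgr t x"]]
    have 1: "(\<lambda>m. approx m s (approx m t x)) \<longlonglongrightarrow> sgr s (sgr t x)" by simp
    have "(\<lambda>m. approx m s (approx m t x) - approx m (s + t) x) \<longlonglongrightarrow> 0"
    proof (rule Lim_null_comparison)
      have "(\<lambda>m. s * t * norm z * (1/2) ^ m) \<longlonglongrightarrow> s * t * norm z * 0"
        by (intro tendsto_intros LIMSEQ_power_zero) simp
      then show "(\<lambda>m. s * t * norm z * (1/2) ^ m) \<longlonglongrightarrow> 0" by simp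
      show "eventually (\<lambda>m. norm (approx m s (approx m t x) - approx m (s + t) x) \<le> s * t * norm z * (1/2) ^ m)
        sequentially"
        using approx_add_le[OF xy yz st] by simp
    qed
    from tendsto_diff[OF 1 this] have "(\<lambda>m. approx m (s + t) x) \<longlonglongrightarrow> sgr s (sgr t x)" by simp
    then show "sgr (s + t) x = sgr s (sgr t x)"
      using approx_tendsto[of "s + t" x] st by (auto intro: LIMSEQ_unique)
  qed
  ultimately have "?C = UNIV" using dense2 closure_minimal by blast
  then show ?thesis by auto
qed

text \<open>Comparing powers of the resolvent with powers of the identity, each of the
  \<open>2 ^ m\<close> steps adds at most \<open>t / 2 ^ m * norm y\<close>.\<close>

lemma sgr_diff_le:
  assumes xy: "(x, y) \<in> A" and t: "t \<ge> 0"
  shows "norm (sgr t x - x) \<le> t * norm y"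
proof -
  have *: "norm ((J h ^^ n) x - x) \<le> real n * (h * norm y)" if "h \<ge> 0" for h n
  proof -
    have "norm ((J h ^^ n) x - (id ^^ n) x) \<le> real n * norm (J h x - id x)"
      by (rule funpow_diff_le) (auto intro: linear_J norm_J linear_id)
    also have "\<dots> \<le> real n * (h * norm y)"
      using J_diff_le[OF xy that] by (simp add: mult_left_mono)
    finally show ?thesis by simp
  qed
  have "norm (approx m t x - x) \<le> t * norm y" for m
    using *[of "t / 2 ^ m" "2 ^ m"] t by (simp add: approx_def)
  moreover have "(\<lambda>m. norm (approx m t x - x)) \<longlonglongrightarrow> norm (sgr t x - x)"
    by (intro tendsto_intros approx_tendsto t)
  ultimately show ?thesis by (intro tendsto_upperbound) auto
qed

lemma sgr_tendsto: "((\<lambda>t. sgr t x) \<longlongrightarrow> x) (at_right 0)"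
  by (intro tendsto_contractions_at_right linear_sgr norm_sgr sgr_diff_le)

text \<open>\<open>J t x\<close> is the coarsest approximation \<open>approx 0 t x\<close>. It
  differs from \<open>sgr t x\<close> by at most \<open>t\<^sup>2 * norm z\<close>, and
  \<open>J t x - x - t y = t\<^sup>2 J t z\<close> exactly; hence the factor 2.\<close>

lemma sgr_second_order:
  assumes xy: "(x, y) \<in> A" and yz: "(y, z) \<in> A" and t: "t \<ge> 0"
  shows "norm (sgr t x - x - t *\<^sub>R y) \<le> 2 * t\<^sup>2 * norm z"
proof -
  have ap: "approx 0 t x = J t x" by (simp add: approx_def)
  have "norm (approx m t x - J t x) \<le> t\<^sup>2 * norm z" for m
  proof -
    have "norm (approx (0 + m) t x - approx 0 t x) \<le> t\<^sup>2 * norm z * (1/2) ^ 0 * (1 - (1/2) ^ m)"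
      by (rule approx_diff_le[OF assms])
    also have "\<dots> \<le> t\<^sup>2 * norm z * (1/2) ^ 0 * 1" by (intro mult_left_mono) auto
    finally show ?thesis by (simp add: ap)
  qed
  moreover have "(\<lambda>m. norm (approx m t x - J t x)) \<longlonglongrightarrow> norm (sgr t x - J t x)"
    by (intro tendsto_intros approx_tendsto t)
  ultimately have 1: "norm (sgr t x - J t x) \<le> t\<^sup>2 * norm z" by (intro tendsto_upperbound) auto
  have "J t x - x - t *\<^sub>R y = t *\<^sub>R (J t y - y)"
    using J_graph(2)[OF xy t] by (simp add: algebra_simps)
  also have "\<dots> = t\<^sup>2 *\<^sub>R J t z"
    using J_graph(2)[OF yz t] by (simp add: power2_eq_square)
  finally have "norm (J t x - x - t *\<^sub>R y) = t\<^sup>2 * norm (J t z)" by simp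
  then have 2: "norm (J t x - x - t *\<^sub>R y) \<le> t\<^sup>2 * norm z" by (simp add: mult_left_mono norm_J)
  have "sgr t x - x - t *\<^sub>R y = (sgr t x - J t x) + (J t x - x - t *\<^sub>R y)" by simp
  then have "norm (sgr t x - x - t *\<^sub>R y) \<le> t\<^sup>2 * norm z + t\<^sup>2 * norm z"
    using norm_triangle_mono[OF 1 2] by metis
  then show ?thesis by linarith
qed

text \<open>Elements of the domain are approximated by \<open>J h x\<close>, which lies in the domain of \<open>A\<^sup>2\<close>; the
  error is controlled by \<open>sgr_diff_le\<close>, so that no integral of the orbit is needed.\<close>

lemma sgr_derivative:
  assumes xy: "(x, y) \<in> A"
  shows "((\<lambda>t. (1/t) *\<^sub>R (sgr t x - x)) \<longlongrightarrow> y) (at_right 0)"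
proof (rule tendstoI)
  fix e :: real assume e: "e > 0"
  have "eventually (\<lambda>h. dist (J h y) y < e / 3) (at_right 0)"
    by (rule tendstoD[OF J_tendsto]) (use e in simp)
  moreover have pos: "eventually (\<lambda>h::real. h > 0) (at_right 0)" by (simp add: eventually_at_right_less)
  ultimately have "eventually (\<lambda>h. h > 0 \<and> dist (J h y) y < e / 3) (at_right 0)"
    by eventually_elim auto
  then obtain h where h: "h > 0" "dist (J h y) y < e / 3"
    using eventually_happens'[OF trivial_limit_at_right_real] by blast
  define u v where "u = J h x" "v = J h y"
  have uv: "(u, v) \<in> A" unfolding u_v_def by (rule J_graph(1)[OF xy])
  obtain w where vw: "(v, w) \<in> A" unfolding u_v_def using h(1) by (rule J_obtain)
  have vy: "norm (y - v) < e / 3" using h(2) norm_minus_commute[of y "J h y"] unfolding u_v_def dist_norm by linarith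
  have "((\<lambda>t. 2 * t * norm w) \<longlongrightarrow> 2 * 0 * norm w) (at_right (0::real))"
    by (intro tendsto_intros)
  from order_tendstoD(2)[OF this, of "e / 3"]
  have "eventually (\<lambda>t. 2 * t * norm w < e / 3) (at_right (0::real))"
    using e by simp
  with pos show "eventually (\<lambda>t. dist ((1/t) *\<^sub>R (sgr t x - x)) y < e) (at_right 0)"
  proof eventually_elim
    case (elim t)
    have 1: "norm ((1/t) *\<^sub>R (sgr t (x - u) - (x - u))) \<le> norm (y - v)"
      using mult_left_mono[OF sgr_diff_le[OF diff[OF xy uv], of t], of "1/t"] elim by simp
    have "norm ((1/t) *\<^sub>R (sgr t u - u - t *\<^sub>R v)) \<le> (1/t) * (2 * t\<^sup>2 * norm w)"
      using mult_left_mono[OF sgr_second_order[OF uv vw, of t], of "1/t"] elim by simp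
    also have "\<dots> = 2 * t * norm w" using elim by (simp add: power2_eq_square)
    finally have 2: "norm ((1/t) *\<^sub>R (sgr t u - u - t *\<^sub>R v)) \<le> 2 * t * norm w" .
    have "(1/t) *\<^sub>R (sgr t x - x) - y
        = (1/t) *\<^sub>R (sgr t (x - u) - (x - u)) + (1/t) *\<^sub>R (sgr t u - u - t *\<^sub>R v) - (y - v)"
      using elim by (simp add: linear_diff[OF linear_sgr] algebra_simps)
    then have "norm ((1/t) *\<^sub>R (sgr t x - x) - y) \<le> norm ((1/t) *\<^sub>R (sgr t (x - u) - (x - u)))
      + norm ((1/t) *\<^sub>R (sgr t u - u - t *\<^sub>R v)) + norm (y - v)"
      by (metis norm_triangle_add_diff)
    then show ?case using 1 2 vy elim unfolding dist_norm by linarith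
  qed
qed

text \<open>For the forward direction, the generator is dissipative because the semigroup contracts,
  and \<open>1 - A\<close> is already onto. Take \<open>(x', y')\<close> in \<open>A\<close> with
  \<open>x' - y' = x - y\<close>: the generator maps \<open>d = x - x'\<close> to itself, which
  dissipativity permits only for \<open>d = 0\<close>.\<close>

theorem generator_sgr:
  "((\<lambda>t. (1/t) *\<^sub>R (sgr t x - x)) \<longlongrightarrow> y) (at_right 0) \<longleftrightarrow> (x, y) \<in> A"
proof
  assume lim: "((\<lambda>t. (1/t) *\<^sub>R (sgr t x - x)) \<longlongrightarrow> y) (at_right 0)"
  obtain x' y' where A: "(x', y') \<in> A" "x' - 1 *\<^sub>R y' = x - y" using range[of 1 "x - y"] by auto
  define d where "d = x - x'"
  have d: "y - y' = d" using A(2) by (simp add: d_def algebra_simps)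
  have "((\<lambda>t. (1/t) *\<^sub>R (sgr t x - x) - (1/t) *\<^sub>R (sgr t x' - x')) \<longlongrightarrow> y - y') (at_right 0)"
    by (intro tendsto_diff lim sgr_derivative A(1))
  then have "((\<lambda>t. (1/t) *\<^sub>R (sgr t d - d)) \<longlongrightarrow> d) (at_right 0)"
    unfolding d by (simp add: d_def linear_diff[OF linear_sgr] algebra_simps)
  then have "((\<lambda>t. ((1/t) *\<^sub>R (sgr t d - d)) \<bullet> d) \<longlongrightarrow> d \<bullet> d) (at_right 0)"
    by (intro tendsto_intros)
  moreover have "eventually (\<lambda>t. ((1/t) *\<^sub>R (sgr t d - d)) \<bullet> d \<le> 0) (at_right (0::real))"
  proof (rule eventually_mono[OF eventually_at_right_less])
    fix t :: real assume t: "0 < t"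
    have "sgr t d \<bullet> d \<le> norm (sgr t d) * norm d" by (rule norm_cauchy_schwarz)
    also have "\<dots> \<le> norm d * norm d" by (intro mult_right_mono norm_sgr) simp
    also have "\<dots> = d \<bullet> d" by (simp add: dot_square_norm power2_eq_square)
    finally show "((1/t) *\<^sub>R (sgr t d - d)) \<bullet> d \<le> 0"
      using t by (simp add: inner_diff_left divide_nonpos_pos)
  qed
  ultimately have "d \<bullet> d \<le> 0"
    by (intro tendsto_upperbound) auto
  then have "d = 0" by (metis inner_eq_zero_iff inner_ge_zero order_antisym)
  then show "(x, y) \<in> A" using A d by (simp add: d_def)
qed (rule sgr_derivative)

text \<open>The pair of \<open>A\<close> with \<open>x' - y' = x - y\<close> identifies the limit:
  by \<open>norm_le_resolvent\<close>, \<open>f n - x'\<close> is bounded by a quantity tending to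
  0.\<close>

lemma closed_graph:
  assumes A: "\<And>n. (f n, g n) \<in> A" and f: "f \<longlonglongrightarrow> x" and g: "g \<longlonglongrightarrow> y"
  shows "(x, y) \<in> A"
proof -
  obtain x' y' where xy: "(x', y') \<in> A" "x' - 1 *\<^sub>R y' = x - y" using range[of 1 "x - y"] by auto
  have "(\<lambda>n. norm (f n - x')) \<longlonglongrightarrow> norm (x - x')" by (intro tendsto_intros f)
  moreover have "(\<lambda>n. norm ((f n - x') - (g n - y'))) \<longlonglongrightarrow> norm ((x - x') - (y - y'))"
    by (intro tendsto_intros f g)
  moreover have "norm (f n - x') \<le> norm ((f n - x') - (g n - y'))" for n
    using norm_le_resolvent[OF diff[OF A[of n] xy(1)], of 1] by simp
  ultimately have "norm (x - x') \<le> norm ((x - x') - (y - y'))"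
    using LIMSEQ_le by blast
  also have "(x - x') - (y - y') = 0" using xy(2) by (simp add: algebra_simps)
  finally show ?thesis using xy by simp
qed

text \<open>\<open>P\<close> commutes with every resolvent, hence with every approximation, and
  continuity passes this to the limit. In the application \<open>P\<close> is the restriction to
  \<open>S\<close>.\<close>

lemma sgr_commute:
  assumes P: "linear P" "continuous_on UNIV P" and com: "\<And>x y. (x, y) \<in> A \<Longrightarrow> (P x, P y) \<in> A"
  shows "sgr t (P x) = P (sgr t x)"
proof -
  have J: "J h (P f) = P (J h f)" for h f
  proof (cases "h > 0")
    case True
    then obtain y where y: "(J h f, y) \<in> A" "J h f - h *\<^sub>R y = f" by (rule J_obtain)
    show ?thesis
      using arg_cong[OF y(2), of P]
      by (intro J_eqI[OF com[OF y(1)] _ True]) (simp add: linear_diff[OF P(1)] linear_scale[OF P(1)])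
  qed simp
  have "approx m s (P f) = P (approx m s f)" for m s f
    unfolding approx_def by (rule funpow_commute[symmetric]) (simp add: J)
  then have "(\<lambda>m. approx m (max t 0) (P x)) \<longlonglongrightarrow> P (sgr t x)"
    using continuous_on_tendsto_compose[OF P(2) approx_tendsto_max[of t x]] by simp
  then show ?thesis using approx_tendsto_max LIMSEQ_unique by blast
qed

end

section \<open>Von Neumann's theorem for closed operators\<close>

lemma orthogonal_projection_exists:
  fixes M :: "'h::{real_inner,complete_space} set"
  assumes M: "subspace M" "closed M"
  obtains p where "p \<in> M" "\<And>m. m \<in> M \<Longrightarrow> (x - p) \<bullet> m = 0"
proof -
  define d where "d = (INF m\<in>M. (norm (x - m))\<^sup>2)"
  have bdd: "bdd_below ((\<lambda>m. (norm (x - m))\<^sup>2) ` M)" by (intro bdd_belowI2[of _ 0]) simp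
  have ne: "M \<noteq> {}" using subspace_0[OF M(1)] by auto
  have d: "d \<le> (norm (x - m))\<^sup>2" if "m \<in> M" for m
    unfolding d_def by (rule cINF_lower[OF bdd that])
  have "\<exists>m\<in>M. (norm (x - m))\<^sup>2 < d + 1 / real (Suc n)" for n
    using cINF_less_iff[OF ne bdd, of "d + 1 / real (Suc n)"] by (simp add: d_def[symmetric])
  then obtain p where p: "\<And>n. p n \<in> M" "\<And>n. (norm (x - p n))\<^sup>2 < d + 1 / real (Suc n)"
    by metis
  have par: "(norm (p m - p n))\<^sup>2 \<le> 2 * (1 / real (Suc m) + 1 / real (Suc n))" for m n
  proof -
    have "(1/2) *\<^sub>R (p m + p n) \<in> M" by (intro subspace_scale subspace_add M p)
    then have "d \<le> (norm (x - (1/2) *\<^sub>R (p m + p n)))\<^sup>2" by (rule d)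
    \<comment> \<open>Parallelogram law: near-minimisers are close to each other because their
      midpoint lies in \<open>M\<close> and its squared distance from \<open>x\<close> is at least
      \<open>d\<close>.\<close>
    moreover have "(norm (p m - p n))\<^sup>2
        = 2 * (norm (x - p m))\<^sup>2 + 2 * (norm (x - p n))\<^sup>2 - 4 * (norm (x - (1/2) *\<^sub>R (p m + p n)))\<^sup>2"
      by (simp add: power2_norm_eq_inner inner_add inner_diff inner_commute algebra_simps)
    ultimately show ?thesis using p(2)[of m] p(2)[of n] by simp
  qed
  have "Cauchy p"
  proof (rule CauchyI)
    fix e :: real assume e: "e > 0"
    obtain k where k: "1 / real (Suc k) < e\<^sup>2 / 4"
      using e nat_approx_posE[of "e\<^sup>2 / 4"] by (auto simp: divide_pos_pos)
    have "norm (p m - p n) < e" if "m \<ge> k" "n \<ge> k" for m n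
    proof (rule power_less_imp_less_base)
      have "(norm (p m - p n))\<^sup>2 \<le> 2 * (1 / real (Suc m) + 1 / real (Suc n))" by (rule par)
      also have "\<dots> \<le> 2 * (1 / real (Suc k) + 1 / real (Suc k))"
        using that by (intro mult_left_mono add_mono divide_left_mono) auto
      also have "\<dots> < 2 * (e\<^sup>2 / 4 + e\<^sup>2 / 4)"
        using k by (intro mult_strict_left_mono add_strict_mono) auto
      finally show "(norm (p m - p n))\<^sup>2 < e\<^sup>2" by simp
    qed (use e in simp)
    then show "\<exists>M. \<forall>m\<ge>M. \<forall>n\<ge>M. norm (p m - p n) < e" by blast
  qed
  then obtain q where q: "p \<longlonglongrightarrow> q" using Cauchy_convergent_iff convergent_def by blast
  have qM: "q \<in> M" using closed_sequentially[OF M(2) _ q] p(1) by blast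
  have "(norm (x - q))\<^sup>2 \<le> d"
  proof (rule LIMSEQ_le)
    show "(\<lambda>n. (norm (x - p n))\<^sup>2) \<longlonglongrightarrow> (norm (x - q))\<^sup>2" by (intro tendsto_intros q)
    have "(\<lambda>n. d + 1 / real (Suc n)) \<longlonglongrightarrow> d + 0"
      by (intro tendsto_add tendsto_const LIMSEQ_Suc[OF lim_1_over_n])
    then show "(\<lambda>n. d + 1 / real (Suc n)) \<longlonglongrightarrow> d" by simp
    show "\<exists>N. \<forall>n\<ge>N. (norm (x - p n))\<^sup>2 \<le> d + 1 / real (Suc n)"
      using p(2) less_imp_le by blast
  qed
  then have min: "(norm (x - q))\<^sup>2 \<le> (norm (x - m))\<^sup>2" if "m \<in> M" for m
    using d[OF that] by linarith
  have "(x - q) \<bullet> m = 0" if m: "m \<in> M" for m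
  proof (cases "m = 0")
    case False
    \<comment> \<open>The minimiser of the quadratic in \<open>expand\<close>: moving
      \<open>q\<close> by \<open>c *\<^sub>R m\<close> lowers the squared distance by
      \<open>((x - q) \<bullet> m)\<^sup>2 / (m \<bullet> m)\<close>.\<close>
    define c where "c = ((x - q) \<bullet> m) / (m \<bullet> m)"
    have expand: "(norm (r - c *\<^sub>R m))\<^sup>2 = (norm r)\<^sup>2 - 2 * c * (r \<bullet> m) + c\<^sup>2 * (m \<bullet> m)" for r
      unfolding power2_norm_eq_inner
      by (simp add: inner_diff_left inner_diff_right inner_commute[of m r] power2_eq_square
          right_diff_distrib)
    have mm: "m \<bullet> m > 0" using False by simp
    have "q + c *\<^sub>R m \<in> M" by (intro subspace_add subspace_scale M qM m)
    from min[OF this] have "(norm (x - q))\<^sup>2 \<le> (norm ((x - q) - c *\<^sub>R m))\<^sup>2" by (simp add: algebra_simps)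
    also have "\<dots> = (norm (x - q))\<^sup>2 - 2 * c * ((x - q) \<bullet> m) + c\<^sup>2 * (m \<bullet> m)"
      by (rule expand)
    also have "\<dots> = (norm (x - q))\<^sup>2 - ((x - q) \<bullet> m)\<^sup>2 / (m \<bullet> m)"
      using mm by (simp add: c_def power2_eq_square field_simps)
    finally have "((x - q) \<bullet> m)\<^sup>2 / (m \<bullet> m) \<le> 0" by simp
    then have "((x - q) \<bullet> m)\<^sup>2 \<le> 0" using mm by (simp add: divide_le_0_iff)
    then show ?thesis by simp
  qed simp
  then show thesis using that qM by blast
qed

lemma closure_eq_UNIV_if_orthogonal_trivial:
  fixes V :: "'h::{real_inner,complete_space} set"
  assumes V: "subspace V" and triv: "\<And>w. (\<And>v. v \<in> V \<Longrightarrow> w \<bullet> v = 0) \<Longrightarrow> w = 0"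
  shows "closure V = UNIV"
proof -
  have "subspace (closure V)"
  proof (rule subspaceI)
    show "0 \<in> closure V" using subspace_0[OF V] closure_subset by blast
  next
    fix x y assume "x \<in> closure V" "y \<in> closure V"
    then obtain f g where "\<And>n::nat. f n \<in> V" "f \<longlonglongrightarrow> x" "\<And>n::nat. g n \<in> V" "g \<longlonglongrightarrow> y"
      unfolding closure_sequential by blast
    then show "x + y \<in> closure V" unfolding closure_sequential
      by (intro exI[of _ "\<lambda>n. f n + g n"]) (auto intro: tendsto_add subspace_add[OF V])
  next
    fix c x assume "x \<in> closure V"
    then obtain f where "\<And>n::nat. f n \<in> V" "f \<longlonglongrightarrow> x"
      unfolding closure_sequential by blast
    then show "c *\<^sub>R x \<in> closure V" unfolding closure_sequential
      by (intro exI[of _ "\<lambda>n. c *\<^sub>R f n"]) (auto intro: tendsto_scaleR subspace_scale[OF V])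
  qed
  then have "x \<in> closure V" for x
  proof -
    obtain p where p: "p \<in> closure V" "\<And>m. m \<in> closure V \<Longrightarrow> (x - p) \<bullet> m = 0"
      using orthogonal_projection_exists[OF \<open>subspace (closure V)\<close> closed_closure, of x] by blast
    have "x - p = 0" by (rule triv) (use p(2) closure_subset in blast)
    then show ?thesis using p(1) by simp
  qed
  then show ?thesis by blast
qed

text \<open>For the graph \<open>G\<close> of a densely defined operator \<open>D\<close> this is
  the graph of \<open>- D\<^sup>* D\<close>: the condition says that \<open>F = D z\<close> lies in
  the domain of the adjoint, with \<open>D\<^sup>* F = - g\<close>.\<close>

definition minus_adjoint_square :: "('h::real_inner \<times> 'k::real_inner) set \<Rightarrow> ('h \<times> 'h) set" where
  "minus_adjoint_square G =
    {(z, g). \<exists>F. (z, F) \<in> G \<and> (\<forall>p P. (p, P) \<in> G \<longrightarrow> - (F \<bullet> P) = g \<bullet> p)}"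

text \<open>The range condition is von Neumann's argument: projecting \<open>(f, 0)\<close> orthogonally onto the
  closed subspace of all \<open>(p, sqrt h P)\<close> with \<open>(p, P)\<close> in the graph solves \<open>z - h A z = f\<close>.\<close>

theorem m_dissipative_minus_adjoint_square:
  fixes G :: "('h::{real_inner,complete_space} \<times> 'k::{real_inner,complete_space}) set"
  assumes G: "subspace G" "closed G"
    and triv: "\<And>w. (\<And>p P. (p, P) \<in> G \<Longrightarrow> w \<bullet> p = 0) \<Longrightarrow> w = 0"
  shows "m_dissipative (minus_adjoint_square G)" (is "m_dissipative ?A")
proof
  have add: "(p + p', P + P') \<in> G" if "(p, P) \<in> G" "(p', P') \<in> G" for p P p' P'
    using subspace_add[OF G(1) that] by simp
  have scale: "(c *\<^sub>R p, c *\<^sub>R P) \<in> G" if "(p, P) \<in> G" for p P c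
    using subspace_scale[OF G(1) that, of c] by simp
  show sub: "subspace ?A"
  proof (rule subspaceI)
    show "0 \<in> ?A" using subspace_0[OF G(1)]
      by (auto simp: minus_adjoint_square_def zero_prod_def intro!: exI[of _ 0])
  next
    fix x y assume "x \<in> ?A" "y \<in> ?A"
    then obtain z g F z' g' F' where x: "x = (z, g)" "(z, F) \<in> G" "\<And>p P. (p, P) \<in> G \<Longrightarrow> - (F \<bullet> P) = g \<bullet> p"
      and y: "y = (z', g')" "(z', F') \<in> G" "\<And>p P. (p, P) \<in> G \<Longrightarrow> - (F' \<bullet> P) = g' \<bullet> p"
      unfolding minus_adjoint_square_def by blast
    have "- ((F + F') \<bullet> P) = (g + g') \<bullet> p" if "(p, P) \<in> G" for p P
      using x(3)[OF that] y(3)[OF that] by (simp add: inner_add_left)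
    then show "x + y \<in> ?A" using add[OF x(2) y(2)] by (auto simp: minus_adjoint_square_def x(1) y(1))
  next
    fix c x assume "x \<in> ?A"
    then obtain z g F where x: "x = (z, g)" "(z, F) \<in> G" "\<And>p P. (p, P) \<in> G \<Longrightarrow> - (F \<bullet> P) = g \<bullet> p"
      unfolding minus_adjoint_square_def by blast
    have "- ((c *\<^sub>R F) \<bullet> P) = (c *\<^sub>R g) \<bullet> p" if "(p, P) \<in> G" for p P
      using x(3)[OF that, symmetric] by simp
    then have "(c *\<^sub>R z, c *\<^sub>R g) \<in> ?A" using scale[OF x(2), of c] unfolding minus_adjoint_square_def by blast
    then show "c *\<^sub>R x \<in> ?A" by (simp add: x(1))
  qed
  show diss: "x \<bullet> y \<le> 0" if xy: "(x, y) \<in> ?A" for x y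
  proof -
    obtain F where F: "(x, F) \<in> G" "\<And>p P. (p, P) \<in> G \<Longrightarrow> - (F \<bullet> P) = y \<bullet> p"
      using xy unfolding minus_adjoint_square_def by blast
    have "x \<bullet> y = - (F \<bullet> F)" using F(2)[OF F(1)] by (simp add: inner_commute)
    then show ?thesis by simp
  qed
  show ran: "\<exists>x y. (x, y) \<in> ?A \<and> x - h *\<^sub>R y = f" if h: "h > 0" for h :: real and f
  proof -
    define S where "S = (\<lambda>x::'h \<times> 'k. (fst x, (1 / sqrt h) *\<^sub>R snd x)) -` G"
    have linS: "linear (\<lambda>x::'h \<times> 'k. (fst x, (1 / sqrt h) *\<^sub>R snd x))"
      by (rule linearI) (auto simp: algebra_simps)
    have "subspace S" unfolding S_def by (rule linear_subspace_vimage[OF linS G(1)])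
    moreover have "closed S" unfolding S_def
      by (rule continuous_closed_vimage[OF G(2)]) (intro continuous_intros)
    ultimately obtain q where q: "q \<in> S" "\<And>m. m \<in> S \<Longrightarrow> ((f, 0) - q) \<bullet> m = 0"
      using orthogonal_projection_exists[of S "(f, 0)"] by blast
    define z F where "z = fst q" "F = (1 / sqrt h) *\<^sub>R snd q"
    have qeq: "q = (z, sqrt h *\<^sub>R F)" using h by (simp add: z_F_def)
    have zF: "(z, F) \<in> G" using q(1) by (simp add: S_def z_F_def)
    define g where "g = (1 / h) *\<^sub>R (z - f)"
    have "- (F \<bullet> P) = g \<bullet> p" if "(p, P) \<in> G" for p P
    proof -
      have "(p, sqrt h *\<^sub>R P) \<in> S" using that h by (simp add: S_def)
      \<comment> \<open>The two factors \<open>sqrt h\<close>, one from \<open>q\<close> and one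
        from the test pair, multiply to the \<open>h\<close> in front of
        \<open>F \<bullet> P\<close>.\<close>
      from q(2)[OF this] have "(f - z) \<bullet> p - h * (F \<bullet> P) = 0"
        using h by (simp add: qeq inner_prod_def)
      then show ?thesis using h by (simp add: g_def field_simps inner_diff_left)
    qed
    then have "(z, g) \<in> ?A" using zF by (auto simp: minus_adjoint_square_def)
    moreover have "z - h *\<^sub>R g = f" using h by (simp add: g_def)
    ultimately show ?thesis by blast
  qed
  show "closure (fst ` ?A) = UNIV"
  proof (rule closure_eq_UNIV_if_orthogonal_trivial)
    show "subspace (fst ` ?A)" by (rule linear_subspace_image[OF linear_fst sub])
    fix w assume w: "\<And>v. v \<in> fst ` ?A \<Longrightarrow> w \<bullet> v = 0"
    \<comment> \<open>Solving \<open>x - y = w\<close> turns orthogonality into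
      \<open>x \<bullet> x = x \<bullet> y \<le> 0\<close>. So \<open>x = 0\<close>, then
      \<open>F = 0\<close>, and \<open>y\<close> is orthogonal to the domain of
      \<open>G\<close>.\<close>
    obtain x y where xy: "(x, y) \<in> ?A" "x - 1 *\<^sub>R y = w" using ran[of 1 w] by auto
    have "w \<bullet> x = 0" using w xy(1) by force
    then have "x \<bullet> x - x \<bullet> y = 0" using xy(2) by (auto simp: inner_diff_right inner_commute)
    then have x0: "x = 0" using diss[OF xy(1)] inner_ge_zero[of x] by simp
    obtain F where F: "(x, F) \<in> G" "\<And>p P. (p, P) \<in> G \<Longrightarrow> - (F \<bullet> P) = y \<bullet> p"
      using xy(1) unfolding minus_adjoint_square_def by blast
    have "F = 0" using F(2)[OF F(1)] x0 by simp
    then have "y = 0" using F(2) by (intro triv) auto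
    then show "w = 0" using xy(2) x0 by simp
  qed
qed

section \<open>The Hilbert space of square-integrable functions\<close>

definition square_integrable :: "'a measure \<Rightarrow> ('a \<Rightarrow> real) \<Rightarrow> bool" where
  "square_integrable M f \<longleftrightarrow> f \<in> borel_measurable M \<and> integrable M (\<lambda>x. (f x)\<^sup>2)"

lemma square_integrable_mult:
  assumes "square_integrable M f" "square_integrable M g"
  shows "integrable M (\<lambda>x. f x * g x)"
proof (rule Bochner_Integration.integrable_bound)
  show "integrable M (\<lambda>x. (f x)\<^sup>2 + (g x)\<^sup>2)"
    using assms by (auto simp: square_integrable_def)
  show "(\<lambda>x. f x * g x) \<in> borel_measurable M"
    using assms by (auto simp: square_integrable_def)
  have "\<bar>a * b\<bar> \<le> a\<^sup>2 + b\<^sup>2" for a b :: real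
    using sum_squares_bound[of "\<bar>a\<bar>" "\<bar>b\<bar>"] mult_nonneg_nonneg[of "\<bar>a\<bar>" "\<bar>b\<bar>"]
    unfolding abs_mult power2_abs by linarith
  then show "AE x in M. norm (f x * g x) \<le> norm ((f x)\<^sup>2 + (g x)\<^sup>2)"
    by (intro AE_I2) (simp add: abs_mult)
qed

lemma square_integrable_zero: "square_integrable M (\<lambda>x. 0)"
  by (simp add: square_integrable_def)

lemma square_integrable_add:
  assumes "square_integrable M f" "square_integrable M g"
  shows "square_integrable M (\<lambda>x. f x + g x)"
proof -
  have "(\<lambda>x. (f x + g x)\<^sup>2) = (\<lambda>x. (f x)\<^sup>2 + (g x)\<^sup>2 + 2 * (f x * g x))"
    by (simp add: power2_sum fun_eq_iff)
  then show ?thesis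
    using assms square_integrable_mult[OF assms] by (auto simp: square_integrable_def)
qed

lemma square_integrable_scale:
  assumes "square_integrable M f"
  shows "square_integrable M (\<lambda>x. c * f x)"
  using assms by (auto simp: square_integrable_def power_mult_distrib)

lemma square_integrable_uminus:
  assumes "square_integrable M f"
  shows "square_integrable M (\<lambda>x. - f x)"
  using square_integrable_scale[OF assms, of "-1"] by simp

lemma square_integrable_diff:
  assumes "square_integrable M f" "square_integrable M g"
  shows "square_integrable M (\<lambda>x. f x - g x)"
  using square_integrable_add[OF assms(1) square_integrable_uminus[OF assms(2)]] by simp

lemma square_integrable_bound:
  assumes "square_integrable M g" "f \<in> borel_measurable M" "AE x in M. \<bar>f x\<bar> \<le> \<bar>g x\<bar>"
  shows "square_integrable M f"
  unfolding square_integrable_def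
proof
  show "integrable M (\<lambda>x. (f x)\<^sup>2)"
  proof (rule Bochner_Integration.integrable_bound)
    show "integrable M (\<lambda>x. (g x)\<^sup>2)" using assms(1) by (simp add: square_integrable_def)
    show "AE x in M. norm ((f x)\<^sup>2) \<le> norm ((g x)\<^sup>2)"
      using assms(3) by (auto simp: abs_le_square_iff)
  qed (use assms(2) in simp)
qed (fact assms(2))

text \<open>The pointwise bound on \<open>(f (n + k) - f n)\<^sup>2\<close> uses only \<open>(a + b)\<^sup>2 \<le> 2 a\<^sup>2 + 2 b\<^sup>2\<close>; the weights
  it produces are absorbed by the geometric decay of the increments.\<close>

lemma Riesz_Fischer_geometric:
  fixes f :: "nat \<Rightarrow> 'a \<Rightarrow> real"
  assumes f: "\<And>n. square_integrable M (f n)"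
    and decay: "\<And>n. (\<integral>x. (f (Suc n) x - f n x)\<^sup>2 \<partial>M) \<le> (1/4) ^ n"
  obtains g where "square_integrable M g" "(\<lambda>n. \<integral>x. (f n x - g x)\<^sup>2 \<partial>M) \<longlonglongrightarrow> 0"
proof -
  \<comment> \<open>The weights \<open>2 ^ n\<close> are mild enough for the integrals to stay
    summable against the decay \<open>(1/4) ^ n\<close>, and strong enough to force pointwise
    convergence.\<close>
  define w where "w = (\<lambda>n x. 2 ^ n * (f (Suc n) x - f n x)\<^sup>2)"
  have fm [measurable]: "f n \<in> borel_measurable M" for n
    using f by (auto simp: square_integrable_def)
  have wi: "integrable M (w n)" for n
    using square_integrable_diff[OF f f] by (auto simp: square_integrable_def w_def)
  have w0: "w n x \<ge> 0" for n x by (simp add: w_def)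
  have wle: "(\<integral>x. w n x \<partial>M) \<le> (1/2) ^ n" for n
  proof -
    have "(\<integral>x. w n x \<partial>M) = 2 ^ n * (\<integral>x. (f (Suc n) x - f n x)\<^sup>2 \<partial>M)" by (simp add: w_def)
    also have "\<dots> \<le> 2 ^ n * (1/4) ^ n" by (intro mult_left_mono decay) simp
    also have "\<dots> = (1/2) ^ n" by (simp flip: power_mult_distrib)
    finally show ?thesis .
  qed
  have geo: "summable (\<lambda>n. (1/2::real) ^ n)" by (simp add: summable_geometric)
  have wsum: "summable (\<lambda>n. \<integral>x. norm (w n x) \<partial>M)"
    by (rule summable_comparison_test'[OF geo, of 0]) (use wle w0 in \<open>auto simp: integral_nonneg_AE\<close>)
  have AEw: "AE x in M. summable (\<lambda>n. w n x)"
  proof -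
    have "(\<integral>\<^sup>+x. (\<Sum>n. ennreal (w n x)) \<partial>M) = (\<Sum>n. \<integral>\<^sup>+x. ennreal (w n x) \<partial>M)"
      by (rule nn_integral_suminf) (use wi in measurable)
    also have "\<dots> = (\<Sum>n. ennreal (\<integral>x. w n x \<partial>M))"
      by (simp add: nn_integral_eq_integral[OF wi] w0)
    also have "\<dots> < top"
      using wsum w0 by (simp add: integral_nonneg_AE ennreal_suminf_neq_top less_top)
    finally have "AE x in M. (\<Sum>n. ennreal (w n x)) \<noteq> top"
      by (intro nn_integral_PInf_AE[unfolded infinity_ennreal_def])
        (use wi in \<open>auto simp: less_top intro!: borel_measurable_suminf_order\<close>)
    then show ?thesis by eventually_elim (rule summable_suminf_not_top, auto simp: w0)
  qed
  define H where "H = (\<lambda>x. \<Sum>n. w n x)"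
  have Hi: "integrable M H" unfolding H_def
    by (rule integrable_suminf[OF wi]) (use AEw wsum w0 in auto)
  have incr: "(f (n + k) x - f n x)\<^sup>2 \<le> (\<Sum>j<k. 2 ^ Suc j * (f (Suc (n + j)) x - f (n + j) x)\<^sup>2)" for n k x
  proof (induction k arbitrary: n)
    case (Suc k)
    have sq: "(a + b)\<^sup>2 \<le> 2 * a\<^sup>2 + 2 * b\<^sup>2" for a b :: real
      using sum_squares_bound[of a b] by (simp add: power2_sum)
    have "(f (n + Suc k) x - f n x)\<^sup>2 \<le> 2 * (f (Suc n) x - f n x)\<^sup>2 + 2 * (f (Suc n + k) x - f (Suc n) x)\<^sup>2"
      using sq[of "f (Suc n) x - f n x" "f (Suc n + k) x - f (Suc n) x"] by simp
    also have "\<dots> \<le> 2 * (f (Suc n) x - f n x)\<^sup>2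
      + 2 * (\<Sum>j<k. 2 ^ Suc j * (f (Suc (Suc n + j)) x - f (Suc n + j) x)\<^sup>2)"
      by (intro add_left_mono mult_left_mono Suc.IH) simp
    also have "\<dots> = (\<Sum>j<Suc k. 2 ^ Suc j * (f (Suc (n + j)) x - f (n + j) x)\<^sup>2)"
      by (subst sum.lessThan_Suc_shift) (simp add: sum_distrib_left algebra_simps)
    finally show ?case .
  qed simp
  have incrH: "(f (n + k) x - f n x)\<^sup>2 \<le> 2 * (1/2) ^ n * H x" if "summable (\<lambda>n. w n x)" for n k x
  proof -
    have "2 ^ Suc j * (f (Suc (n + j)) x - f (n + j) x)\<^sup>2 = 2 * (1/2) ^ n * w (n + j) x" for j
      by (simp add: w_def power_add field_simps)
    then have "(f (n + k) x - f n x)\<^sup>2 \<le> 2 * (1/2) ^ n * (\<Sum>j<k. w (n + j) x)"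
      using incr[of n k x] unfolding sum_distrib_left by (simp only:)
    also have "(\<Sum>j<k. w (n + j) x) = sum (\<lambda>i. w i x) {n..<n + k}"
      by (rule sum.reindex_bij_witness[of _ "\<lambda>i. i - n" "\<lambda>j. n + j"]) auto
    also have "\<dots> \<le> H x" unfolding H_def
      by (rule sum_le_suminf[OF that]) (auto simp: w0)
    finally show ?thesis by (simp add: mult_left_mono)
  qed
  define g where "g = (\<lambda>x. lim (\<lambda>n. f n x))"
  have gm [measurable]: "g \<in> borel_measurable M" unfolding g_def by measurable
  have lim: "(\<lambda>n. f n x) \<longlonglongrightarrow> g x" if "summable (\<lambda>n. w n x)" for x
  proof -
    have "\<bar>f (Suc n) x - f n x\<bar> \<le> (1/2) ^ n + w n x" for n
    proof -
      \<comment> \<open>AM-GM, used with \<open>p = 2 ^ n\<close>: the increment is at most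
        \<open>(1/2) ^ n + w n x\<close>, so summability of \<open>w\<close> gives absolute
        summability of the increments.\<close>
      have am: "\<bar>d\<bar> \<le> 1 / p + p * d\<^sup>2" if "p > 0" for d p :: real
      proof -
        have "0 \<le> (1 - p * \<bar>d\<bar>)\<^sup>2" by simp
        then have "p * \<bar>d\<bar> \<le> 1 + p\<^sup>2 * d\<^sup>2" using that
          by (simp add: power2_diff power_mult_distrib) (smt (verit) mult_nonneg_nonneg abs_ge_zero)
        then show ?thesis using that by (simp add: field_simps power2_eq_square)
      qed
      show ?thesis using am[of "2 ^ n" "f (Suc n) x - f n x"] by (simp add: w_def power_one_over)
    qed
    then have "summable (\<lambda>n. f (Suc n) x - f n x)"
      by (intro summable_comparison_test'[OF summable_add[OF geo that], of 0]) auto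
    then have "convergent (\<lambda>n. \<Sum>k<n. f (Suc k) x - f k x)"
      by (simp add: summable_iff_convergent)
    then have "convergent (\<lambda>n. f n x - f 0 x)" unfolding sum_lessThan_telescope[of "\<lambda>k. f k x"] .
    from convergent_add[OF this convergent_const[of "f 0 x"]]
    show ?thesis unfolding g_def by (simp add: convergent_LIMSEQ_iff)
  qed
  have bnd: "AE x in M. (f n x - g x)\<^sup>2 \<le> 2 * (1/2) ^ n * H x" for n
    using AEw
  proof eventually_elim
    case (elim x)
    have "(\<lambda>k. (f (n + k) x - f n x)\<^sup>2) \<longlonglongrightarrow> (g x - f n x)\<^sup>2"
      by (intro tendsto_intros) (use LIMSEQ_ignore_initial_segment[OF lim[OF elim], of n] in \<open>simp add: add.commute\<close>)
    then have "(g x - f n x)\<^sup>2 \<le> 2 * (1/2) ^ n * H x"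
      by (rule LIMSEQ_le_const2) (use incrH[OF elim] in auto)
    then show ?case by (simp add: power2_commute)
  qed
  have di: "integrable M (\<lambda>x. (f n x - g x)\<^sup>2)" for n
    by (rule Bochner_Integration.integrable_bound[of M "\<lambda>x. 2 * (1/2) ^ n * H x"])
      (use Hi bnd[of n] in \<open>auto elim!: eventually_mono\<close>)
  have "square_integrable M (\<lambda>x. f 0 x - g x)"
    using di[of 0] by (simp add: square_integrable_def)
  from square_integrable_diff[OF f[of 0] this] have "square_integrable M g" by simp
  moreover have "(\<lambda>n. \<integral>x. (f n x - g x)\<^sup>2 \<partial>M) \<longlonglongrightarrow> 0"
  proof (rule tendsto_sandwich[of "\<lambda>_. 0"])
    have "(\<integral>x. (f n x - g x)\<^sup>2 \<partial>M) \<le> (\<integral>x. 2 * (1/2) ^ n * H x \<partial>M)" for n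
      by (rule integral_mono_AE[OF di _ bnd]) (use Hi in simp)
    then show "eventually (\<lambda>n. (\<integral>x. (f n x - g x)\<^sup>2 \<partial>M) \<le> 2 * (1/2) ^ n * (\<integral>x. H x \<partial>M)) sequentially"
      by simp
    have "(\<lambda>n. 2 * (1/2) ^ n * (\<integral>x. H x \<partial>M)) \<longlonglongrightarrow> 2 * 0 * (\<integral>x. H x \<partial>M)"
      by (intro tendsto_intros LIMSEQ_power_zero) simp
    then show "(\<lambda>n. 2 * (1/2) ^ n * (\<integral>x. H x \<partial>M)) \<longlonglongrightarrow> 0" by simp
  qed auto
  ultimately show thesis by (rule that)
qed

\<comment> \<open>The quotient is partial because only square-integrable functions have a class;
  identifying functions that agree almost everywhere makes the inner product definite.\<close>
quotient_type (overloaded) 'a l2 = "'a::euclidean_space \<Rightarrow> real" / partial: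
  "\<lambda>f g. square_integrable lebesgue f \<and> square_integrable lebesgue g \<and> (AE x in lebesgue. f x = g x)"
proof (rule part_equivpI)
  show "\<exists>f::'a \<Rightarrow> real. square_integrable lebesgue f \<and> square_integrable lebesgue f \<and> (AE x in lebesgue. f x = f x)"
    using square_integrable_zero by auto
qed (auto intro!: sympI transpI elim: eventually_elim2)

instantiation l2 :: (euclidean_space) real_inner
begin

lift_definition zero_l2 :: "'a l2" is "\<lambda>_. 0"
  by (simp add: square_integrable_zero)

lift_definition plus_l2 :: "'a l2 \<Rightarrow> 'a l2 \<Rightarrow> 'a l2" is "\<lambda>f g x. f x + g x"
  by (auto intro: square_integrable_add elim: eventually_elim2)

lift_definition minus_l2 :: "'a l2 \<Rightarrow> 'a l2 \<Rightarrow> 'a l2" is "\<lambda>f g x. f x - g x"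
  by (auto intro: square_integrable_diff elim: eventually_elim2)

lift_definition uminus_l2 :: "'a l2 \<Rightarrow> 'a l2" is "\<lambda>f x. - f x"
  by (auto intro: square_integrable_uminus)

lift_definition scaleR_l2 :: "real \<Rightarrow> 'a l2 \<Rightarrow> 'a l2" is "\<lambda>c f x. c * f x"
  by (auto intro: square_integrable_scale elim: eventually_mono)

lift_definition inner_l2 :: "'a l2 \<Rightarrow> 'a l2 \<Rightarrow> real" is "\<lambda>f g. \<integral>x. f x * g x \<partial>lebesgue"
  by (intro integral_cong_AE) (auto simp: square_integrable_def elim: eventually_elim2)

definition norm_l2 :: "'a l2 \<Rightarrow> real" where "norm_l2 u = sqrt (u \<bullet> u)"
definition dist_l2 :: "'a l2 \<Rightarrow> 'a l2 \<Rightarrow> real" where "dist_l2 u v = norm (u - v)"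
definition sgn_l2 :: "'a l2 \<Rightarrow> 'a l2" where "sgn_l2 u = inverse (norm u) *\<^sub>R u"
definition uniformity_l2 :: "('a l2 \<times> 'a l2) filter" where
  "uniformity_l2 = (INF e\<in>{0<..}. principal {(u, v). dist u v < e})"
definition open_l2 :: "'a l2 set \<Rightarrow> bool" where
  "open_l2 U \<longleftrightarrow> (\<forall>u\<in>U. \<forall>\<^sub>F (u', v) in uniformity. u' = u \<longrightarrow> v \<in> U)"

instance
proof
  fix u v w :: "'a l2" and r s :: real
  show "u + v + w = u + (v + w)" by transfer (auto intro: square_integrable_add simp: add.assoc)
  show "u + v = v + u" by transfer (auto intro: square_integrable_add simp: add.commute)
  show "0 + u = u" by transfer auto
  show "- u + u = 0" by transfer (auto simp: square_integrable_zero)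
  show "u - v = u + - v" by transfer (auto intro: square_integrable_diff)
  show "r *\<^sub>R (u + v) = r *\<^sub>R u + r *\<^sub>R v"
    by transfer (auto intro!: square_integrable_add square_integrable_scale simp: distrib_left)
  show "(r + s) *\<^sub>R u = r *\<^sub>R u + s *\<^sub>R u"
    by transfer (auto intro!: square_integrable_add square_integrable_scale simp: distrib_right)
  show "r *\<^sub>R s *\<^sub>R u = (r * s) *\<^sub>R u"
    by transfer (auto intro!: square_integrable_scale simp: mult.assoc)
  show "1 *\<^sub>R u = u" by transfer auto
  show "u \<bullet> v = v \<bullet> u" by transfer (simp add: mult.commute)
  show "(u + v) \<bullet> w = u \<bullet> w + v \<bullet> w"
    by transfer (simp add: distrib_right Bochner_Integration.integral_add square_integrable_mult)
  show "(r *\<^sub>R u) \<bullet> v = r * (u \<bullet> v)"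
    by transfer (simp add: mult.assoc)
  show "0 \<le> u \<bullet> u" by transfer (simp add: integral_nonneg_AE)
  show "u \<bullet> u = 0 \<longleftrightarrow> u = 0"
    by transfer
      (simp add: square_integrable_zero power2_eq_square[symmetric] integral_nonneg_eq_0_iff_AE square_integrable_def)
qed (fact dist_l2_def sgn_l2_def uniformity_l2_def open_l2_def norm_l2_def)+

end

section \<open>Classes and their representatives\<close>

definition class_l2 :: "('a::euclidean_space \<Rightarrow> real) \<Rightarrow> 'a l2" where
  "class_l2 f = abs_l2 f"

lemma rep_l2: "square_integrable lebesgue (rep_l2 u)" "class_l2 (rep_l2 u) = u"
  using Quotient3_rep_reflp[OF Quotient3_l2, of u] Quotient3_abs_rep[OF Quotient3_l2, of u]
  unfolding class_l2_def by auto

lemma class_l2_eq_iff: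
  assumes "square_integrable lebesgue f" "square_integrable lebesgue g"
  shows "class_l2 f = class_l2 g \<longleftrightarrow> (AE x in lebesgue. f x = g x)"
  using Quotient3_rel[OF Quotient3_l2, of f g] assms unfolding class_l2_def by auto

lemma class_l2_ops:
  assumes "square_integrable lebesgue f" "square_integrable lebesgue g"
  shows "class_l2 f + class_l2 g = class_l2 (\<lambda>x. f x + g x)"
    and "class_l2 f - class_l2 g = class_l2 (\<lambda>x. f x - g x)"
    and "c *\<^sub>R class_l2 f = class_l2 (\<lambda>x. c * f x)"
    and "class_l2 f \<bullet> class_l2 g = (\<integral>x. f x * g x \<partial>lebesgue)"
  unfolding class_l2_def
  using assms by (simp_all add: plus_l2.abs_eq minus_l2.abs_eq scaleR_l2.abs_eq inner_l2.abs_eq)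

lemma zero_eq_class_l2: "0 = class_l2 (\<lambda>_. 0)"
  by (simp add: zero_l2_def class_l2_def)

lemma norm_class_l2:
  assumes "square_integrable lebesgue f"
  shows "norm (class_l2 f) = sqrt (\<integral>x. (f x)\<^sup>2 \<partial>lebesgue)"
  by (simp add: norm_l2_def class_l2_ops(4)[OF assms assms] power2_eq_square)

text \<open>Supplies the decay that \<open>Riesz_Fischer_geometric\<close> asks for; a Cauchy
  sequence with a convergent subsequence converges.\<close>

lemma Cauchy_geometric_subseq:
  fixes X :: "nat \<Rightarrow> 'b::metric_space"
  assumes "Cauchy X"
  obtains r where "strict_mono r" "\<And>k. dist (X (r (Suc k))) (X (r k)) < (1/2) ^ k"
proof -
  have "\<exists>N. \<forall>m\<ge>N. \<forall>n\<ge>N. dist (X m) (X n) < (1/2) ^ k" for k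
    using assms unfolding Cauchy_def by (auto dest!: spec[of _ "(1/2) ^ k"])
  then obtain N where N: "\<And>k m n. m \<ge> N k \<Longrightarrow> n \<ge> N k \<Longrightarrow> dist (X m) (X n) < (1/2) ^ k"
    by metis
  \<comment> \<open>The sum dominates \<open>N k\<close>, and the summand \<open>k\<close> makes
    \<open>r\<close> strictly increasing.\<close>
  define r where "r = (\<lambda>k. k + (\<Sum>j\<le>k. N j))"
  have "strict_mono r" unfolding strict_mono_Suc_iff by (simp add: r_def)
  moreover have rN: "r k \<ge> N k" for k
    using member_le_sum[of k "{..k}" N] by (simp add: r_def)
  moreover have "r (Suc k) \<ge> r k" for k by (simp add: r_def)
  ultimately show thesis using that[of r] N by (metis order_trans)
qed

instance l2 :: (euclidean_space) complete_space
proof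
  fix X :: "nat \<Rightarrow> 'a l2" assume X: "Cauchy X"
  then obtain r where r: "strict_mono r" "\<And>k. dist (X (r (Suc k))) (X (r k)) < (1/2) ^ k"
    by (rule Cauchy_geometric_subseq) blast
  define f where "f = (\<lambda>k. rep_l2 (X (r k)))"
  have f: "square_integrable lebesgue (f k)" "X (r k) = class_l2 (f k)" for k
    by (simp_all add: f_def rep_l2)
  have nrm: "(norm (class_l2 (f k) - class_l2 g))\<^sup>2 = (\<integral>x. (f k x - g x)\<^sup>2 \<partial>lebesgue)"
    if "square_integrable lebesgue g" for k g
    using that by (simp add: class_l2_ops(2) f(1) norm_class_l2 square_integrable_diff integral_nonneg_AE)
  have "(\<integral>x. (f (Suc k) x - f k x)\<^sup>2 \<partial>lebesgue) \<le> (1/4) ^ k" for k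
  proof -
    have "(\<integral>x. (f (Suc k) x - f k x)\<^sup>2 \<partial>lebesgue) = (dist (X (r (Suc k))) (X (r k)))\<^sup>2"
      by (simp add: dist_norm f(2) nrm f(1))
    also have "\<dots> \<le> ((1/2) ^ k)\<^sup>2" using r(2)[of k] by (intro power_mono) auto
    also have "\<dots> = (1/4) ^ k" by (simp add: power2_eq_square flip: power_mult_distrib)
    finally show ?thesis .
  qed
  with f(1) obtain g where g: "square_integrable lebesgue g"
    "(\<lambda>k. \<integral>x. (f k x - g x)\<^sup>2 \<partial>lebesgue) \<longlonglongrightarrow> 0"
    by (rule Riesz_Fischer_geometric) blast
  have "(\<lambda>k. sqrt ((norm (class_l2 (f k) - class_l2 g))\<^sup>2)) \<longlonglongrightarrow> sqrt 0"
    using g(2) unfolding nrm[OF g(1)] by (rule tendsto_real_sqrt)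
  then have "(\<lambda>k. X (r k)) \<longlonglongrightarrow> class_l2 g"
    by (simp add: f(2) tendsto_norm_zero_iff LIM_zero_iff)
  then have "X \<longlonglongrightarrow> class_l2 g"
    using Cauchy_converges_subseq[OF X r(1)] by (simp add: o_def)
  then show "convergent X" by (auto simp: convergent_def)
qed

text \<open>A subset \<open>S\<close> cannot be a parameter of a type, so the square-integrable functions on \<open>S\<close> are
  represented by their extensions by zero, that is, by the range of \<open>proj_l2 S\<close>.\<close>

definition ext_l2 :: "'a::euclidean_space set \<Rightarrow> ('a \<Rightarrow> real) \<Rightarrow> 'a l2" where
  "ext_l2 S f = class_l2 (\<lambda>x. indicator S x * f x)"

definition proj_l2 :: "'a::euclidean_space set \<Rightarrow> 'a l2 \<Rightarrow> 'a l2" where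
  "proj_l2 S u = ext_l2 S (rep_l2 u)"

lemma indicator_power2: "(indicator S x * a)\<^sup>2 = indicator S x * a\<^sup>2" for a :: real
  by (simp add: indicator_def)

section \<open>Functions on a measurable set and their extensions by zero\<close>

context
  fixes S :: "'a::euclidean_space set"
  assumes S: "S \<in> sets lebesgue"
begin

lemma borel_measurable_lebesgue_on_iff:
  "f \<in> borel_measurable (lebesgue_on S) \<longleftrightarrow> (\<lambda>x. indicator S x * f x :: real) \<in> borel_measurable lebesgue"
  using borel_measurable_restrict_space_iff[of S lebesgue f] S by simp

lemma integrable_lebesgue_on_iff:
  "integrable (lebesgue_on S) f \<longleftrightarrow> integrable lebesgue (\<lambda>x. indicator S x * f x :: real)"
  using integrable_restrict_space[of S lebesgue f] S by simp

lemma integral_lebesgue_on_eq: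
  "integral\<^sup>L (lebesgue_on S) f = (\<integral>x. indicator S x * f x \<partial>lebesgue)" for f :: "'a \<Rightarrow> real"
  using integral_restrict_space[of S lebesgue f] S by simp

lemma AE_lebesgue_on_iff:
  "(AE x in lebesgue_on S. P x) \<longleftrightarrow> (AE x in lebesgue. x \<in> S \<longrightarrow> P x)"
  using AE_restrict_space_iff[of S lebesgue P] S by simp

lemma L2_iff_square_integrable:
  "f \<in> L2 S \<longleftrightarrow> square_integrable lebesgue (\<lambda>x. indicator S x * f x)"
  by (simp add: L2_def square_integrable_def borel_measurable_lebesgue_on_iff
      integrable_lebesgue_on_iff indicator_power2)

lemma L2_iff_square_integrable_on: "f \<in> L2 S \<longleftrightarrow> square_integrable (lebesgue_on S) f"
  by (simp add: L2_def square_integrable_def)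

lemma inner_ext_l2:
  assumes "f \<in> L2 S" "g \<in> L2 S"
  shows "ext_l2 S f \<bullet> ext_l2 S g = (\<integral>x. f x * g x \<partial>lebesgue_on S)"
proof -
  have "ext_l2 S f \<bullet> ext_l2 S g = (\<integral>x. (indicator S x * f x) * (indicator S x * g x) \<partial>lebesgue)"
    using assms by (simp add: ext_l2_def class_l2_ops(4) L2_iff_square_integrable)
  also have "\<dots> = (\<integral>x. indicator S x * (f x * g x) \<partial>lebesgue)"
    by (intro Bochner_Integration.integral_cong) (auto simp: indicator_def)
  finally show ?thesis by (simp add: integral_lebesgue_on_eq)
qed

lemma norm_ext_l2:
  assumes "f \<in> L2 S"
  shows "norm (ext_l2 S f) = L2norm S f"
  using inner_ext_l2[OF assms assms] by (simp add: norm_eq_sqrt_inner L2norm_def power2_eq_square)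

lemma ext_l2_eq_iff:
  assumes "f \<in> L2 S" "g \<in> L2 S"
  shows "ext_l2 S f = ext_l2 S g \<longleftrightarrow> ae_eq S f g"
proof -
  have "ext_l2 S f = ext_l2 S g \<longleftrightarrow> (AE x in lebesgue. indicator S x * f x = indicator S x * g x)"
    using assms by (simp add: ext_l2_def class_l2_eq_iff L2_iff_square_integrable)
  also have "\<dots> \<longleftrightarrow> ae_eq S f g"
    unfolding ae_eq_def AE_lebesgue_on_iff by (intro arg_cong[where f = "\<lambda>P. almost_everywhere lebesgue P"])
      (auto simp: indicator_def fun_eq_iff)
  finally show ?thesis .
qed

lemma L2_add: "f \<in> L2 S \<Longrightarrow> g \<in> L2 S \<Longrightarrow> (\<lambda>x. f x + g x) \<in> L2 S"
  unfolding L2_iff_square_integrable_on by (rule square_integrable_add)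

lemma L2_diff: "f \<in> L2 S \<Longrightarrow> g \<in> L2 S \<Longrightarrow> (\<lambda>x. f x - g x) \<in> L2 S"
  unfolding L2_iff_square_integrable_on by (rule square_integrable_diff)

lemma L2_scale: "f \<in> L2 S \<Longrightarrow> (\<lambda>x. c * f x) \<in> L2 S"
  unfolding L2_iff_square_integrable_on by (rule square_integrable_scale)

lemma ext_l2_add:
  assumes "f \<in> L2 S" "g \<in> L2 S"
  shows "ext_l2 S (\<lambda>x. f x + g x) = ext_l2 S f + ext_l2 S g"
  using assms by (simp add: ext_l2_def class_l2_ops(1) L2_iff_square_integrable distrib_left)

lemma ext_l2_diff:
  assumes "f \<in> L2 S" "g \<in> L2 S"
  shows "ext_l2 S (\<lambda>x. f x - g x) = ext_l2 S f - ext_l2 S g"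
  using assms by (simp add: ext_l2_def class_l2_ops(2) L2_iff_square_integrable right_diff_distrib)

lemma ext_l2_scale:
  assumes "f \<in> L2 S"
  shows "ext_l2 S (\<lambda>x. c * f x) = c *\<^sub>R ext_l2 S f"
  using assms by (simp add: ext_l2_def class_l2_ops(3)[of _ "\<lambda>_. 0"] square_integrable_zero
      L2_iff_square_integrable mult.left_commute)

lemma square_integrable_imp_L2:
  assumes f: "square_integrable lebesgue f"
  shows "f \<in> L2 S"
  unfolding L2_iff_square_integrable
proof (rule square_integrable_bound[OF f])
  have [measurable]: "f \<in> borel_measurable lebesgue" using f by (simp add: square_integrable_def)
  show "(\<lambda>x. indicator S x * f x) \<in> borel_measurable lebesgue" using S by measurable
qed (auto simp: indicator_def)

lemma rep_l2_in_L2: "rep_l2 u \<in> L2 S"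
  by (rule square_integrable_imp_L2[OF rep_l2(1)])

lemma ext_l2_rep_l2: "ext_l2 S (rep_l2 u) = proj_l2 S u"
  by (simp add: proj_l2_def)

text \<open>\<open>rep_l2\<close> picks some representative; any other differs from it on a null
  set, which the class does not see.\<close>

lemma proj_l2_class_l2:
  assumes "square_integrable lebesgue f"
  shows "proj_l2 S (class_l2 f) = ext_l2 S f"
proof -
  have "AE x in lebesgue. rep_l2 (class_l2 f) x = f x"
    using class_l2_eq_iff[OF rep_l2(1) assms] rep_l2(2) by blast
  then show ?thesis
    unfolding proj_l2_def ext_l2_eq_iff[OF rep_l2_in_L2 square_integrable_imp_L2[OF assms]] ae_eq_def
      AE_lebesgue_on_iff by eventually_elim simp
qed

lemma proj_l2_ext_l2 [simp]:
  assumes "f \<in> L2 S"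
  shows "proj_l2 S (ext_l2 S f) = ext_l2 S f"
proof -
  have "(\<lambda>x. indicator S x * (indicator S x * f x)) = (\<lambda>x. indicator S x * f x)"
    by (auto simp: indicator_def fun_eq_iff)
  then show ?thesis using proj_l2_class_l2 assms
    unfolding ext_l2_def L2_iff_square_integrable by simp
qed

lemma proj_l2_idem [simp]: "proj_l2 S (proj_l2 S u) = proj_l2 S u"
  by (simp add: proj_l2_def[of S u] rep_l2_in_L2)

text \<open>An extension by zero pairs only with the values on \<open>S\<close>.\<close>

lemma inner_ext_l2_proj_l2:
  assumes "f \<in> L2 S"
  shows "ext_l2 S f \<bullet> proj_l2 S u = ext_l2 S f \<bullet> u"
proof -
  have "ext_l2 S f \<bullet> u = (\<integral>x. (indicator S x * f x) * rep_l2 u x \<partial>lebesgue)"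
    using class_l2_ops(4)[OF assms[unfolded L2_iff_square_integrable] rep_l2(1)[of u]]
    by (simp add: ext_l2_def rep_l2)
  then show ?thesis
    by (simp add: proj_l2_def inner_ext_l2[OF assms rep_l2_in_L2] integral_lebesgue_on_eq mult.assoc)
qed

lemma inner_ext_l2_rep_l2:
  assumes "f \<in> L2 S"
  shows "u \<bullet> ext_l2 S f = (\<integral>x. rep_l2 u x * f x \<partial>lebesgue_on S)"
  using inner_ext_l2_proj_l2[OF assms, of u] inner_ext_l2[OF rep_l2_in_L2 assms, of u]
  by (simp add: proj_l2_def inner_commute)

lemma inner_proj_l2: "proj_l2 S u \<bullet> v = u \<bullet> proj_l2 S v"
  using inner_ext_l2_proj_l2[OF rep_l2_in_L2, of u v] inner_ext_l2_proj_l2[OF rep_l2_in_L2, of v u]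
  by (simp add: proj_l2_def inner_commute)

lemma linear_proj_l2: "linear (proj_l2 S)"
proof
  fix u v :: "'a l2" and c :: real
  have "u + v = class_l2 (\<lambda>x. rep_l2 u x + rep_l2 v x)"
    using class_l2_ops(1)[OF rep_l2(1)[of u] rep_l2(1)[of v]] by (simp add: rep_l2)
  then show "proj_l2 S (u + v) = proj_l2 S u + proj_l2 S v"
    by (simp add: proj_l2_class_l2 square_integrable_add rep_l2 ext_l2_add rep_l2_in_L2 ext_l2_rep_l2)
  have "c *\<^sub>R u = class_l2 (\<lambda>x. c * rep_l2 u x)"
    using class_l2_ops(3)[OF rep_l2(1)[of u] rep_l2(1)[of u]] by (simp add: rep_l2)
  then show "proj_l2 S (c *\<^sub>R u) = c *\<^sub>R proj_l2 S u"
    by (simp add: proj_l2_class_l2 square_integrable_scale rep_l2 ext_l2_scale rep_l2_in_L2 ext_l2_rep_l2)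
qed

lemma norm_proj_l2: "norm (proj_l2 S u) \<le> norm u"
proof (cases "proj_l2 S u = 0")
  case False
  have "norm (proj_l2 S u) * norm (proj_l2 S u) = proj_l2 S u \<bullet> u"
    using inner_proj_l2[of "proj_l2 S u" u] by (simp add: dot_square_norm power2_eq_square)
  also have "\<dots> \<le> norm (proj_l2 S u) * norm u" by (rule norm_cauchy_schwarz)
  finally show ?thesis using False by simp
qed simp

lemma continuous_on_proj_l2: "continuous_on T (proj_l2 S)"
  by (intro linear_continuous_on bounded_linear.intro linear_proj_l2 bounded_linear_axioms.intro exI[of _ 1])
    (simp add: norm_proj_l2)

end

section \<open>Test functions and weak gradients\<close>

lemma pderiv_i_eq:
  assumes "(f has_derivative f') (at y)"
  shows "pderiv_i i f y = f' (axis i 1)"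
  unfolding pderiv_i_def frechet_derivative_at[OF assms, symmetric] ..

lemma pderiv_i_add:
  assumes "\<And>y. f differentiable (at y)" "\<And>y. g differentiable (at y)"
  shows "pderiv_i i (\<lambda>y. f y + g y) = (\<lambda>y. pderiv_i i f y + pderiv_i i g y)"
proof
  fix y
  from assms[unfolded frechet_derivative_works]
  show "pderiv_i i (\<lambda>y. f y + g y) y = pderiv_i i f y + pderiv_i i g y"
    by (subst pderiv_i_eq[OF has_derivative_add]) (auto simp: pderiv_i_def)
qed

lemma pderiv_i_mult:
  assumes "\<And>y. f differentiable (at y)" "\<And>y. g differentiable (at y)"
  shows "pderiv_i i (\<lambda>y. f y * g y) = (\<lambda>y. f y * pderiv_i i g y + pderiv_i i f y * g y)"
proof
  fix y
  from assms[unfolded frechet_derivative_works]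
  show "pderiv_i i (\<lambda>y. f y * g y) y = f y * pderiv_i i g y + pderiv_i i f y * g y"
    by (subst pderiv_i_eq[OF has_derivative_mult]) (auto simp: pderiv_i_def)
qed

lemma Ck_imp_continuous: "Ck k f \<Longrightarrow> continuous_on UNIV f"
  by (cases k) auto

lemma Ck_Suc_imp_Ck: "Ck (Suc k) f \<Longrightarrow> Ck k f"
proof (induction k arbitrary: f)
  case (Suc k)
  have "f differentiable (at y)" for y using Suc.prems unfolding Ck.simps(2)[of "Suc k"] by blast
  moreover have "continuous_on UNIV f" using Suc.prems by (rule Ck_imp_continuous)
  moreover have "Ck k (pderiv_i i f)" for i
    using Suc.prems unfolding Ck.simps(2)[of "Suc k"] by (intro Suc.IH) blast
  ultimately show ?case by simp
qed simp

lemma Ck_const: "Ck k (\<lambda>y. c)"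
proof (induction k arbitrary: c)
  case (Suc k)
  have "pderiv_i i (\<lambda>y. c) = (\<lambda>y. 0)" for i :: 'a
    by (rule ext) (simp add: pderiv_i_eq[OF has_derivative_const])
  then show ?case using Suc by simp
qed simp

lemma Ck_add: "Ck k f \<Longrightarrow> Ck k g \<Longrightarrow> Ck k (\<lambda>y. f y + g y)"
proof (induction k arbitrary: f g)
  case (Suc k)
  then show ?case by (auto simp: pderiv_i_add intro: continuous_on_add)
qed (auto intro: continuous_on_add)

lemma Ck_mult: "Ck k f \<Longrightarrow> Ck k g \<Longrightarrow> Ck k (\<lambda>y. f y * g y)"
proof (induction k arbitrary: f g)
  case (Suc k)
  have "Ck k f" "Ck k g" using Suc.prems by (auto intro: Ck_Suc_imp_Ck)
  then have "Ck k (pderiv_i i (\<lambda>y. f y * g y))" for i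
    using Suc.prems by (subst pderiv_i_mult) (auto intro!: Ck_add Suc.IH)
  then show ?case using Suc.prems by (auto intro: continuous_on_mult)
qed (auto intro: continuous_on_mult)

lemma Ck_prod:
  assumes "\<And>j. j \<in> I \<Longrightarrow> Ck k (f j)"
  shows "Ck k (\<lambda>y. \<Prod>j\<in>I. f j y)"
  using assms by (induction I rule: infinite_finite_induct) (auto intro: Ck_const Ck_mult)

lemma smooth_mult: "smooth f \<Longrightarrow> smooth g \<Longrightarrow> smooth (\<lambda>y. f y * g y)"
  by (auto simp: smooth_def intro: Ck_mult)

lemma smooth_differentiable: "smooth f \<Longrightarrow> f differentiable (at y)"
  unfolding smooth_def by (metis Ck.simps(2))

lemma smooth_continuous: "smooth f \<Longrightarrow> continuous_on UNIV f"
  unfolding smooth_def using Ck_imp_continuous by blast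

lemma smooth_pderiv_i: "smooth f \<Longrightarrow> smooth (pderiv_i i f)"
  unfolding smooth_def by (metis Ck.simps(2))

text \<open>The functions \<open>p(1/t) exp(-1/t)\<close>, extended by zero to \<open>t \<le> 0\<close>, are closed under differentiation.\<close>

definition flat :: "real poly \<Rightarrow> real \<Rightarrow> real" where
  "flat p t = (if t > 0 then poly p (1 / t) * exp (- (1 / t)) else 0)"

lemma poly_times_exp_minus_tendsto_0: "((\<lambda>s::real. poly p s * exp (- s)) \<longlongrightarrow> 0) at_top"
proof -
  have "((\<lambda>s. \<Sum>i\<le>degree p. coeff p i * (s ^ i / exp s)) \<longlongrightarrow> (\<Sum>i\<le>degree p. coeff p i * 0)) at_top"
    by (intro tendsto_intros tendsto_power_div_exp_0)
  moreover have "(\<Sum>i\<le>degree p. coeff p i * (s ^ i / exp s)) = poly p s * exp (- s)" for s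
    by (simp add: poly_altdef sum_distrib_right exp_minus divide_inverse mult.assoc)
  ultimately show ?thesis by simp
qed

lemma flat_tendsto_0: "(flat p \<longlongrightarrow> 0) (at_right 0)"
proof -
  have "((\<lambda>t. poly p (inverse t) * exp (- (inverse t))) \<longlongrightarrow> 0) (at_right 0)"
    by (rule filterlim_compose[OF poly_times_exp_minus_tendsto_0 filterlim_inverse_at_top_right])
  then show ?thesis
    by (rule tendsto_cong[THEN iffD1, rotated])
      (auto simp: flat_def inverse_eq_divide intro: eventually_mono[OF eventually_at_right_less])
qed

text \<open>With \<open>s = 1/t\<close>, the derivative in \<open>t\<close> of
  \<open>p(s) exp(-s)\<close> is \<open>s\<^sup>2 (p - p')(s) exp(-s)\<close>; the polynomial
  \<open>[:0, 0, 1:]\<close> is \<open>s\<^sup>2\<close>.\<close>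

lemma flat_has_derivative:
  "(flat p has_real_derivative flat ([:0, 0, 1:] * (p - pderiv p)) t) (at t)"
proof -
  consider "t > 0" | "t < 0" | "t = 0" by linarith
  then show ?thesis
  proof cases
    case 1
    have "((\<lambda>t. poly p (1 / t) * exp (- (1 / t))) has_real_derivative
        flat ([:0, 0, 1:] * (p - pderiv p)) t) (at t)"
      using 1 by (auto intro!: derivative_eq_intros DERIV_chain2[OF poly_DERIV]
          simp: flat_def field_simps power2_eq_square)
    then show ?thesis
      by (rule has_field_derivative_transform_within_open[of _ _ _ "{0<..}"])
        (use 1 in \<open>auto simp: flat_def\<close>)
  next
    case 2
    have "((\<lambda>t. 0) has_real_derivative flat ([:0, 0, 1:] * (p - pderiv p)) t) (at t)"
      using 2 by (simp add: flat_def)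
    then show ?thesis
      by (rule has_field_derivative_transform_within_open[of _ _ _ "{..<0}"])
        (use 2 in \<open>auto simp: flat_def\<close>)
  next
    case 3
    have "((\<lambda>h. flat p h / h) \<longlongrightarrow> 0) (at 0)"
    proof (rule filterlim_split_at)
      show "((\<lambda>h. flat p h / h) \<longlongrightarrow> 0) (at_left 0)"
        by (rule tendsto_eventually) (simp add: flat_def eventually_at_filter)
      \<comment> \<open>For \<open>h > 0\<close> the quotient is again of the form
        \<open>flat\<close>: dividing by \<open>h\<close> multiplies the polynomial by its
        variable.\<close>
      show "((\<lambda>h. flat p h / h) \<longlongrightarrow> 0) (at_right 0)"
        by (rule tendsto_cong[THEN iffD1, rotated, OF flat_tendsto_0[of "[:0, 1:] * p"]])
          (auto simp: flat_def intro: eventually_mono[OF eventually_at_right_less])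
    qed
    then show ?thesis using 3 by (simp add: DERIV_def flat_def)
  qed
qed

text \<open>The induction runs over all \<open>p\<close> at once, since each differentiation changes
  the polynomial.\<close>

lemma Ck_flat: "Ck k (\<lambda>y. flat p (c * y $ i + d))"
proof (induction k arbitrary: p)
  case 0
  have "continuous_on UNIV (flat p)"
    using flat_has_derivative DERIV_continuous_on by blast
  then show ?case
    by (auto intro!: continuous_on_compose2[of UNIV "flat p"] continuous_intros)
next
  case (Suc k)
  let ?q = "[:0, 0, 1:] * (p - pderiv p)"
  have D: "((\<lambda>y. flat p (c * y $ i + d)) has_derivative
      (\<lambda>v. flat ?q (c * y $ i + d) * (c * v $ i))) (at y)" for y :: "real^'a"
    by (rule has_derivative_compose[OF _ flat_has_derivative[unfolded has_field_derivative_def]])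
      (auto intro!: derivative_eq_intros bounded_linear_imp_has_derivative bounded_linear_vec_nth)
  have "pderiv_i j (\<lambda>y. flat p (c * y $ i + d)) = (\<lambda>y. (c * axis j 1 $ i) * flat ?q (c * y $ i + d))" for j
    by (rule ext) (subst pderiv_i_eq[OF D], simp)
  moreover have "Ck k (\<lambda>y. (c * axis j 1 $ i) * flat ?q (c * y $ i + d))" for j
    by (intro Ck_mult Ck_const Suc.IH)
  moreover have "(\<lambda>y. flat p (c * y $ i + d)) differentiable (at y)" for y :: "real^'a"
    using D differentiableI by blast
  moreover from this have "continuous_on UNIV (\<lambda>y::real^'a. flat p (c * y $ i + d))"
    by (intro differentiable_imp_continuous_on) (simp add: differentiable_on_def)
  ultimately show ?case by simp
qed

text \<open>A smooth function that vanishes off the open box and tends to its indicator: the scaling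
  by \<open>n\<close> sharpens the transition at the faces. The affine arguments have the shape
  \<open>c * y $ i + d\<close> of \<open>Ck_flat\<close>.\<close>

definition box_bump :: "real^'n \<Rightarrow> real^'n \<Rightarrow> nat \<Rightarrow> real^'n \<Rightarrow> real" where
  "box_bump a b n y = (\<Prod>i\<in>UNIV. flat 1 (real n * y $ i + - real n * a $ i) * flat 1 (- real n * y $ i + real n * b $ i))"

lemma smooth_box_bump: "smooth (box_bump a b n)"
  unfolding smooth_def box_bump_def[abs_def] by (intro allI Ck_prod Ck_mult Ck_flat)

lemma flat_1_bounds: "0 \<le> flat 1 t" "flat 1 t \<le> 1"
  by (auto simp: flat_def)

lemma box_bump_bounds: "0 \<le> box_bump a b n y" "box_bump a b n y \<le> 1"
  unfolding box_bump_def
  by (auto intro!: prod_nonneg prod_le_1 mult_le_one mult_nonneg_nonneg flat_1_bounds)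

lemma box_bump_eq_0:
  assumes "y \<notin> box a b"
  shows "box_bump a b n y = 0"
proof -
  from assms obtain i where "y $ i \<le> a $ i \<or> b $ i \<le> y $ i"
    by (auto simp: mem_box_cart not_less)
  then have "flat 1 (real n * y $ i + - real n * a $ i) * flat 1 (- real n * y $ i + real n * b $ i) = 0"
    by (auto simp: flat_def zero_less_mult_iff algebra_simps dest: mult_left_mono[of _ _ "real n"])
  then show ?thesis unfolding box_bump_def by (auto intro!: prod_zero)
qed

lemma flat_1_tendsto_1:
  assumes "t > 0"
  shows "(\<lambda>n. flat 1 (real n * t)) \<longlonglongrightarrow> 1"
proof -
  have "(\<lambda>n. exp (- (1 / t * (1 / real n)))) \<longlonglongrightarrow> exp (- (1 / t * 0))"
    by (intro tendsto_intros lim_1_over_n)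
  then have "(\<lambda>n. exp (- (1 / t * (1 / real n)))) \<longlonglongrightarrow> 1" by simp
  then show ?thesis
    by (rule Lim_transform_eventually)
      (use assms in \<open>auto simp: flat_def field_simps intro: eventually_mono[OF eventually_gt_at_top[of 0]]\<close>)
qed

lemma box_bump_tendsto: "(\<lambda>n. box_bump a b n y) \<longlonglongrightarrow> indicator (box a b) y"
proof (cases "y \<in> box a b")
  case True
  have "(\<lambda>n. \<Prod>i\<in>UNIV. flat 1 (real n * (y $ i - a $ i)) * flat 1 (real n * (b $ i - y $ i)))
      \<longlonglongrightarrow> (\<Prod>i\<in>(UNIV::'a set). 1 * 1)"
    using True by (intro tendsto_intros flat_1_tendsto_1) (auto simp: mem_box_cart)
  then show ?thesis using True by (simp add: box_bump_def algebra_simps)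
qed (simp add: box_bump_eq_0)

lemma tsupport_box_bump: "tsupport (box_bump a b n) \<subseteq> cbox a b"
  unfolding tsupport_def
  by (rule closure_minimal) (use box_bump_eq_0[of _ a b n] box_subset_cbox[of a b] in auto)

lemma test_fun_box_bump:
  assumes "cbox a b \<subseteq> S"
  shows "test_fun S (box_bump a b n)"
  unfolding test_fun_def
  using smooth_box_bump tsupport_box_bump assms compact_Int_closed[OF compact_cbox[of a b], of "tsupport (box_bump a b n)"]
  by (metis closed_closure inf.absorb2 subset_trans tsupport_def)

section \<open>Integration by parts for compactly supported functions\<close>

lemma integrable_compact_support:
  fixes f :: "'a::euclidean_space \<Rightarrow> real"
  assumes "continuous_on UNIV f" "compact K" "\<And>y. y \<notin> K \<Longrightarrow> f y = 0"
  shows "integrable lborel f"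
proof -
  have "integrable lborel (\<lambda>x. indicator K x *\<^sub>R f x)"
    using assms by (intro borel_integrable_compact) (auto intro: continuous_on_subset)
  moreover have "(\<lambda>x. indicator K x *\<^sub>R f x) = f" using assms(3) by (auto simp: indicator_def fun_eq_iff)
  ultimately show ?thesis by simp
qed

lemma not_in_tsupport: "y \<notin> tsupport f \<Longrightarrow> f y = 0"
  unfolding tsupport_def using closure_subset[of "{y. f y \<noteq> 0}"] by blast

lemma pderiv_i_not_in_tsupport:
  assumes "y \<notin> tsupport f"
  shows "pderiv_i i f y = 0"
proof -
  have "open (- tsupport f)" by (simp add: tsupport_def open_Compl)
  then have "(f has_derivative (\<lambda>_. 0)) (at y)"
    by (rule has_derivative_transform_within_open[OF has_derivative_const[of 0]])
      (use assms not_in_tsupport[of _ f] in auto)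
  then show ?thesis by (simp add: pderiv_i_eq)
qed

text \<open>The difference quotients have integral zero by translation invariance.\<close>

lemma integral_pderiv_i_eq_0:
  fixes f :: "real^'n \<Rightarrow> real"
  assumes f: "smooth f" and K: "compact (tsupport f)"
  shows "(\<integral>y. pderiv_i i f y \<partial>lborel) = 0"
proof -
  let ?e = "axis i 1 :: real^'n"
  define c where "c = (\<lambda>n. 1 / real (Suc n))"
  define q where "q = (\<lambda>n y. (f (c n *\<^sub>R ?e + y) - f y) / c n)"
  have c: "0 < c n" "c n \<le> 1" for n by (simp_all add: c_def)
  have cont: "continuous_on UNIV f" "continuous_on UNIV (pderiv_i i f)"
    using f smooth_continuous smooth_pderiv_i by blast+
  have fi: "integrable lborel f"
    by (rule integrable_compact_support[OF cont(1) K]) (rule not_in_tsupport)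
  have [measurable]: "f \<in> borel_measurable borel" "pderiv_i i f \<in> borel_measurable borel"
    using cont by (auto intro: borel_measurable_continuous_onI)
  obtain R where R: "\<And>y. y \<in> tsupport f \<Longrightarrow> norm y \<le> R"
    using compact_imp_bounded[OF K] unfolding bounded_iff by blast
  have "bounded (pderiv_i i f ` tsupport f)"
    by (intro compact_imp_bounded compact_continuous_image K continuous_on_subset[OF cont(2)]) simp
  then obtain B where B: "\<And>y. y \<in> tsupport f \<Longrightarrow> \<bar>pderiv_i i f y\<bar> \<le> B"
    unfolding bounded_iff by auto
  \<comment> \<open>Off the support the derivative is 0, so the bound must be nonnegative even when
    the support is empty.\<close>
  define M where "M = max B 0"
  have M: "\<bar>pderiv_i i f y\<bar> \<le> M" for y
    using B[of y] pderiv_i_not_in_tsupport[of y f i] by (cases "y \<in> tsupport f") (auto simp: M_def)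
  have D: "((\<lambda>t. f (t *\<^sub>R ?e + y)) has_real_derivative pderiv_i i f (t *\<^sub>R ?e + y)) (at t)" for t y
  proof -
    have "(f has_derivative frechet_derivative f (at (t *\<^sub>R ?e + y))) (at (t *\<^sub>R ?e + y))"
      using smooth_differentiable[OF f] by (simp add: frechet_derivative_works)
    moreover have "((\<lambda>t. t *\<^sub>R ?e + y) has_derivative (\<lambda>s. s *\<^sub>R ?e)) (at t)"
      by (auto intro!: derivative_eq_intros)
    ultimately have 1: "((\<lambda>t. f (t *\<^sub>R ?e + y)) has_derivative
        (\<lambda>s. frechet_derivative f (at (t *\<^sub>R ?e + y)) (s *\<^sub>R ?e))) (at t)"
      by (rule has_derivative_compose[rotated])
    have "linear (frechet_derivative f (at (t *\<^sub>R ?e + y)))"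
      by (rule linear_frechet_derivative[OF smooth_differentiable[OF f]])
    then have "(\<lambda>s. frechet_derivative f (at (t *\<^sub>R ?e + y)) (s *\<^sub>R ?e)) = (*) (pderiv_i i f (t *\<^sub>R ?e + y))"
      by (simp add: fun_eq_iff linear_scale pderiv_i_def)
    with 1 show ?thesis unfolding has_field_derivative_def by simp
  qed
  have "(\<lambda>n. \<integral>y. q n y \<partial>lborel) \<longlonglongrightarrow> (\<integral>y. pderiv_i i f y \<partial>lborel)"
  proof (rule integral_dominated_convergence)
    \<comment> \<open>Shifts have length at most 1, so every difference quotient vanishes outside
      the ball of radius \<open>R + 1\<close>; inside, the mean value theorem bounds it by
      \<open>M\<close>.\<close>
    show "integrable lborel (\<lambda>y::real^'n. indicator (cball 0 (R + 1)) y *\<^sub>R M)"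
      by (intro borel_integrable_compact) auto
    show "AE y in lborel. (\<lambda>n. q n y) \<longlonglongrightarrow> pderiv_i i f y"
    proof (rule AE_I2)
      fix y
      have "((\<lambda>h. (f (h *\<^sub>R ?e + y) - f y) / h) \<longlongrightarrow> pderiv_i i f y) (at 0)"
        using D[of y 0] by (simp add: DERIV_def)
      moreover have "filterlim c (at 0) sequentially"
        unfolding filterlim_at using c(1) LIMSEQ_Suc[OF lim_1_over_n]
        by (auto simp: c_def less_imp_neq[symmetric])
      ultimately show "(\<lambda>n. q n y) \<longlonglongrightarrow> pderiv_i i f y"
        unfolding q_def by (rule filterlim_compose)
    qed
    show "AE y in lborel. norm (q n y) \<le> indicator (cball 0 (R + 1)) y *\<^sub>R M" for n
    proof (rule AE_I2)
      fix y :: "real^'n"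
      show "norm (q n y) \<le> indicator (cball 0 (R + 1)) y *\<^sub>R M"
      proof (cases "norm y \<le> R + 1")
        case True
        obtain z where "f (c n *\<^sub>R ?e + y) - f (0 *\<^sub>R ?e + y) = (c n - 0) * pderiv_i i f (z *\<^sub>R ?e + y)"
          using MVT2[OF c(1)[of n], of "\<lambda>t. f (t *\<^sub>R ?e + y)" "\<lambda>t. pderiv_i i f (t *\<^sub>R ?e + y)"] D by blast
        then have "q n y = pderiv_i i f (z *\<^sub>R ?e + y)" using c(1)[of n] by (simp add: q_def)
        then show ?thesis using M True by simp
      next
        case False
        have "norm y \<le> norm (c n *\<^sub>R ?e + y) + norm (c n *\<^sub>R ?e)"
          using norm_triangle_ineq4[of "c n *\<^sub>R ?e + y" "c n *\<^sub>R ?e"] by simp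
        then have "R < norm (c n *\<^sub>R ?e + y)" "R < norm y"
          using False c[of n] by (auto simp: norm_axis_1)
        then have "f (c n *\<^sub>R ?e + y) = 0" "f y = 0"
          using R not_in_tsupport by (metis not_less)+
        then show ?thesis using False by (simp add: q_def)
      qed
    qed
  qed (auto simp: q_def)
  moreover have "(\<integral>y. q n y \<partial>lborel) = 0" for n
  proof -
    have "integrable (distr lborel borel ((+) (c n *\<^sub>R ?e))) f"
      and "(\<integral>y. f y \<partial>distr lborel borel ((+) (c n *\<^sub>R ?e))) = (\<integral>y. f y \<partial>lborel)"
      unfolding lborel_distr_plus using fi by auto
    then have "integrable lborel (\<lambda>y. f (c n *\<^sub>R ?e + y))"
      and "(\<integral>y. f (c n *\<^sub>R ?e + y) \<partial>lborel) = (\<integral>y. f y \<partial>lborel)"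
      by (simp_all add: integrable_distr_eq integral_distr)
    then show ?thesis unfolding q_def using fi by simp
  qed
  ultimately show ?thesis by (simp add: LIMSEQ_const_iff)
qed

lemma test_fun_bounded_support:
  assumes "test_fun S \<phi>"
  shows "y \<notin> S \<Longrightarrow> \<phi> y = 0" "y \<notin> S \<Longrightarrow> pderiv_i i \<phi> y = 0"
  using assms not_in_tsupport pderiv_i_not_in_tsupport unfolding test_fun_def by blast+

text \<open>The product of two test functions has compact support, so its derivative integrates to
  zero; the product rule splits that integral into the two sides.\<close>

lemma test_fun_integral_by_parts:
  fixes \<phi> \<psi> :: "real^'n \<Rightarrow> real"
  assumes S: "S \<in> sets lebesgue" and \<phi>: "test_fun S \<phi>" and \<psi>: "test_fun S \<psi>"
  shows "(\<integral>y. \<phi> y * pderiv_i i \<psi> y \<partial>lebesgue_on S) = - (\<integral>y. pderiv_i i \<phi> y * \<psi> y \<partial>lebesgue_on S)"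
proof -
  have s: "smooth \<phi>" "smooth \<psi>" "compact (tsupport \<phi>)" "compact (tsupport \<psi>)"
    using \<phi> \<psi> by (auto simp: test_fun_def)
  have cont: "continuous_on UNIV \<phi>" "continuous_on UNIV \<psi>"
    "continuous_on UNIV (pderiv_i i \<phi>)" "continuous_on UNIV (pderiv_i i \<psi>)"
    using s smooth_continuous smooth_pderiv_i by blast+
  have i1: "integrable lborel (\<lambda>y. \<phi> y * pderiv_i i \<psi> y)"
    by (rule integrable_compact_support[OF _ s(3)])
      (auto intro!: continuous_intros cont simp: not_in_tsupport)
  have i2: "integrable lborel (\<lambda>y. pderiv_i i \<phi> y * \<psi> y)"
    by (rule integrable_compact_support[OF _ s(4)])
      (auto intro!: continuous_intros cont simp: not_in_tsupport)
  have sub: "tsupport (\<lambda>y. \<phi> y * \<psi> y) \<subseteq> tsupport \<phi>"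
    unfolding tsupport_def by (rule closure_mono) auto
  have "compact (tsupport (\<lambda>y. \<phi> y * \<psi> y))"
    using compact_Int_closed[OF s(3), of "tsupport (\<lambda>y. \<phi> y * \<psi> y)"] sub
    by (simp add: tsupport_def[of "\<lambda>y. \<phi> y * \<psi> y"] inf.absorb2)
  then have "(\<integral>y. pderiv_i i (\<lambda>y. \<phi> y * \<psi> y) y \<partial>lborel) = 0"
    by (intro integral_pderiv_i_eq_0 smooth_mult s)
  then have "(\<integral>y. \<phi> y * pderiv_i i \<psi> y \<partial>lborel) = - (\<integral>y. pderiv_i i \<phi> y * \<psi> y \<partial>lborel)"
    using i1 i2 by (simp add: pderiv_i_mult smooth_differentiable s)
  moreover have "(\<integral>y. g y \<partial>lebesgue_on S) = (\<integral>y. g y \<partial>lborel)"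
    if "integrable lborel g" "\<And>y. y \<notin> S \<Longrightarrow> g y = 0" for g :: "real^'n \<Rightarrow> real"
  proof -
    have "(\<lambda>y. indicator S y * g y) = g" using that(2) by (auto simp: indicator_def fun_eq_iff)
    then show ?thesis using that(1) by (simp add: integral_lebesgue_on_eq[OF S] integral_completion)
  qed
  ultimately show ?thesis
    using i1 i2 test_fun_bounded_support[OF \<phi>] test_fun_bounded_support[OF \<psi>] by simp
qed

text \<open>The bumps of the box converge to its indicator, dominated by \<open>norm (g y)\<close>,
  and the faces are null. The conclusion uses the gauge integral, for which the differentiation
  result applied next is stated.\<close>

lemma integral_cbox_eq_0_if_orthogonal_test_fun:
  fixes g :: "real^'n \<Rightarrow> real"
  assumes S: "S \<in> sets lebesgue" and g: "loc_integrable S g"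
    and orth: "\<And>\<phi>. test_fun S \<phi> \<Longrightarrow> (\<integral>y. g y * \<phi> y \<partial>lebesgue_on S) = 0"
    and sub: "cbox a b \<subseteq> S"
  shows "integral (cbox a b) g = 0"
proof -
  let ?K = "cbox a b"
  have K: "?K \<in> sets lebesgue" by simp
  have gK: "integrable (lebesgue_on ?K) g"
    using g sub unfolding loc_integrable_def by auto
  then have gm: "g \<in> borel_measurable (lebesgue_on ?K)" by auto
  have bm: "box_bump a b n \<in> borel_measurable (lebesgue_on ?K)" for n
    by (intro continuous_imp_measurable_on_sets_lebesgue continuous_on_subset[OF smooth_continuous[OF smooth_box_bump]])
      auto
  have "(\<lambda>n. \<integral>y. g y * box_bump a b n y \<partial>lebesgue_on ?K) \<longlonglongrightarrow> (\<integral>y. g y * indicator (box a b) y \<partial>lebesgue_on ?K)"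
  proof (rule integral_dominated_convergence)
    show "integrable (lebesgue_on ?K) (\<lambda>y. norm (g y))" using gK by (rule integrable_norm)
    show "(\<lambda>y. g y * indicator (box a b) y) \<in> borel_measurable (lebesgue_on ?K)"
      by (intro borel_measurable_times gm measurable_restrict_space1 borel_measurable_indicator) simp
    show "(\<lambda>y. g y * box_bump a b n y) \<in> borel_measurable (lebesgue_on ?K)" for n
      by (intro borel_measurable_times gm bm)
    show "AE y in lebesgue_on ?K. (\<lambda>n. g y * box_bump a b n y) \<longlonglongrightarrow> g y * indicator (box a b) y"
      by (intro AE_I2 tendsto_intros box_bump_tendsto)
    show "AE y in lebesgue_on ?K. norm (g y * box_bump a b n y) \<le> norm (g y)" for n
      using box_bump_bounds[of a b n] by (intro AE_I2) (simp add: abs_mult mult_left_le)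
  qed
  moreover have "(\<integral>y. g y * box_bump a b n y \<partial>lebesgue_on ?K) = 0" for n
  proof -
    have "(\<lambda>y. indicator ?K y * (g y * box_bump a b n y)) = (\<lambda>y. indicator S y * (g y * box_bump a b n y))"
      using sub box_bump_eq_0[of _ a b n] box_subset_cbox[of a b] by (fastforce simp: indicator_def)
    then show ?thesis
      using orth[OF test_fun_box_bump[OF sub, of n]]
      by (simp add: integral_lebesgue_on_eq[OF S] integral_lebesgue_on_eq[OF K])
  qed
  ultimately have "(\<integral>y. g y * indicator (box a b) y \<partial>lebesgue_on ?K) = 0"
    by (simp add: LIMSEQ_const_iff)
  moreover have "(\<integral>y. g y * indicator (box a b) y \<partial>lebesgue_on ?K) = (\<integral>y. g y \<partial>lebesgue_on ?K)"
  proof (rule integral_cong_AE)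
    show "(\<lambda>y. g y * indicator (box a b) y) \<in> borel_measurable (lebesgue_on ?K)"
      by (intro borel_measurable_times gm measurable_restrict_space1 borel_measurable_indicator) simp
    have "cbox a b - box a b \<in> null_sets lebesgue"
      using negligible_frontier_interval by (simp add: negligible_iff_null_sets)
    then have "AE y in lebesgue. y \<notin> cbox a b - box a b" by (rule AE_not_in)
    then show "AE y in lebesgue_on ?K. g y * indicator (box a b) y = g y"
      unfolding AE_lebesgue_on_iff[OF K] by eventually_elim auto
  qed (rule gm)
  ultimately show ?thesis using lebesgue_integral_eq_integral[OF gK K] by simp
qed

text \<open>By Lebesgue differentiation.\<close>

lemma AE_box_eq_0_if_integral_cbox_eq_0:
  fixes g :: "'a::euclidean_space \<Rightarrow> real"
  assumes g: "integrable (lebesgue_on (cbox c d)) g"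
    and int0: "\<And>a b. cbox a b \<subseteq> cbox c d \<Longrightarrow> integral (cbox a b) g = 0"
  shows "AE x in lebesgue. x \<in> box c d \<longrightarrow> g x = 0"
proof -
  define f where "f = (\<lambda>x. indicator (cbox c d) x * g x)"
  have "integrable lebesgue f"
    using g integrable_lebesgue_on_iff[of "cbox c d" g] by (simp add: f_def)
  then have "f integrable_on cbox a b" for a b
    by (intro integrable_on_subcbox[of f UNIV] integrable_on_lebesgue) auto
  then obtain T where T: "negligible T" "\<And>x e. x \<notin> T \<Longrightarrow> 0 < e \<Longrightarrow>
      \<exists>r>0. \<forall>h. 0 < h \<and> h < r \<longrightarrow> norm (integral (cbox x (x + h *\<^sub>R One)) f /\<^sub>R h ^ DIM('a) - f x) < e"
    using integrable_ccontinuous_explicit[of f] by blast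
  have "g x = 0" if x: "x \<in> box c d" "x \<notin> T" for x
  proof (rule ccontr)
    assume "g x \<noteq> 0"
    then obtain r where r: "r > 0" "\<And>h. 0 < h \<Longrightarrow> h < r \<Longrightarrow>
        norm (integral (cbox x (x + h *\<^sub>R One)) f /\<^sub>R h ^ DIM('a) - f x) < \<bar>g x\<bar>"
      using T(2)[OF x(2), of "\<bar>g x\<bar>"] by auto
    obtain s where s: "s > 0" "ball x s \<subseteq> box c d"
      using x(1) open_box open_contains_ball by blast
    \<comment> \<open>Small enough for the differentiation estimate and for the cube from
      \<open>x\<close> to \<open>x + h *\<^sub>R One\<close> to stay in the box; the added 1 makes
      the containment in the open ball strict.\<close>
    define h where "h = min (r / 2) (s / (norm (One::'a) + 1))"
    have n1: "norm (One::'a) + 1 > 0" by (simp add: add_nonneg_pos)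
    have h: "0 < h" "h < r" using r(1) s(1) n1 by (auto simp: h_def)
    have "h * norm (One::'a) < h * (norm (One::'a) + 1)" using h by simp
    also have "\<dots> \<le> s / (norm (One::'a) + 1) * (norm (One::'a) + 1)"
      using n1 by (intro mult_right_mono) (auto simp: h_def)
    also have "\<dots> = s" using n1 by simp
    finally have "x + h *\<^sub>R One \<in> ball x s" using h by (simp add: dist_norm)
    then have xh: "x + h *\<^sub>R One \<in> box c d" using s(2) by blast
    have sub: "cbox x (x + h *\<^sub>R One) \<subseteq> cbox c d"
      using x(1) xh by (fastforce simp: mem_box intro: less_imp_le order_trans)
    have "integral (cbox x (x + h *\<^sub>R One)) f = integral (cbox x (x + h *\<^sub>R One)) g"
      using sub by (intro integral_cong) (auto simp: f_def)
    also have "\<dots> = 0" by (rule int0[OF sub])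
    finally have "\<bar>f x\<bar> < \<bar>g x\<bar>" using r(2)[OF h] by simp
    then show False using x(1) box_subset_cbox[of c d] by (auto simp: f_def)
  qed
  moreover have "AE x in lebesgue. x \<notin> T"
    using T(1) by (intro AE_not_in) (simp add: negligible_iff_null_sets)
  ultimately show ?thesis by (auto elim!: eventually_mono)
qed

text \<open>Fundamental lemma of the calculus of variations. An open set is a countable union of
  closed boxes; on each of them the function vanishes off the faces, which are null.\<close>

theorem AE_eq_0_if_orthogonal_test_fun:
  fixes g :: "real^'n \<Rightarrow> real"
  assumes S: "open S" and g: "loc_integrable S g"
    and orth: "\<And>\<phi>. test_fun S \<phi> \<Longrightarrow> (\<integral>y. g y * \<phi> y \<partial>lebesgue_on S) = 0"
  shows "AE y in lebesgue_on S. g y = 0"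
proof -
  have SL: "S \<in> sets lebesgue" using S by simp
  obtain D where D: "countable D" "D \<subseteq> Pow S" "\<And>X. X \<in> D \<Longrightarrow> \<exists>a b. X = cbox a b" "\<Union>D = S"
    using open_countable_Union_open_cbox[OF S] by metis
  have "AE y in lebesgue. y \<in> X \<longrightarrow> g y = 0" if X: "X \<in> D" for X
  proof -
    obtain a b where ab: "X = cbox a b" using D(3)[OF X] by blast
    have sub: "cbox a b \<subseteq> S" using D(2) X ab by blast
    have "AE y in lebesgue. y \<in> box a b \<longrightarrow> g y = 0"
    proof (rule AE_box_eq_0_if_integral_cbox_eq_0)
      show "integrable (lebesgue_on (cbox a b)) g" using g sub unfolding loc_integrable_def by auto
      show "integral (cbox c d) g = 0" if "cbox c d \<subseteq> cbox a b" for c d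
        by (rule integral_cbox_eq_0_if_orthogonal_test_fun[OF SL g orth]) (use that sub in auto)
    qed
    moreover have "AE y in lebesgue. y \<notin> cbox a b - box a b"
      using negligible_frontier_interval[of a b] by (intro AE_not_in) (simp add: negligible_iff_null_sets)
    ultimately show ?thesis unfolding ab by eventually_elim auto
  qed
  then have "AE y in lebesgue. \<forall>X\<in>D. y \<in> X \<longrightarrow> g y = 0"
    using D(1) by (subst AE_ball_countable) auto
  then show ?thesis unfolding AE_lebesgue_on_iff[OF SL]
    using D(4) by (auto elim!: eventually_mono)
qed

section \<open>Local integrability and uniqueness of weak gradients\<close>

lemma square_integrable_indicator_continuous:
  fixes h :: "'a::euclidean_space \<Rightarrow> real"
  assumes "compact K" "continuous_on K h"
  shows "square_integrable lebesgue (\<lambda>y. indicator K y * h y)"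
proof -
  have i: "integrable lborel (\<lambda>y. indicator K y * f y)" if "continuous_on K f" for f :: "'a \<Rightarrow> real"
    using borel_integrable_compact[OF assms(1) that] by simp
  have m: "(\<lambda>y. indicator K y * f y) \<in> borel_measurable lborel" if "continuous_on K f" for f :: "'a \<Rightarrow> real"
    using i[OF that] by (rule borel_measurable_integrable)
  have c2: "continuous_on K (\<lambda>y. (h y)\<^sup>2)" by (intro continuous_intros assms)
  have "integrable lebesgue (\<lambda>y. indicator K y * (h y)\<^sup>2)"
    using integrable_completion[OF m[OF c2]] i[OF c2] by simp
  moreover have "(\<lambda>y. indicator K y * h y) \<in> borel_measurable lebesgue"
    using measurable_completion[OF m[OF assms(2)]] by simp
  ultimately show ?thesis by (simp add: square_integrable_def indicator_power2)
qed

text \<open>On a compact subset the continuous factor is square integrable. With \<open>h\<close>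
  equal to \<open>\<rho>\<close> or \<open>1 / \<rho>\<close> this allows weighting and unweighting,
  whatever \<open>\<rho>\<close> does at the boundary.\<close>

lemma loc_integrable_L2_mult_continuous:
  assumes S: "S \<in> sets lebesgue" and z: "z \<in> L2 S" and h: "continuous_on S h"
  shows "loc_integrable S (\<lambda>y. z y * h y)"
  unfolding loc_integrable_def
proof (intro allI impI, elim conjE)
  fix K assume K: "compact K" "K \<subseteq> S"
  have "integrable lebesgue (\<lambda>y. (indicator S y * z y) * (indicator K y * h y))"
    using z unfolding L2_iff_square_integrable[OF S]
    by (rule square_integrable_mult[OF _ square_integrable_indicator_continuous[OF K(1) continuous_on_subset[OF h K(2)]]])
  moreover have "(\<lambda>y. (indicator S y * z y) * (indicator K y * h y)) = (\<lambda>y. indicator K y * (z y * h y))"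
    using K(2) by (auto simp: indicator_def fun_eq_iff)
  ultimately show "integrable (lebesgue_on K) (\<lambda>y. z y * h y)"
    using integrable_lebesgue_on_iff[of K] K(1) by (simp add: lmeasurable_compact fmeasurableD)
qed

lemma loc_integrable_diff:
  "loc_integrable S f \<Longrightarrow> loc_integrable S g \<Longrightarrow> loc_integrable S (\<lambda>y. f y - g y)"
  unfolding loc_integrable_def by (auto intro: Bochner_Integration.integrable_diff)

text \<open>A weak gradient is only assumed locally integrable; its measurability on all of
  \<open>S\<close> is glued from countably many closed boxes.\<close>

lemma loc_integrable_measurable:
  assumes S: "open S" and g: "loc_integrable S g"
  shows "g \<in> borel_measurable (lebesgue_on S)"
proof -
  obtain D where D: "countable D" "D \<subseteq> Pow S" "\<And>X. X \<in> D \<Longrightarrow> \<exists>a b. X = cbox a b" "\<Union>D = S"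
    using open_countable_Union_open_cbox[OF S] by metis
  show ?thesis
  proof (rule measurable_piecewise_restrict[OF D(1)])
    fix X assume X: "X \<in> D"
    obtain a b where ab: "X = cbox a b" using D(3)[OF X] by blast
    have sub: "X \<subseteq> S" using D(2) X by blast
    show "X \<inter> space (lebesgue_on S) \<in> sets (lebesgue_on S)"
      using S sub by (auto simp: sets_restrict_space ab image_iff intro!: exI[of _ "cbox a b"])
    have "restrict_space (lebesgue_on S) X = lebesgue_on X"
      using restrict_restrict_space[of S lebesgue X] S sub by (simp add: ab inf.absorb2)
    moreover have "integrable (lebesgue_on X) g"
      using g sub unfolding loc_integrable_def by (simp add: ab)
    ultimately show "g \<in> borel_measurable (restrict_space (lebesgue_on S) X)"
      by (simp add: borel_measurable_integrable)
  qed (use D(4) in auto)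
qed

lemma integrable_loc_integrable_mult_test_fun:
  assumes S: "S \<in> sets lebesgue" and g: "loc_integrable S g" and \<phi>: "test_fun S \<phi>"
  shows "integrable (lebesgue_on S) (\<lambda>y. g y * \<phi> y)"
proof -
  let ?K = "tsupport \<phi>"
  have K: "compact ?K" "?K \<subseteq> S" "smooth \<phi>" using \<phi> by (auto simp: test_fun_def)
  have KL: "?K \<in> sets lebesgue" using K(1) by (simp add: lmeasurable_compact fmeasurableD)
  have gK: "integrable lebesgue (\<lambda>y. indicator ?K y * g y)"
    using g K integrable_lebesgue_on_iff[OF KL] unfolding loc_integrable_def by blast
  have [measurable]: "(\<lambda>y. indicator ?K y * g y) \<in> borel_measurable lebesgue"
    using gK by (rule borel_measurable_integrable)
  have [measurable]: "\<phi> \<in> borel_measurable lebesgue"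
    using smooth_continuous[OF K(3)] by (intro measurable_completion) (simp add: borel_measurable_continuous_onI)
  have "bounded (\<phi> ` ?K)"
    by (intro compact_imp_bounded compact_continuous_image K continuous_on_subset[OF smooth_continuous[OF K(3)]]) simp
  then obtain B where B: "\<And>y. y \<in> ?K \<Longrightarrow> \<bar>\<phi> y\<bar> \<le> B" unfolding bounded_iff by auto
  have "integrable lebesgue (\<lambda>y. (indicator ?K y * g y) * \<phi> y)"
  proof (rule Bochner_Integration.integrable_bound)
    show "integrable lebesgue (\<lambda>y. (indicator ?K y * g y) * B)" using gK by simp
    show "(\<lambda>y. (indicator ?K y * g y) * \<phi> y) \<in> borel_measurable lebesgue" by measurable
    show "AE y in lebesgue. norm (indicator ?K y * g y * \<phi> y) \<le> norm (indicator ?K y * g y * B)"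
      using B by (intro AE_I2) (fastforce simp: indicator_def abs_mult intro!: mult_left_mono)
  qed
  moreover have "(\<lambda>y. (indicator ?K y * g y) * \<phi> y) = (\<lambda>y. indicator S y * (g y * \<phi> y))"
    using K(2) not_in_tsupport[of _ \<phi>] by (fastforce simp: indicator_def)
  ultimately show ?thesis by (simp add: integrable_lebesgue_on_iff[OF S])
qed

text \<open>The fundamental lemma, applied to each component of the difference. It lets one gradient
  stand for all in \<open>Lop\<close>, which quantifies over every weak gradient.\<close>

lemma weak_grad_unique:
  assumes S: "open S" and G: "weak_grad S f G" and G': "weak_grad S f G'"
  shows "AE y in lebesgue_on S. G y = G' y"
proof -
  have SL: "S \<in> sets lebesgue" using S by simp
  have loc: "loc_integrable S (\<lambda>y. G y $ i)" "loc_integrable S (\<lambda>y. G' y $ i)" for i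
    using G G' by (auto simp: weak_grad_def)
  have "AE y in lebesgue_on S. G y $ i - G' y $ i = 0" for i
  proof (rule AE_eq_0_if_orthogonal_test_fun[OF S loc_integrable_diff[OF loc]])
    fix \<phi> assume \<phi>: "test_fun S \<phi>"
    have "(\<integral>y. (G y $ i - G' y $ i) * \<phi> y \<partial>lebesgue_on S)
        = (\<integral>y. G y $ i * \<phi> y \<partial>lebesgue_on S) - (\<integral>y. G' y $ i * \<phi> y \<partial>lebesgue_on S)"
      unfolding left_diff_distrib
      by (intro Bochner_Integration.integral_diff integrable_loc_integrable_mult_test_fun[OF SL _ \<phi>] loc)
    also have "\<dots> = 0"
    proof -
      have "(\<integral>y. f y * pderiv_i i \<phi> y \<partial>lebesgue_on S) = - (\<integral>y. G y $ i * \<phi> y \<partial>lebesgue_on S)"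
        using G \<phi> unfolding weak_grad_def by blast
      moreover have "(\<integral>y. f y * pderiv_i i \<phi> y \<partial>lebesgue_on S) = - (\<integral>y. G' y $ i * \<phi> y \<partial>lebesgue_on S)"
        using G' \<phi> unfolding weak_grad_def by blast
      ultimately show ?thesis by linarith
    qed
    finally show "(\<integral>y. (G y $ i - G' y $ i) * \<phi> y \<partial>lebesgue_on S) = 0" .
  qed
  then have "AE y in lebesgue_on S. \<forall>i\<in>UNIV. G y $ i - G' y $ i = 0"
    by (subst AE_ball_countable) auto
  then show ?thesis by eventually_elim (simp add: vec_eq_iff)
qed

section \<open>The weighted Dirichlet form\<close>

text \<open>Keeps from \<open>sqrt (ubar ...)\<close> what bounds it from both sides on compact
  subsets; its behaviour at the boundary of \<open>S\<close> stays free.\<close>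

locale weighted_domain =
  fixes S :: "(real^'n) set" and \<rho> :: "real^'n \<Rightarrow> real"
  assumes open_S: "open S" and cont: "continuous_on S \<rho>" and pos: "y \<in> S \<Longrightarrow> \<rho> y > 0"
begin

lemma SL: "S \<in> sets lebesgue"
  using open_S by simp

text \<open>The first component is not required to vanish outside \<open>S\<close>; there the operator \<open>op_l2\<close> is zero.\<close>

definition grad_graph :: "((real^'n) l2 \<times> (((real^'n) l2)^'n)) set" where
  "grad_graph = {x. (\<forall>i. proj_l2 S (snd x $ i) = snd x $ i) \<and>
    (\<forall>\<phi> i. test_fun S \<phi> \<longrightarrow>
      fst x \<bullet> ext_l2 S (\<lambda>y. pderiv_i i \<phi> y / \<rho> y) = - (snd x $ i \<bullet> ext_l2 S (\<lambda>y. \<phi> y / \<rho> y)))}"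

lemma continuous_compact_support_L2:
  assumes f: "continuous_on S f" and K: "compact K" "K \<subseteq> S" "\<And>y. y \<in> S \<Longrightarrow> y \<notin> K \<Longrightarrow> f y = 0"
  shows "f \<in> L2 S"
proof -
  have "square_integrable lebesgue (\<lambda>y. indicator K y * f y)"
    by (intro square_integrable_indicator_continuous K continuous_on_subset[OF f])
  moreover have "(\<lambda>y. indicator K y * f y) = (\<lambda>y. indicator S y * f y)"
    using K by (auto simp: indicator_def fun_eq_iff)
  ultimately show ?thesis by (simp add: L2_iff_square_integrable[OF SL])
qed

lemma test_fun_L2:
  assumes \<phi>: "test_fun S \<phi>" and h: "continuous_on S h"
  shows "(\<lambda>y. \<phi> y * h y) \<in> L2 S" "(\<lambda>y. pderiv_i i \<phi> y * h y) \<in> L2 S"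
proof -
  have K: "compact (tsupport \<phi>)" "tsupport \<phi> \<subseteq> S" "smooth \<phi>" using \<phi> by (auto simp: test_fun_def)
  have c: "continuous_on S \<phi>" "continuous_on S (pderiv_i i \<phi>)"
    using smooth_continuous[OF K(3)] smooth_continuous[OF smooth_pderiv_i[OF K(3)]]
    by (auto intro: continuous_on_subset)
  show "(\<lambda>y. \<phi> y * h y) \<in> L2 S"
    by (rule continuous_compact_support_L2[OF _ K(1,2)])
      (auto intro!: continuous_intros c h simp: not_in_tsupport)
  show "(\<lambda>y. pderiv_i i \<phi> y * h y) \<in> L2 S"
    by (rule continuous_compact_support_L2[OF _ K(1,2)])
      (auto intro!: continuous_intros c h simp: pderiv_i_not_in_tsupport)
qed

lemma cont_inverse: "continuous_on S (\<lambda>y. inverse (\<rho> y))"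
  using pos by (intro continuous_intros cont) (metis less_irrefl)

lemma test_fun_div_L2:
  assumes "test_fun S \<phi>"
  shows "(\<lambda>y. \<phi> y / \<rho> y) \<in> L2 S" "(\<lambda>y. pderiv_i i \<phi> y / \<rho> y) \<in> L2 S"
  using test_fun_L2[OF assms cont_inverse] by (simp_all add: divide_inverse)

lemma integral_cong_S:
  "(\<And>y. y \<in> S \<Longrightarrow> f y = g y) \<Longrightarrow> integral\<^sup>L (lebesgue_on S) f = integral\<^sup>L (lebesgue_on S) g"
  for f g :: "real^'n \<Rightarrow> real"
  by (rule Bochner_Integration.integral_cong) (auto simp: space_restrict_space)

lemma loc_integrable_cong_S:
  assumes "\<And>y. y \<in> S \<Longrightarrow> f y = g y"
  shows "loc_integrable S f \<longleftrightarrow> loc_integrable S g"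
  unfolding loc_integrable_def
  by (intro all_cong imp_cong refl Bochner_Integration.integrable_cong)
    (use assms in \<open>auto simp: space_restrict_space\<close>)

text \<open>The second component stores \<open>\<rho>\<close> times the weak gradient and the test
  functions are divided by \<open>\<rho>\<close>, so the weights cancel and the weak gradient
  identity remains.\<close>

lemma weak_grad_iff_grad_graph:
  assumes z: "z \<in> L2 S" and F: "\<And>i. F i \<in> L2 S"
    and G: "\<And>y i. y \<in> S \<Longrightarrow> F i y = G y $ i * \<rho> y"
  shows "weak_grad S (\<lambda>y. z y / \<rho> y) G \<longleftrightarrow> (ext_l2 S z, \<chi> i. ext_l2 S (F i)) \<in> grad_graph"
proof -
  have l1: "loc_integrable S (\<lambda>y. z y / \<rho> y)"
    using loc_integrable_L2_mult_continuous[OF SL z cont_inverse] by (simp add: divide_inverse)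
  have FG: "loc_integrable S (\<lambda>y. F i y * inverse (\<rho> y))" for i
    by (rule loc_integrable_L2_mult_continuous[OF SL F cont_inverse])
  have "F i y * inverse (\<rho> y) = G y $ i" if "y \<in> S" for y i
    using G[OF that] pos[OF that] by (simp add: field_simps)
  then have l2: "loc_integrable S (\<lambda>y. G y $ i)" for i
    using loc_integrable_cong_S[of "\<lambda>y. F i y * inverse (\<rho> y)" "\<lambda>y. G y $ i"] FG by simp
  have "ext_l2 S z \<bullet> ext_l2 S (\<lambda>y. pderiv_i i \<phi> y / \<rho> y) = (\<integral>y. z y / \<rho> y * pderiv_i i \<phi> y \<partial>lebesgue_on S)"
    if "test_fun S \<phi>" for \<phi> i
    by (simp add: inner_ext_l2[OF SL z test_fun_div_L2(2)[OF that]])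
  moreover have "ext_l2 S (F i) \<bullet> ext_l2 S (\<lambda>y. \<phi> y / \<rho> y) = (\<integral>y. G y $ i * \<phi> y \<partial>lebesgue_on S)"
    if "test_fun S \<phi>" for \<phi> i
    unfolding inner_ext_l2[OF SL F test_fun_div_L2(1)[OF that]]
    by (rule integral_cong_S) (use G pos in \<open>force simp: field_simps\<close>)
  ultimately show ?thesis
    using l1 l2 by (auto simp: weak_grad_def grad_graph_def proj_l2_ext_l2[OF SL F])
qed

lemma subspace_grad_graph: "subspace grad_graph"
proof (rule subspaceI)
  show "0 \<in> grad_graph" by (simp add: grad_graph_def linear_0[OF linear_proj_l2[OF SL]])
qed (auto simp: grad_graph_def linear_add[OF linear_proj_l2[OF SL]] linear_scale[OF linear_proj_l2[OF SL]]
      inner_add_left)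

text \<open>The test vectors are fixed elements of the Hilbert space, so every condition is an
  equation between continuous functions of the pair.\<close>

lemma closed_grad_graph: "closed grad_graph"
  unfolding grad_graph_def
  by (intro closed_Collect_conj closed_Collect_all closed_Collect_imp open_Collect_const closed_Collect_eq
      continuous_on_compose2[OF continuous_on_proj_l2[OF SL]] continuous_intros)
    auto

lemma grad_graph_proj:
  assumes "(p, P) \<in> grad_graph"
  shows "(proj_l2 S p, P) \<in> grad_graph"
  using assms by (auto simp: grad_graph_def inner_commute[of "proj_l2 S p"] inner_commute[of p]
      inner_ext_l2_proj_l2[OF SL] test_fun_div_L2)

text \<open>Every \<open>\<phi> * \<rho>\<close> lies in the domain, with \<open>\<rho>\<close>
  times the gradient of \<open>\<phi>\<close> as second component. So \<open>w * \<rho>\<close> is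
  orthogonal to all test functions and \<open>w\<close> vanishes on \<open>S\<close>.\<close>

lemma grad_graph_orthogonal_trivial:
  assumes w: "\<And>p P. (p, P) \<in> grad_graph \<Longrightarrow> w \<bullet> p = 0"
  shows "w = 0"
proof -
  have "AE y in lebesgue_on S. rep_l2 w y * \<rho> y = 0"
  proof (rule AE_eq_0_if_orthogonal_test_fun[OF open_S])
    show "loc_integrable S (\<lambda>y. rep_l2 w y * \<rho> y)"
      by (rule loc_integrable_L2_mult_continuous[OF SL rep_l2_in_L2[OF SL] cont])
    fix \<phi> assume \<phi>: "test_fun S \<phi>"
    define p where "p = (\<lambda>y. \<phi> y * \<rho> y)"
    have p: "p \<in> L2 S" unfolding p_def by (rule test_fun_L2[OF \<phi> cont])
    have dp: "(\<lambda>y. pderiv_i i \<phi> y * \<rho> y) \<in> L2 S" for i by (rule test_fun_L2[OF \<phi> cont])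
    have "ext_l2 S p \<bullet> ext_l2 S (\<lambda>y. pderiv_i i \<psi> y / \<rho> y)
        = - (ext_l2 S (\<lambda>y. pderiv_i i \<phi> y * \<rho> y) \<bullet> ext_l2 S (\<lambda>y. \<psi> y / \<rho> y))"
      if \<psi>: "test_fun S \<psi>" for \<psi> i
    proof -
      have "ext_l2 S p \<bullet> ext_l2 S (\<lambda>y. pderiv_i i \<psi> y / \<rho> y) = (\<integral>y. \<phi> y * pderiv_i i \<psi> y \<partial>lebesgue_on S)"
        unfolding inner_ext_l2[OF SL p test_fun_div_L2(2)[OF \<psi>]]
        by (rule integral_cong_S) (use pos in \<open>force simp: p_def field_simps\<close>)
      moreover have "ext_l2 S (\<lambda>y. pderiv_i i \<phi> y * \<rho> y) \<bullet> ext_l2 S (\<lambda>y. \<psi> y / \<rho> y)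
          = (\<integral>y. pderiv_i i \<phi> y * \<psi> y \<partial>lebesgue_on S)"
        unfolding inner_ext_l2[OF SL dp test_fun_div_L2(1)[OF \<psi>]]
        by (rule integral_cong_S) (use pos in \<open>force simp: field_simps\<close>)
      ultimately show ?thesis using test_fun_integral_by_parts[OF SL \<phi> \<psi>, of i] by simp
    qed
    then have "(ext_l2 S p, \<chi> i. ext_l2 S (\<lambda>y. pderiv_i i \<phi> y * \<rho> y)) \<in> grad_graph"
      by (simp add: grad_graph_def proj_l2_ext_l2[OF SL dp])
    then have "w \<bullet> ext_l2 S p = 0" by (rule w)
    then show "(\<integral>y. rep_l2 w y * \<rho> y * \<phi> y \<partial>lebesgue_on S) = 0"
      unfolding inner_ext_l2_rep_l2[OF SL p] by (simp add: p_def mult_ac)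
  qed
  then have "ae_eq S (rep_l2 w) (\<lambda>_. 0)"
    unfolding ae_eq_def AE_lebesgue_on_iff[OF SL] by eventually_elim (use pos in force)
  then have "proj_l2 S w = ext_l2 S (\<lambda>_. 0)"
    using ext_l2_eq_iff[OF SL rep_l2_in_L2[OF SL] square_integrable_imp_L2[OF SL square_integrable_zero]]
    by (simp add: proj_l2_def)
  then have pw: "proj_l2 S w = 0" by (simp add: ext_l2_def zero_eq_class_l2)
  \<comment> \<open>The part of \<open>w\<close> outside \<open>S\<close> remains. All pairings of
    \<open>w\<close> with test vectors are 0, so \<open>w\<close> itself is in the domain with
    gradient 0 and can be tested against itself.\<close>
  have "w \<bullet> ext_l2 S f = 0" if "f \<in> L2 S" for f
    using inner_ext_l2_proj_l2[OF SL that, of w] pw by (simp add: inner_commute)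
  then have "(w, 0) \<in> grad_graph"
    by (auto simp: grad_graph_def linear_0[OF linear_proj_l2[OF SL]] test_fun_div_L2)
  then have "w \<bullet> w = 0" by (rule w)
  then show ?thesis by simp
qed

definition op_l2 :: "((real^'n) l2 \<times> (real^'n) l2) set" where
  "op_l2 = minus_adjoint_square grad_graph"

sublocale op: m_dissipative op_l2
  unfolding op_l2_def
  by (intro m_dissipative_minus_adjoint_square subspace_grad_graph closed_grad_graph)
    (rule grad_graph_orthogonal_trivial)

text \<open>Graph pairs may be projected in the first component, so the same \<open>F\<close> serves
  the projected pair. This is why the semigroup preserves functions supported in
  \<open>S\<close>.\<close>

lemma op_l2_proj:
  assumes "(x, y) \<in> op_l2"
  shows "(proj_l2 S x, proj_l2 S y) \<in> op_l2"
proof -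
  obtain F where F: "(x, F) \<in> grad_graph" "\<And>p P. (p, P) \<in> grad_graph \<Longrightarrow> - (F \<bullet> P) = y \<bullet> p"
    using assms unfolding op_l2_def minus_adjoint_square_def by blast
  have "- (F \<bullet> P) = proj_l2 S y \<bullet> p" if "(p, P) \<in> grad_graph" for p P
    unfolding inner_proj_l2[OF SL] by (rule F(2)[OF grad_graph_proj[OF that]])
  then show ?thesis using grad_graph_proj[OF F(1)] unfolding op_l2_def minus_adjoint_square_def by blast
qed

end

section \<open>The weak form operator on functions and on classes\<close>

context weighted_domain
begin

text \<open>\<open>Hy\<close> with \<open>sqrt (ubar ...)\<close> abstracted to
  \<open>\<rho>\<close>; \<open>form_op\<close> abstracts \<open>Lop\<close> in the same
  way.\<close>

definition form_domain :: "(real^'n \<Rightarrow> real) set" where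
  "form_domain = {z. z \<in> L2 S \<and> (\<exists>G. weak_grad S (\<lambda>y. z y / \<rho> y) G \<and>
      integrable (lebesgue_on S) (\<lambda>y. (norm (G y))\<^sup>2 * (\<rho> y)\<^sup>2))}"

definition form_op :: "(real^'n \<Rightarrow> real) \<Rightarrow> (real^'n \<Rightarrow> real) \<Rightarrow> bool" where
  "form_op z g \<longleftrightarrow> z \<in> form_domain \<and> g \<in> L2 S \<and>
     (\<forall>\<psi> Gz G\<psi>. \<psi> \<in> form_domain
        \<and> weak_grad S (\<lambda>y. z y / \<rho> y) Gz \<and> weak_grad S (\<lambda>y. \<psi> y / \<rho> y) G\<psi> \<longrightarrow>
        - (\<integral>y. (Gz y \<bullet> G\<psi> y) * (\<rho> y)\<^sup>2 \<partial>lebesgue_on S) = (\<integral>y. g y * \<psi> y \<partial>lebesgue_on S))"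

definition grad_l2 :: "(real^'n \<Rightarrow> real^'n) \<Rightarrow> ((real^'n) l2)^'n" where
  "grad_l2 G = (\<chi> i. ext_l2 S (\<lambda>y. G y $ i * \<rho> y))"

lemma rho_measurable: "\<rho> \<in> borel_measurable (lebesgue_on S)"
  by (rule continuous_imp_measurable_on_sets_lebesgue[OF cont SL])

lemma weak_grad_measurable:
  assumes "weak_grad S f G"
  shows "(\<lambda>y. G y $ i) \<in> borel_measurable (lebesgue_on S)"
  by (rule loc_integrable_measurable[OF open_S]) (use assms in \<open>simp add: weak_grad_def\<close>)

lemma norm_power2_vec: "(norm (x::real^'n))\<^sup>2 = (\<Sum>i\<in>UNIV. (x $ i)\<^sup>2)"
  unfolding power2_norm_eq_inner by (simp add: inner_vec_def power2_eq_square)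

lemma energy_iff_L2:
  fixes G :: "real^'n \<Rightarrow> real^'n"
  assumes G: "\<And>i. (\<lambda>y. G y $ i) \<in> borel_measurable (lebesgue_on S)"
  shows "integrable (lebesgue_on S) (\<lambda>y. (norm (G y))\<^sup>2 * (\<rho> y)\<^sup>2) \<longleftrightarrow> (\<forall>i. (\<lambda>y. G y $ i * \<rho> y) \<in> L2 S)"
proof -
  have eq: "(norm (G y))\<^sup>2 * (\<rho> y)\<^sup>2 = (\<Sum>i\<in>UNIV. (G y $ i * \<rho> y)\<^sup>2)" for y
    by (simp add: norm_power2_vec sum_distrib_right power_mult_distrib)
  have m: "(\<lambda>y. G y $ i * \<rho> y) \<in> borel_measurable (lebesgue_on S)" for i
    by (intro borel_measurable_times G rho_measurable)
  show ?thesis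
  proof
    assume int: "integrable (lebesgue_on S) (\<lambda>y. (norm (G y))\<^sup>2 * (\<rho> y)\<^sup>2)"
    show "\<forall>i. (\<lambda>y. G y $ i * \<rho> y) \<in> L2 S"
    proof
      fix i
      have "integrable (lebesgue_on S) (\<lambda>y. (G y $ i * \<rho> y)\<^sup>2)"
      proof (rule Bochner_Integration.integrable_bound[OF int])
        show "(\<lambda>y. (G y $ i * \<rho> y)\<^sup>2) \<in> borel_measurable (lebesgue_on S)"
          by (intro borel_measurable_power m)
        have "(G y $ i * \<rho> y)\<^sup>2 \<le> (norm (G y))\<^sup>2 * (\<rho> y)\<^sup>2" for y
          unfolding eq by (rule member_le_sum) auto
        then show "AE y in lebesgue_on S. norm ((G y $ i * \<rho> y)\<^sup>2) \<le> norm ((norm (G y))\<^sup>2 * (\<rho> y)\<^sup>2)"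
          by (intro AE_I2) simp
      qed
      then show "(\<lambda>y. G y $ i * \<rho> y) \<in> L2 S" using m by (simp add: L2_def)
    qed
  next
    assume "\<forall>i. (\<lambda>y. G y $ i * \<rho> y) \<in> L2 S"
    then show "integrable (lebesgue_on S) (\<lambda>y. (norm (G y))\<^sup>2 * (\<rho> y)\<^sup>2)"
      unfolding eq by (intro Bochner_Integration.integrable_sum) (simp add: L2_def)
  qed
qed

lemma inner_grad_l2:
  assumes G: "\<And>i. (\<lambda>y. G y $ i * \<rho> y) \<in> L2 S" and G': "\<And>i. (\<lambda>y. G' y $ i * \<rho> y) \<in> L2 S"
  shows "grad_l2 G \<bullet> grad_l2 G' = (\<integral>y. (G y \<bullet> G' y) * (\<rho> y)\<^sup>2 \<partial>lebesgue_on S)"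
proof -
  have "grad_l2 G \<bullet> grad_l2 G' = (\<Sum>i\<in>UNIV. \<integral>y. (G y $ i * \<rho> y) * (G' y $ i * \<rho> y) \<partial>lebesgue_on S)"
    by (simp add: grad_l2_def inner_vec_def inner_ext_l2[OF SL G G'])
  also have "\<dots> = (\<integral>y. (\<Sum>i\<in>UNIV. (G y $ i * \<rho> y) * (G' y $ i * \<rho> y)) \<partial>lebesgue_on S)"
    using G G' unfolding L2_iff_square_integrable_on[OF SL]
    by (intro Bochner_Integration.integral_sum[symmetric] square_integrable_mult)
  also have "\<dots> = (\<integral>y. (G y \<bullet> G' y) * (\<rho> y)\<^sup>2 \<partial>lebesgue_on S)"
    by (intro integral_cong_S) (simp add: inner_vec_def sum_distrib_left sum_distrib_right power2_eq_square mult_ac)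
  finally show ?thesis .
qed

lemma weak_grad_imp_grad_graph:
  assumes z: "z \<in> L2 S" and G: "weak_grad S (\<lambda>y. z y / \<rho> y) G"
    and E: "integrable (lebesgue_on S) (\<lambda>y. (norm (G y))\<^sup>2 * (\<rho> y)\<^sup>2)"
  shows "\<And>i. (\<lambda>y. G y $ i * \<rho> y) \<in> L2 S" "(ext_l2 S z, grad_l2 G) \<in> grad_graph"
proof -
  show *: "(\<lambda>y. G y $ i * \<rho> y) \<in> L2 S" for i
    using energy_iff_L2[of G] weak_grad_measurable[OF G] E by blast
  show "(ext_l2 S z, grad_l2 G) \<in> grad_graph"
    unfolding grad_l2_def
    by (rule weak_grad_iff_grad_graph[THEN iffD1, OF z _ _ G]) (simp_all add: *)
qed

lemma grad_graph_imp_weak_grad: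
  assumes z: "z \<in> L2 S" and F: "(ext_l2 S z, F) \<in> grad_graph"
  obtains G where "weak_grad S (\<lambda>y. z y / \<rho> y) G"
    "integrable (lebesgue_on S) (\<lambda>y. (norm (G y))\<^sup>2 * (\<rho> y)\<^sup>2)" "F = grad_l2 G"
proof -
  \<comment> \<open>Dividing representatives by \<open>\<rho>\<close> undoes the weighting on
    \<open>S\<close>, where \<open>\<rho>\<close> is positive; integrals over \<open>S\<close> do
    not see other values.\<close>
  define G :: "real^'n \<Rightarrow> real^'n" where "G = (\<lambda>y. \<chi> i. rep_l2 (F $ i) y / \<rho> y)"
  have G: "rep_l2 (F $ i) y = G y $ i * \<rho> y" if "y \<in> S" for y i
    using pos[OF that] by (simp add: G_def)
  have Fi: "F $ i = ext_l2 S (rep_l2 (F $ i))" for i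
    using F by (simp add: grad_graph_def ext_l2_rep_l2[OF SL])
  then have "F = (\<chi> i. ext_l2 S (rep_l2 (F $ i)))" by (simp add: vec_eq_iff)
  then have wg: "weak_grad S (\<lambda>y. z y / \<rho> y) G"
    using weak_grad_iff_grad_graph[OF z rep_l2_in_L2[OF SL], of "\<lambda>i. F $ i" G] G F by simp
  have ind: "(\<lambda>y. indicator S y * (G y $ i * \<rho> y)) = (\<lambda>y. indicator S y * rep_l2 (F $ i) y)" for i
    using G by (auto simp: indicator_def fun_eq_iff)
  then have L: "(\<lambda>y. G y $ i * \<rho> y) \<in> L2 S" for i
    using rep_l2_in_L2[OF SL, of "F $ i"] by (simp add: L2_iff_square_integrable[OF SL])
  then have "integrable (lebesgue_on S) (\<lambda>y. (norm (G y))\<^sup>2 * (\<rho> y)\<^sup>2)"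
    using energy_iff_L2[of G] weak_grad_measurable[OF wg] by blast
  moreover have "F = grad_l2 G"
    using Fi ind by (simp add: grad_l2_def vec_eq_iff ext_l2_def)
  ultimately show thesis using that wg by blast
qed

lemma weak_grad_inner_measurable:
  assumes "weak_grad S f G" "weak_grad S h H"
  shows "(\<lambda>y. (G y \<bullet> H y) * (\<rho> y)\<^sup>2) \<in> borel_measurable (lebesgue_on S)"
  unfolding inner_vec_def inner_real_def
  by (intro borel_measurable_times borel_measurable_sum borel_measurable_power rho_measurable
      weak_grad_measurable[OF assms(1)] weak_grad_measurable[OF assms(2)])

lemma integral_weak_grad_cong:
  assumes "weak_grad S f G1" "weak_grad S f G2" "weak_grad S h H1" "weak_grad S h H2"
  shows "(\<integral>y. (G1 y \<bullet> H1 y) * (\<rho> y)\<^sup>2 \<partial>lebesgue_on S) = (\<integral>y. (G2 y \<bullet> H2 y) * (\<rho> y)\<^sup>2 \<partial>lebesgue_on S)"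
proof (rule integral_cong_AE)
  show "AE y in lebesgue_on S. (G1 y \<bullet> H1 y) * (\<rho> y)\<^sup>2 = (G2 y \<bullet> H2 y) * (\<rho> y)\<^sup>2"
    using weak_grad_unique[OF open_S assms(1,2)] weak_grad_unique[OF open_S assms(3,4)]
    by eventually_elim simp
qed (rule weak_grad_inner_measurable; fact assms)+

text \<open>One direction turns every graph pair into a function of the form domain; the other rests
  on the integral being independent of the choice of weak gradients.\<close>

lemma form_op_iff:
  assumes z: "z \<in> L2 S" and g: "g \<in> L2 S"
  shows "form_op z g \<longleftrightarrow> (ext_l2 S z, ext_l2 S g) \<in> op_l2"
proof
  assume op: "form_op z g"
  then obtain G where G: "weak_grad S (\<lambda>y. z y / \<rho> y) G"
      "integrable (lebesgue_on S) (\<lambda>y. (norm (G y))\<^sup>2 * (\<rho> y)\<^sup>2)"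
    unfolding form_op_def form_domain_def by blast
  note GL = weak_grad_imp_grad_graph[OF z G]
  have "- (grad_l2 G \<bullet> P) = ext_l2 S g \<bullet> p" if pP: "(p, P) \<in> grad_graph" for p P
  proof -
    \<comment> \<open>\<open>p\<close> may be nonzero off \<open>S\<close>. The form sees only its
      projection, and the pairing with \<open>ext_l2 S g\<close> does not notice the change.\<close>
    define \<psi> where "\<psi> = rep_l2 p"
    have \<psi>: "\<psi> \<in> L2 S" unfolding \<psi>_def by (rule rep_l2_in_L2[OF SL])
    have ext: "ext_l2 S \<psi> = proj_l2 S p" by (simp add: \<psi>_def ext_l2_rep_l2[OF SL])
    have "(ext_l2 S \<psi>, P) \<in> grad_graph" unfolding ext by (rule grad_graph_proj[OF pP])
    then obtain H where H: "weak_grad S (\<lambda>y. \<psi> y / \<rho> y) H"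
        "integrable (lebesgue_on S) (\<lambda>y. (norm (H y))\<^sup>2 * (\<rho> y)\<^sup>2)" "P = grad_l2 H"
      by (rule grad_graph_imp_weak_grad[OF \<psi>])
    note HL = weak_grad_imp_grad_graph[OF \<psi> H(1,2)]
    have "\<psi> \<in> form_domain" using \<psi> H unfolding form_domain_def by blast
    then have "- (\<integral>y. (G y \<bullet> H y) * (\<rho> y)\<^sup>2 \<partial>lebesgue_on S) = (\<integral>y. g y * \<psi> y \<partial>lebesgue_on S)"
      using op G(1) H(1) unfolding form_op_def by blast
    then have "- (grad_l2 G \<bullet> P) = ext_l2 S g \<bullet> ext_l2 S \<psi>"
      by (simp add: H(3) inner_grad_l2[OF GL(1) HL(1)] inner_ext_l2[OF SL g \<psi>])
    then show ?thesis by (simp add: ext inner_ext_l2_proj_l2[OF SL g])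
  qed
  then show "(ext_l2 S z, ext_l2 S g) \<in> op_l2"
    using GL(2) unfolding op_l2_def minus_adjoint_square_def by blast
next
  assume "(ext_l2 S z, ext_l2 S g) \<in> op_l2"
  then obtain F where F: "(ext_l2 S z, F) \<in> grad_graph"
    "\<And>p P. (p, P) \<in> grad_graph \<Longrightarrow> - (F \<bullet> P) = ext_l2 S g \<bullet> p"
    unfolding op_l2_def minus_adjoint_square_def by blast
  obtain G where G: "weak_grad S (\<lambda>y. z y / \<rho> y) G"
    "integrable (lebesgue_on S) (\<lambda>y. (norm (G y))\<^sup>2 * (\<rho> y)\<^sup>2)" "F = grad_l2 G"
    using grad_graph_imp_weak_grad[OF z F(1)] by blast
  note GL = weak_grad_imp_grad_graph[OF z G(1,2)]
  have "z \<in> form_domain" using z G unfolding form_domain_def by blast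
  moreover have "- (\<integral>y. (Gz y \<bullet> G\<psi> y) * (\<rho> y)\<^sup>2 \<partial>lebesgue_on S) = (\<integral>y. g y * \<psi> y \<partial>lebesgue_on S)"
    if \<psi>H: "\<psi> \<in> form_domain" and Gz: "weak_grad S (\<lambda>y. z y / \<rho> y) Gz"
      and G\<psi>: "weak_grad S (\<lambda>y. \<psi> y / \<rho> y) G\<psi>" for \<psi> Gz G\<psi>
  proof -
    obtain H where \<psi>: "\<psi> \<in> L2 S" and H: "weak_grad S (\<lambda>y. \<psi> y / \<rho> y) H"
      "integrable (lebesgue_on S) (\<lambda>y. (norm (H y))\<^sup>2 * (\<rho> y)\<^sup>2)"
      using \<psi>H unfolding form_domain_def by blast
    note HL = weak_grad_imp_grad_graph[OF \<psi> H]
    have "(\<integral>y. (Gz y \<bullet> G\<psi> y) * (\<rho> y)\<^sup>2 \<partial>lebesgue_on S) = grad_l2 G \<bullet> grad_l2 H"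
      unfolding inner_grad_l2[OF GL(1) HL(1)] by (rule integral_weak_grad_cong[OF Gz G(1) G\<psi> H(1)])
    then show ?thesis using F(2)[OF HL(2)] by (simp add: G(3) inner_ext_l2[OF SL g \<psi>])
  qed
  ultimately show "form_op z g" using g unfolding form_op_def by blast
qed

lemma form_op_L2: "form_op z g \<Longrightarrow> z \<in> L2 S \<and> g \<in> L2 S"
  by (auto simp: form_op_def form_domain_def)

lemma L2norm_diff:
  assumes "f \<in> L2 S" "g \<in> L2 S"
  shows "L2norm S (\<lambda>y. f y - g y) = norm (ext_l2 S f - ext_l2 S g)"
  using assms by (simp add: norm_ext_l2[OF SL, symmetric] L2_diff[OF SL] ext_l2_diff[OF SL])

text \<open>\<open>op_l2\<close> has a closed graph, so limits of \<open>form_op\<close> pairs stay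
  in it; constant sequences give the converse.\<close>

lemma op_closure_form_op_iff:
  "op_closure S form_op f g \<longleftrightarrow> f \<in> L2 S \<and> g \<in> L2 S \<and> (ext_l2 S f, ext_l2 S g) \<in> op_l2"
proof
  assume "op_closure S form_op f g"
  then obtain fs gs where L: "f \<in> L2 S" "g \<in> L2 S" and A: "\<And>n. form_op (fs n) (gs n)"
    and lim: "(\<lambda>n. L2norm S (\<lambda>y. fs n y - f y)) \<longlonglongrightarrow> 0" "(\<lambda>n. L2norm S (\<lambda>y. gs n y - g y)) \<longlonglongrightarrow> 0"
    unfolding op_closure_def by blast
  have Ln: "fs n \<in> L2 S" "gs n \<in> L2 S" for n using form_op_L2[OF A] by auto
  have e: "(\<lambda>n. ext_l2 S (fs n)) \<longlonglongrightarrow> ext_l2 S f" "(\<lambda>n. ext_l2 S (gs n)) \<longlonglongrightarrow> ext_l2 S g"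
    using lim by (simp_all add: L2norm_diff L Ln tendsto_norm_zero_iff LIM_zero_iff)
  have "(ext_l2 S (fs n), ext_l2 S (gs n)) \<in> op_l2" for n
    using A form_op_iff[OF Ln] by blast
  from op.closed_graph[OF this e] show "f \<in> L2 S \<and> g \<in> L2 S \<and> (ext_l2 S f, ext_l2 S g) \<in> op_l2"
    using L by simp
next
  assume A: "f \<in> L2 S \<and> g \<in> L2 S \<and> (ext_l2 S f, ext_l2 S g) \<in> op_l2"
  then have "form_op f g" using form_op_iff by blast
  then show "op_closure S form_op f g"
    using A unfolding op_closure_def
    by (intro conjI exI[of _ "\<lambda>_. f"] exI[of _ "\<lambda>_. g"]) (auto simp: L2norm_def)
qed

text \<open>A choice of representatives, so the semigroup laws hold almost everywhere, as
  \<open>C0_contraction_semigroup\<close> asks.\<close>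

definition l2_semigroup :: "real \<Rightarrow> (real^'n \<Rightarrow> real) \<Rightarrow> real^'n \<Rightarrow> real" where
  "l2_semigroup t f = rep_l2 (op.sgr t (ext_l2 S f))"

lemma l2_semigroup_L2: "l2_semigroup t f \<in> L2 S"
  unfolding l2_semigroup_def by (rule rep_l2_in_L2[OF SL])

text \<open>A representative could be nonzero off \<open>S\<close>. As \<open>op_l2\<close> is
  stable under the projection, \<open>sgr\<close> commutes with it, so the orbit of an extension by
  zero consists of such extensions.\<close>

lemma ext_l2_semigroup:
  assumes "f \<in> L2 S"
  shows "ext_l2 S (l2_semigroup t f) = op.sgr t (ext_l2 S f)"
proof -
  have "ext_l2 S (l2_semigroup t f) = proj_l2 S (op.sgr t (ext_l2 S f))"
    by (simp add: l2_semigroup_def ext_l2_rep_l2[OF SL])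
  also have "\<dots> = op.sgr t (proj_l2 S (ext_l2 S f))"
    by (rule op.sgr_commute[symmetric, OF linear_proj_l2[OF SL] continuous_on_proj_l2[OF SL] op_l2_proj])
  finally show ?thesis by (simp add: proj_l2_ext_l2[OF SL assms])
qed

lemma C0_semigroup: "C0_contraction_semigroup S l2_semigroup"
  unfolding C0_contraction_semigroup_def
proof (intro conjI allI ballI impI)
  fix t f assume "f \<in> L2 S"
  show "l2_semigroup t f \<in> L2 S" by (rule l2_semigroup_L2)
next
  fix t f g assume "f \<in> L2 S" "g \<in> L2 S" "ae_eq S f g"
  then show "ae_eq S (l2_semigroup t f) (l2_semigroup t g)"
    by (simp add: ext_l2_eq_iff[OF SL, symmetric] l2_semigroup_L2 ext_l2_semigroup)
next
  fix t f g and a b :: real assume fg: "f \<in> L2 S" "g \<in> L2 S"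
  then show "ae_eq S (l2_semigroup t (\<lambda>y. a * f y + b * g y)) (\<lambda>y. a * l2_semigroup t f y + b * l2_semigroup t g y)"
    by (simp add: ext_l2_eq_iff[OF SL, symmetric] l2_semigroup_L2 ext_l2_semigroup L2_add[OF SL] L2_scale[OF SL]
        ext_l2_add[OF SL] ext_l2_scale[OF SL] linear_add[OF op.linear_sgr] linear_scale[OF op.linear_sgr])
next
  fix f assume "f \<in> L2 S"
  then show "ae_eq S (l2_semigroup 0 f) f"
    by (simp add: ext_l2_eq_iff[OF SL, symmetric] l2_semigroup_L2 ext_l2_semigroup op.sgr_0)
next
  fix s t :: real and f assume "s \<ge> 0" "t \<ge> 0" "f \<in> L2 S"
  then show "ae_eq S (l2_semigroup (s + t) f) (l2_semigroup s (l2_semigroup t f))"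
    by (simp add: ext_l2_eq_iff[OF SL, symmetric] l2_semigroup_L2 ext_l2_semigroup op.sgr_add)
next
  fix t f assume "f \<in> L2 S"
  then show "L2norm S (l2_semigroup t f) \<le> L2norm S f"
    by (simp add: norm_ext_l2[OF SL, symmetric] l2_semigroup_L2 ext_l2_semigroup op.norm_sgr)
next
  fix f assume f: "f \<in> L2 S"
  have "((\<lambda>t. norm (op.sgr t (ext_l2 S f) - ext_l2 S f)) \<longlongrightarrow> 0) (at_right 0)"
    using op.sgr_tendsto[of "ext_l2 S f"] by (simp add: tendsto_norm_zero_iff LIM_zero_iff)
  then show "((\<lambda>t. L2norm S (\<lambda>y. l2_semigroup t f y - f y)) \<longlongrightarrow> 0) (at_right 0)"
    by (simp add: L2norm_diff l2_semigroup_L2 f ext_l2_semigroup)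
qed

lemma generator_l2_semigroup_iff:
  "generator S l2_semigroup f g \<longleftrightarrow> f \<in> L2 S \<and> g \<in> L2 S \<and> (ext_l2 S f, ext_l2 S g) \<in> op_l2"
proof -
  have "L2norm S (\<lambda>y. (l2_semigroup h f y - f y) / h - g y)
      = norm ((1/h) *\<^sub>R (op.sgr h (ext_l2 S f) - ext_l2 S f) - ext_l2 S g)"
    if f: "f \<in> L2 S" and g: "g \<in> L2 S" for h
  proof -
    have d: "(\<lambda>y. l2_semigroup h f y - f y) \<in> L2 S" by (rule L2_diff[OF SL l2_semigroup_L2 f])
    have "L2norm S (\<lambda>y. (1/h) * (l2_semigroup h f y - f y) - g y)
        = norm (ext_l2 S (\<lambda>y. (1/h) * (l2_semigroup h f y - f y)) - ext_l2 S g)"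
      by (rule L2norm_diff[OF L2_scale[OF SL d] g])
    also have "ext_l2 S (\<lambda>y. (1/h) * (l2_semigroup h f y - f y)) = (1/h) *\<^sub>R (op.sgr h (ext_l2 S f) - ext_l2 S f)"
      unfolding ext_l2_scale[OF SL d] ext_l2_diff[OF SL l2_semigroup_L2 f] ext_l2_semigroup[OF f] ..
    finally show ?thesis by simp
  qed
  then show ?thesis
    unfolding generator_def op.generator_sgr[symmetric]
    by (simp add: tendsto_norm_zero_iff LIM_zero_iff cong: conj_cong)
qed

text \<open>Generator and closure are characterised by the same membership in \<open>op_l2\<close>,
  so each pair is its own witness in \<open>graph_eq\<close>.\<close>

theorem generates_form_op: "generates_C0_contraction_semigroup S (op_closure S form_op)"
proof -
  have "ae_eq S f f" for f :: "real^'n \<Rightarrow> real" by (simp add: ae_eq_def)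
  then have "graph_eq S (generator S l2_semigroup) (op_closure S form_op)"
    unfolding graph_eq_def generator_l2_semigroup_iff op_closure_form_op_iff by blast
  then show ?thesis
    using C0_semigroup unfolding generates_C0_contraction_semigroup_def by blast
qed

end

section \<open>The stationary density\<close>

text \<open>A zero integral would make the open set null, but nonempty open sets are not
  negligible.\<close>

lemma set_lebesgue_integral_pos:
  fixes f :: "'a::euclidean_space \<Rightarrow> real"
  assumes S: "open S" "S \<noteq> {}" and f: "set_integrable lborel S f" and pos: "\<And>x. x \<in> S \<Longrightarrow> f x > 0"
  shows "(LINT x:S|lborel. f x) > 0"
proof -
  let ?g = "\<lambda>x. indicator S x *\<^sub>R f x"
  have g: "integrable lborel ?g" using f by (simp add: set_integrable_def)
  have nn: "?g x \<ge> 0" for x using pos[of x] by (auto simp: indicator_def)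
  have "(\<integral>x. ?g x \<partial>lborel) \<noteq> 0"
  proof
    assume "(\<integral>x. ?g x \<partial>lborel) = 0"
    then have "AE x in lborel. ?g x = 0" using integral_nonneg_eq_0_iff_AE[OF g] nn by simp
    then have "AE x in lborel. x \<notin> S" by eventually_elim (use pos in force)
    then have "S \<in> null_sets lborel" using S(1) by (simp add: AE_iff_null_sets)
    then have "negligible S" by (simp add: negligible_iff_null_sets null_sets_completionI)
    then show False using open_not_negligible[OF S] by blast
  qed
  moreover have "(\<integral>x. ?g x \<partial>lborel) \<ge> 0" using nn by (intro integral_nonneg_AE) auto
  ultimately show ?thesis by (simp add: set_lebesgue_integral_def)
qed

section \<open>Bounds for the potential and the normalising integral\<close>

context
  fixes N :: real and \<gamma> \<eta> :: "real^'n" and \<mu> :: real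
  assumes N: "N > 0" and \<mu>: "4 * N * \<mu> \<ge> 1/2"
begin

lemma xi_xmap_bounds:
  fixes y :: "real^'n"
  assumes "y \<in> Omega_y N"
  shows "0 < xi (xmap N y $ i)" "xi (xmap N y $ i) \<le> 1" "\<bar>xi' (xmap N y $ i)\<bar> \<le> 1"
proof -
  define \<theta> where "\<theta> = y $ i / (4 * sqrt N)"
  have y: "0 < y $ i" "y $ i < 2 * pi * sqrt N"
    using assms by (auto simp: Omega_y_def YN_def mem_box_cart)
  \<comment> \<open>The side length \<open>2 * pi * sqrt N\<close> makes the angle range over
    \<open>(0, pi / 2)\<close>, where sine and cosine are positive.\<close>
  have th: "0 < \<theta>" "\<theta> < pi / 2" using y N by (auto simp: \<theta>_def field_simps)
  have sc: "sin \<theta> > 0" "cos \<theta> > 0" using th by (auto intro: sin_gt_zero cos_gt_zero)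
  have x: "xmap N y $ i = (sin \<theta>)\<^sup>2" by (simp add: xmap_def \<theta>_def)
  have eq: "xi (xmap N y $ i) = (sin \<theta>)\<^sup>2 * (cos \<theta>)\<^sup>2"
    unfolding x xi_def by (simp add: cos_squared_eq)
  have le: "(sin \<theta>)\<^sup>2 \<le> 1" "(cos \<theta>)\<^sup>2 \<le> 1" by (simp_all add: abs_square_le_1)
  show "0 < xi (xmap N y $ i)" unfolding eq using sc by simp
  show "xi (xmap N y $ i) \<le> 1" unfolding eq using le by (simp add: mult_le_one)
  show "\<bar>xi' (xmap N y $ i)\<bar> \<le> 1" unfolding x xi'_def using le by (simp add: abs_le_iff)
qed

lemma Jac_pos: "y \<in> Omega_y N \<Longrightarrow> Jac N (xmap N y :: real^'n) > 0"
  unfolding Jac_def using N xi_xmap_bounds(1)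
  by (intro mult_pos_pos prod_pos) (auto simp: zero_less_power)

lemma continuous_on_W: "continuous_on (Omega_y N) (W N \<gamma> \<eta> \<mu>)"
proof -
  have x: "continuous_on (Omega_y N :: (real^'n) set) (\<lambda>y. xmap N y $ i)" for i
    unfolding xmap_def using N by (auto intro!: continuous_intros)
  have xi: "continuous_on (Omega_y N :: (real^'n) set) (\<lambda>y. xi (xmap N y $ i))" for i
    unfolding xi_def by (intro continuous_intros x)
  have lnxi: "continuous_on (Omega_y N :: (real^'n) set) (\<lambda>y. ln (xi (xmap N y $ i)))" for i
    using xi_xmap_bounds(1) by (intro continuous_intros xi) (metis less_irrefl)
  have J: "continuous_on (Omega_y N :: (real^'n) set) (\<lambda>y. Jac N (xmap N y))"
    unfolding Jac_def by (intro continuous_intros xi)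
  have lnJ: "continuous_on (Omega_y N :: (real^'n) set) (\<lambda>y. ln (Jac N (xmap N y)))"
    using Jac_pos by (intro continuous_intros J) (metis less_irrefl)
  show ?thesis
    unfolding W_def[abs_def] Phi_def xi'_def
    by (intro lnJ lnxi xi x continuous_on_diff continuous_on_add continuous_on_mult continuous_on_sum
        continuous_on_minus continuous_on_const)
qed

text \<open>In \<open>- W\<close> the coefficient of each \<open>ln (xi ...)\<close> is -1 from the
  first sum, \<open>4 * N * \<mu>\<close> from \<open>Phi\<close> and 1/2 from the Jacobian, in
  total \<open>4 * N * \<mu> - 1/2 \<ge> 0\<close>. As \<open>xi\<close> is at most 1 here, these
  terms are at most 0; all others are bounded.\<close>

lemma W_bounded_below: "\<exists>C. \<forall>y\<in>Omega_y N. - W N \<gamma> \<eta> \<mu> y \<le> C"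
proof (intro exI ballI)
  fix y :: "real^'n" assume y: "y \<in> Omega_y N"
  define X where "X i = xi (xmap N y $ i)" for i
  define X' where "X' i = xi' (xmap N y $ i)" for i
  note b = xi_xmap_bounds[OF y, folded X_def X'_def]
  define c where "c = inverse ((2 * sqrt N) ^ CARD('n))"
  have c: "c > 0" using N by (simp add: c_def)
  have "ln (Jac N (xmap N y)) = ln c + (\<Sum>i\<in>UNIV. ln (sqrt (X i)))"
    unfolding Jac_def using b(1) c
    by (fold c_def X_def) (subst ln_mult; simp add: ln_prod prod_pos less_imp_neq[symmetric])
  also have "(\<Sum>i\<in>UNIV. ln (sqrt (X i))) = (1/2) * (\<Sum>i\<in>UNIV. ln (X i))"
    unfolding sum_distrib_left by (intro sum.cong refl) (simp add: ln_sqrt less_imp_le[OF b(1)])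
  finally have J: "ln (Jac N (xmap N y)) = ln c + (1/2) * (\<Sum>i\<in>UNIV. ln (X i))" .
  have "- W N \<gamma> \<eta> \<mu> y = (4 * N * \<mu> - 1/2) * (\<Sum>i\<in>UNIV. ln (X i)) + ln c
      + 2 * N * (- (\<Sum>i\<in>UNIV. \<gamma> $ i * X' i)) + 4 * N * (\<Sum>i\<in>UNIV. \<eta> $ i * X i)"
    unfolding W_def Phi_def J by (fold X_def X'_def) (simp add: algebra_simps)
  also have "\<dots> \<le> 0 + ln c + 2 * N * (\<Sum>i\<in>UNIV. \<bar>\<gamma> $ i\<bar>) + 4 * N * (\<Sum>i\<in>UNIV. \<bar>\<eta> $ i\<bar>)"
  proof (intro add_mono order_refl mult_left_mono)
    have "(\<Sum>i\<in>UNIV. ln (X i)) \<le> 0" using b by (intro sum_nonpos) simp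
    then show "(4 * N * \<mu> - 1/2) * (\<Sum>i\<in>UNIV. ln (X i)) \<le> 0"
      using \<mu> by (intro mult_nonneg_nonpos) auto
    have "- (\<gamma> $ i * X' i) \<le> \<bar>\<gamma> $ i\<bar>" for i
      using mult_left_mono[OF b(3)[of i], of "\<bar>\<gamma> $ i\<bar>"] abs_ge_minus_self[of "\<gamma> $ i * X' i"]
      by (simp add: abs_mult)
    then show "- (\<Sum>i\<in>UNIV. \<gamma> $ i * X' i) \<le> (\<Sum>i\<in>UNIV. \<bar>\<gamma> $ i\<bar>)"
      unfolding sum_negf[symmetric] by (rule sum_mono)
    have "\<eta> $ i * X i \<le> \<bar>\<eta> $ i\<bar>" for i
      using mult_left_mono[OF b(2)[of i], of "\<bar>\<eta> $ i\<bar>"]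
        mult_right_mono[OF abs_ge_self less_imp_le[OF b(1)], of "\<eta> $ i" i] by simp
    then show "(\<Sum>i\<in>UNIV. \<eta> $ i * X i) \<le> (\<Sum>i\<in>UNIV. \<bar>\<eta> $ i\<bar>)"
      by (rule sum_mono)
  qed (use N in auto)
  finally show "- W N \<gamma> \<eta> \<mu> y \<le> 0 + ln (inverse ((2 * sqrt N) ^ CARD('n)))
      + 2 * N * (\<Sum>i\<in>UNIV. \<bar>\<gamma> $ i\<bar>) + 4 * N * (\<Sum>i\<in>UNIV. \<bar>\<eta> $ i\<bar>)"
    by (simp add: c_def)
qed

text \<open>The integrand is bounded on a box of finite volume. Integrability matters: otherwise the
  integral would take the default value 0, and \<open>ubar\<close> would be 0 as well.\<close>

lemma partition_function_pos: "(LINT v:Omega_y N|lborel. exp (- W N \<gamma> \<eta> \<mu> v)) > 0"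
proof (rule set_lebesgue_integral_pos)
  show op: "open (Omega_y N :: (real^'n) set)" by (simp add: Omega_y_def open_box)
  have "(\<chi> i. pi * sqrt N) \<in> (Omega_y N :: (real^'n) set)"
    using N by (simp add: Omega_y_def YN_def mem_box_cart)
  then show "(Omega_y N :: (real^'n) set) \<noteq> {}" by blast
  obtain C where C: "\<And>y. y \<in> Omega_y N \<Longrightarrow> - W N \<gamma> \<eta> \<mu> y \<le> C" using W_bounded_below by blast
  show "set_integrable lborel (Omega_y N) (\<lambda>v. exp (- W N \<gamma> \<eta> \<mu> v))"
    unfolding set_integrable_def
  proof (rule Bochner_Integration.integrable_bound)
    have "emeasure lborel (Omega_y N :: (real^'n) set) < \<infinity>"
      by (simp add: Omega_y_def emeasure_lborel_box_eq)
    then show "integrable lborel (\<lambda>v::real^'n. indicator (Omega_y N) v *\<^sub>R exp C)"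
      using op by (intro integrable_scaleR_left integrable_real_indicator) auto
    have "(\<lambda>v. indicator (Omega_y N) v *\<^sub>R exp (- W N \<gamma> \<eta> \<mu> v)) \<in> borel_measurable borel"
      using op by (intro borel_measurable_continuous_on_indicator continuous_intros continuous_on_W) auto
    then show "(\<lambda>v. indicator (Omega_y N) v *\<^sub>R exp (- W N \<gamma> \<eta> \<mu> v)) \<in> borel_measurable lborel" by simp
    show "AE v in lborel. norm (indicator (Omega_y N) v *\<^sub>R exp (- W N \<gamma> \<eta> \<mu> v))
        \<le> norm (indicator (Omega_y N) v *\<^sub>R exp C)"
      using C by (intro AE_I2) (auto simp: indicator_def)
  qed
qed simp

text \<open>The numerator is an exponential, so this covers every \<open>y\<close>, also outside the
  box, and squaring the root of \<open>ubar\<close> gives it back without a side condition.\<close>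

lemma ubar_pos: "ubar N \<gamma> \<eta> \<mu> y > 0"
  using partition_function_pos by (simp add: ubar_def)

lemma weighted_domain_ubar: "weighted_domain (Omega_y N) (\<lambda>y. sqrt (ubar N \<gamma> \<eta> \<mu> y))"
proof
  show "open (Omega_y N :: (real^'n) set)" by (simp add: Omega_y_def open_box)
  show "continuous_on (Omega_y N) (\<lambda>y. sqrt (ubar N \<gamma> \<eta> \<mu> y))"
    unfolding ubar_def using partition_function_pos
    by (intro continuous_intros continuous_on_W) auto
qed (simp add: ubar_pos)

end

theorem theorem3p4:
  fixes N \<mu> :: real and \<gamma> \<eta> :: "real^'n"
  assumes "N > 0" and "\<mu> > 0" and "4 * N * \<mu> \<ge> 1/2"
  shows "generates_C0_contraction_semigroup (Omega_y N) (op_closure (Omega_y N) (Lop N \<gamma> \<eta> \<mu>))"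
proof -
  interpret weighted_domain "Omega_y N" "\<lambda>y. sqrt (ubar N \<gamma> \<eta> \<mu> y)"
    by (rule weighted_domain_ubar[OF assms(1,3)])
  have sq: "(sqrt (ubar N \<gamma> \<eta> \<mu> y))\<^sup>2 = ubar N \<gamma> \<eta> \<mu> y" for y
    using ubar_pos[OF assms(1,3), of \<gamma> \<eta> y] by simp
  \<comment> \<open>Once \<open>\<rho>\<^sup>2\<close> is rewritten to \<open>ubar\<close>, the
    abstract definitions unfold to those of the statement.\<close>
  have "form_domain = Hy N \<gamma> \<eta> \<mu>"
    unfolding form_domain_def Hy_def sq ..
  then have "form_op = Lop N \<gamma> \<eta> \<mu>"
    unfolding form_op_def[abs_def] Lop_def[abs_def] sq by simp
  then show ?thesis using generates_form_op by simp
qed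

end
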